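(* Let $\mathscr I$ be the monoid of all injective unary operations on $\mathbb N$. Then $\mathscr I$ is the smallest locally closed monoid containing all permutations of $\mathbb N$, and, with $I_{\mathscr I}$ the set of local clones $\mathscr C$ with $\mathscr C\cap\mathscr O^{(1)}=\mathscr I$ ordered by inclusion: (1) The largest element $\mathrm{Pol}(\mathscr I)$ of $I_{\mathscr I}$ equals $\mathrm{Pol}(\{\neq\})$, where $\neq$ is the binary inequality relation on $\mathbb N$. (2) $\mathscr H$ is the unique cover of $\langle\mathscr I\rangle$ in $I_{\mathscr I}$, and every element of $I_{\mathscr I}$ other than $\langle\mathscr I\rangle$ contains $\mathscr H$. Moreover $\mathscr H$ is generated (as a local clone together with all permutations) by any binary injection, and $\mathrm{Inv}(\mathscr H)$ consists exactly of the relations on $\mathbb N$ definable by a Horn formula. (3) $\mathscr B$ is the unique cover of $\mathscr H$ in $I_{\mathscr I}$, and every element of $I_{\mathscr I}$ other than $\langle\mathscr I\rangle$ and $\mathscr H$ contains $\mathscr B$. (4) $\mathscr R$ and $\mathscr S$ are incomparable elements of $I_{\mathscr I}$, and every element of $I_{\mathscr I}$ is either contained in $\mathscr S$ or contains $\mathscr R$. (5) The power set of $\omega$, ordered by reverse inclusion, order-embeds into the interval $[\mathscr R,\mathrm{Pol}(\mathscr I)]$; consequently the interval $I_{\mathscr I}$, and the set of all local clones on $\mathbb N$ containing all permutations, have cardinality $2^{\aleph_0}$ and admit such an embedding.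
   Context: $\mathscr O^{(n)}$: maps $\mathbb N^n\to\mathbb N$; $\mathscr O=\bigcup_n\mathscr O^{(n)}$. A clone is a subset of $\mathscr O$ containing all projections and closed under composition; it is local if each $n$-ary part is closed in the product topology of discrete topologies. For $\mathscr F\subseteq\mathscr O$, $\langle\mathscr F\rangle$ is the smallest local clone containing $\mathscr F$ and all permutations of $\mathbb N$. $\mathrm{Pol}(\mathscr M)$ for a monoid $\mathscr M$ is the set of all $f\in\mathscr O^{(n)}$ (all $n$) with $f(g_1,\dots,g_n)\in\mathscr M$ whenever $g_1,\dots,g_n\in\mathscr M$; $\mathrm{Pol}(\{\neq\})$ is the set of operations preserving $\neq$ (applied componentwise); $\mathrm{Inv}(\mathscr F)$ is the set of relations preserved by all operations in $\mathscr F$. $\mathscr H$ is the set of operations that are injective up to fictitious variables (i.e. of the form $i(x_{j_1},\dots,x_{j_m})$ with $i$ injective). A binary $f$ is a $k$-bar function ($k\ge1$) if there is an injection $p\in\mathscr O^{(2)}$ with $f(x_1,x_2)=p(x_1,x_2)$ for $x_1\ge k$ and $f(x_1,x_2)=p(x_1,0)=x_1$ for $x_1<k$; $\mathscr B=\langle\{f\}\rangle$ for any bar function $f$ (independent of the choice). An $n$-ary $f$ is injective in the $i$-th direction if $f(a)\neq f(b)$ whenever $a_i\neq b_i$; $\mathscr R$ is the set of all operations injective in at least one direction. Let $f_3\in\mathscr O^{(3)}$ satisfy $f_3(x,1,1)=1$, $f_3(2,x,2)=2$, $f_3(3,3,x)=3$ for all $x$, and take on every other argument a value distinct from all other values of $f_3$;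 $\mathscr S=\langle\{f_3\}\rangle$. A Horn formula is a quantifier-free formula in conjunctive normal form whose atoms are of the form $x=y$, each clause containing at most one positive literal. *)

theory Defs
  imports "HOL-Analysis.Analysis" "HOL-Library.Equipollence"
begin

definition tuples :: "nat \<Rightarrow> nat list set" where
  "tuples n = {xs. length xs = n}"

text \<open>
  A finitary operation is its arity \<open>n\<close> together with a function on lists that is \<open>undefined\<close>
  outside the lists of length \<open>n\<close>, so that equality of pairs is equality of operations.
  Coordinates are numbered from 0, and operations and relations have arity at least 1.
\<close>

type_synonym oper = "nat \<times> (nat list \<Rightarrow> nat)"

definition ops :: "nat \<Rightarrow> oper set" where
  "ops n = {n} \<times> (tuples n \<rightarrow>\<^sub>E UNIV)"

definition all_ops :: "oper set" where
  "all_ops = (\<Union>n\<in>{1..}. ops n)"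

definition proj :: "nat \<Rightarrow> nat \<Rightarrow> oper" where
  "proj n i = (n, \<lambda>xs\<in>tuples n. xs ! i)"

definition op_comp :: "nat \<Rightarrow> oper \<Rightarrow> oper list \<Rightarrow> oper" where
  "op_comp m f gs = (m, \<lambda>xs\<in>tuples m. snd f (map (\<lambda>g. snd g xs) gs))"

definition unary :: "(nat \<Rightarrow> nat) \<Rightarrow> oper" where
  "unary g = (1, \<lambda>xs\<in>tuples 1. g (hd xs))"

definition permutations :: "oper set" where
  "permutations = unary ` {g. bij g}"

definition injective_unary :: "oper set" where
  "injective_unary = unary ` {g. inj g}"


definition clone :: "oper set \<Rightarrow> bool" where
  "clone C \<longleftrightarrow> C \<subseteq> all_ops \<and>
     (\<forall>n. \<forall>i<n. proj n i \<in> C) \<and>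
     (\<forall>n\<ge>1. \<forall>m\<ge>1. \<forall>f \<in> C \<inter> ops n. \<forall>gs. length gs = n \<longrightarrow> set gs \<subseteq> C \<inter> ops m \<longrightarrow>
        op_comp m f gs \<in> C)"

definition locally_closed :: "oper set \<Rightarrow> bool" where
  "locally_closed F \<longleftrightarrow>
     (\<forall>n\<ge>1. closedin (product_topology (\<lambda>_. discrete_topology UNIV) (tuples n)) {f. (n, f) \<in> F})"

definition local_clone :: "oper set \<Rightarrow> bool" where
  "local_clone C \<longleftrightarrow> clone C \<and> locally_closed C"

definition transformation_monoid :: "oper set \<Rightarrow> bool" where
  "transformation_monoid M \<longleftrightarrow> M \<subseteq> ops 1 \<and> unary id \<in> M \<and> (\<forall>f\<in>M. \<forall>g\<in>M. op_comp 1 f [g] \<in> M)"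

definition generated :: "oper set \<Rightarrow> oper set" where
  "generated F = local_clone hull (F \<union> permutations)"

definition monoidal_interval :: "oper set \<Rightarrow> oper set set" where
  "monoidal_interval M = {C. local_clone C \<and> C \<inter> ops 1 = M}"

definition Pol_monoid :: "oper set \<Rightarrow> oper set" where
  "Pol_monoid M = {f \<in> all_ops. \<forall>gs. length gs = fst f \<longrightarrow> set gs \<subseteq> M \<longrightarrow> op_comp 1 f gs \<in> M}"


text \<open>Relations also carry their arity, so that the empty relations of different arities differ.\<close>

type_synonym rel = "nat \<times> nat list set"

definition all_rels :: "rel set" where
  "all_rels = {(k, R). k \<ge> 1 \<and> R \<subseteq> tuples k}"

definition preserves :: "oper \<Rightarrow> rel \<Rightarrow> bool" where
  "preserves f \<rho> \<longleftrightarrow>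
     (\<forall>ts. length ts = fst f \<longrightarrow> set ts \<subseteq> snd \<rho> \<longrightarrow>
        map (\<lambda>j. snd f (map (\<lambda>t. t ! j) ts)) [0..<fst \<rho>] \<in> snd \<rho>)"

definition Pol :: "rel set \<Rightarrow> oper set" where
  "Pol \<Gamma> = {f \<in> all_ops. \<forall>\<rho>\<in>\<Gamma>. preserves f \<rho>}"

definition Inv :: "oper set \<Rightarrow> rel set" where
  "Inv F = {\<rho> \<in> all_rels. \<forall>f\<in>F. preserves f \<rho>}"

definition neq_rel :: rel where
  "neq_rel = (2, {[x, y] |x y. x \<noteq> y})"


text \<open>
  \<open>Pos i j\<close> is the literal \<open>x\<^sub>i = x\<^sub>j\<close> and \<open>Neg i j\<close> is its negation; a formula in conjunctive
  normal form is a list of clauses, each clause a list of literals.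
\<close>

datatype literal = is_Pos: Pos nat nat | is_Neg: Neg nat nat

type_synonym cnf = "literal list list"

fun literal_vars :: "literal \<Rightarrow> nat set" where
  "literal_vars (Pos i j) = {i, j}"
| "literal_vars (Neg i j) = {i, j}"

fun literal_holds :: "nat list \<Rightarrow> literal \<Rightarrow> bool" where
  "literal_holds xs (Pos i j) \<longleftrightarrow> xs ! i = xs ! j"
| "literal_holds xs (Neg i j) \<longleftrightarrow> xs ! i \<noteq> xs ! j"

definition cnf_vars :: "cnf \<Rightarrow> nat set" where
  "cnf_vars \<phi> = (\<Union>c\<in>set \<phi>. \<Union>l\<in>set c. literal_vars l)"

definition cnf_holds :: "nat list \<Rightarrow> cnf \<Rightarrow> bool" where
  "cnf_holds xs \<phi> \<longleftrightarrow> (\<forall>c\<in>set \<phi>. \<exists>l\<in>set c. literal_holds xs l)"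

definition Horn :: "cnf \<Rightarrow> bool" where
  "Horn \<phi> \<longleftrightarrow> (\<forall>c\<in>set \<phi>. length (filter is_Pos c) \<le> 1)"

definition Horn_definable :: "rel \<Rightarrow> bool" where
  "Horn_definable \<rho> \<longleftrightarrow>
     (\<exists>\<phi>. Horn \<phi> \<and> cnf_vars \<phi> \<subseteq> {..<fst \<rho>} \<and> snd \<rho> = {xs \<in> tuples (fst \<rho>). cnf_holds xs \<phi>})"


definition injective_op :: "oper \<Rightarrow> bool" where
  "injective_op f \<longleftrightarrow> inj_on (snd f) (tuples (fst f))"

definition clone_H :: "oper set" where
  "clone_H = {op_comp n i (map (proj n) js) |n m i js.
     n \<ge> 1 \<and> m \<ge> 1 \<and> i \<in> ops m \<and> injective_op i \<and> length js = m \<and> set js \<subseteq> {..<n}}"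

definition k_bar_function :: "nat \<Rightarrow> oper \<Rightarrow> bool" where
  "k_bar_function k f \<longleftrightarrow> k \<ge> 1 \<and> f \<in> ops 2 \<and>
     (\<exists>p \<in> ops 2. injective_op p \<and>
        (\<forall>x y. x \<ge> k \<longrightarrow> snd f [x, y] = snd p [x, y]) \<and>
        (\<forall>x y. x < k \<longrightarrow> snd f [x, y] = snd p [x, 0] \<and> snd p [x, 0] = x))"

definition bar_function :: "oper \<Rightarrow> bool" where
  "bar_function f \<longleftrightarrow> (\<exists>k. k_bar_function k f)"

definition injective_in_direction :: "oper \<Rightarrow> nat \<Rightarrow> bool" where
  "injective_in_direction f i \<longleftrightarrow>
     (\<forall>a \<in> tuples (fst f). \<forall>b \<in> tuples (fst f). a ! i \<noteq> b ! i \<longrightarrow> snd f a \<noteq> snd f b)"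

definition clone_R :: "oper set" where
  "clone_R = {f \<in> all_ops. \<exists>i<fst f. injective_in_direction f i}"

definition is_f3 :: "oper \<Rightarrow> bool" where
  "is_f3 f \<longleftrightarrow> f \<in> ops 3 \<and>
     (\<forall>x. snd f [x, 1, 1] = 1 \<and> snd f [2, x, 2] = 2 \<and> snd f [3, 3, x] = 3) \<and>
     (\<forall>a \<in> tuples 3 - (\<Union>x. {[x, 1, 1], [2, x, 2], [3, 3, x]}).
        \<forall>b \<in> tuples 3. b \<noteq> a \<longrightarrow> snd f a \<noteq> snd f b)"

text \<open>
  \<open>bar_function\<close> and \<open>is_f3\<close> do not determine a function, so the clones generated by such
  functions are quantified over all choices; the next two facts say that choices exist.
\<close>

lemma ex_bar_function: "\<exists>f. bar_function f"
proof -
  define p where "p = (\<lambda>xs\<in>tuples 2. prod_encode (xs ! 0, xs ! 1))"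
  define f where "f = (\<lambda>xs\<in>tuples 2. if xs ! 0 < 1 then 0 else prod_encode (xs ! 0, xs ! 1))"
  have "inj_on p (tuples 2)"
    by (auto simp: inj_on_def p_def tuples_def length_Suc_conv numeral_2_eq_2)
  moreover have "prod_encode (0, 0) = 0"
    by (simp add: prod_encode_def)
  ultimately have "k_bar_function 1 (2, f)"
    unfolding k_bar_function_def injective_op_def
    by (intro conjI bexI[of _ "(2, p)"]) (auto simp: f_def p_def ops_def tuples_def)
  then show ?thesis
    unfolding bar_function_def by blast
qed

lemma ex_f3: "\<exists>f. is_f3 f"
proof -
  define g where "g xs =
    (if xs ! 1 = 1 \<and> xs ! 2 = 1 then 1 else if xs ! 0 = 2 \<and> xs ! 2 = 2 then 2
     else if xs ! 0 = 3 \<and> xs ! 1 = 3 then 3 else 4 + list_encode xs)" for xs :: "nat list"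
  have "is_f3 (3, \<lambda>xs\<in>tuples 3. g xs)"
    unfolding is_f3_def
    by (auto simp: ops_def tuples_def g_def length_Suc_conv numeral_3_eq_3 list_encode_eq
        simp del: list_encode.simps)
  then show ?thesis
    by blast
qed


definition covers :: "oper set set \<Rightarrow> oper set \<Rightarrow> oper set \<Rightarrow> bool" where
  "covers P D C \<longleftrightarrow> C \<in> P \<and> D \<in> P \<and> C \<subset> D \<and> \<not> (\<exists>E\<in>P. C \<subset> E \<and> E \<subset> D)"

definition unique_cover :: "oper set set \<Rightarrow> oper set \<Rightarrow> oper set \<Rightarrow> bool" where
  "unique_cover P D C \<longleftrightarrow> covers P D C \<and> (\<forall>E. covers P E C \<longrightarrow> E = D)"

definition reverse_powerset_embeds :: "oper set set \<Rightarrow> bool" where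
  "reverse_powerset_embeds P \<longleftrightarrow>
     (\<exists>\<Phi> :: nat set \<Rightarrow> oper set. (\<forall>A. \<Phi> A \<in> P) \<and> (\<forall>A B. B \<subseteq> A \<longleftrightarrow> \<Phi> A \<subseteq> \<Phi> B))"

end

theory Submission
  imports Defs
begin

text \<open>
  A local clone containing the permutations is determined by the kernels of its operations on finite
  sets of tuples, and its unary operations are injective iff all its operations preserve \<open>\<noteq>\<close>. So every
  part is about which kernels can be produced from a given one; this is done by minimising the number of
  unwanted collapsed (or uncollapsed) pairs on a finite grid.

  An operation depending on two variables yields a binary one with both dependencies, and iterating it
  separates all pairs of a grid. Once binary injections are available, kernels can be intersected. An
  operation outside \<open>\<H>\<close> has a collapsed and an uncollapsed pair agreeing on the same
  coordinates, and iterating it collapses one row of a grid and keeps another one apart: a bar function.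

  Let \<open>T\<close> be the relation "all equal or all distinct" on triples. A clone violating \<open>T\<close> can merge
  two points of a row and nothing else, hence contains \<open>\<R>\<close>. If an operation preserves \<open>\<noteq>\<close>
  and \<open>T\<close>, its kernel classes are subcubes, and \<open>f\<^sub>3\<close> builds such a kernel: \<open>f\<^sub>3(k\<^sub>1, k\<^sub>2, k\<^sub>3)\<close> collapses
  the given cubes when \<open>k\<^sub>i\<close> collapses all of them but the \<open>i\<close>-th. So \<open>\<S>\<close> is the clone of
  polymorphisms of \<open>\<noteq>\<close> and \<open>T\<close>.

  For the continuum, relations \<open>\<rho>\<^sub>n\<close> invariant under \<open>\<R>\<close> and operations \<open>g\<^sub>n\<close> are built from the
  directed \<open>n\<close>-cycle such that \<open>g\<^sub>m\<close> violates \<open>\<rho>\<^sub>n\<close> only if \<open>m = n\<close>.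
\<close>

subsection \<open>Operations and local clones\<close>

text \<open>Minimisation works only if repairing one pair spoils no other. For binary injections
  \<noteq> guarantees this: in \<open>g (\<alpha> (h x y)) (\<beta> x)\<close> points with different
  \<open>x\<close> and different values of \<open>h\<close> differ in both arguments of
  \<open>g\<close>, so they stay apart, while the injections \<alpha> and \<beta> are free to treat
  one chosen pair. Usually a second property has to survive the same substitution. This is why
  tuples are first made generic (fresh entries outside the coordinates where they must agree): then
  all required values can be prescribed by one finite partial injection per coordinate.

  The ternary \<open>f\<^sub>3\<close> is suited to induction because two points with the same value
  agree in at least two of the three arguments; so any two of the three inserted kernels bound what
  is collapsed.

  The cycles have length at least 3 because a collapsed pair of \<open>cycle_op\<close> differs in
  one coordinate, and two such pairs must still agree at a common third one.

  The upper bound on the number of clones comes from local closure: countably many finite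
  restrictions determine a local clone.\<close>

definition opr :: "nat \<Rightarrow> (nat list \<Rightarrow> nat) \<Rightarrow> oper" where
  "opr n F = (n, restrict F (tuples n))"

lemma mem_tuples [simp]: "xs \<in> tuples n \<longleftrightarrow> length xs = n"
  by (simp add: tuples_def)

lemma opr_eq_iff: "opr n F = opr m G \<longleftrightarrow> n = m \<and> (\<forall>xs. length xs = n \<longrightarrow> F xs = G xs)"
  unfolding opr_def by (auto simp: fun_eq_iff restrict_def)

lemma opr_cong: "(\<And>xs. length xs = n \<Longrightarrow> F xs = G xs) \<Longrightarrow> opr n F = opr n G"
  by (simp add: opr_eq_iff)

lemma opr_in_ops [simp]: "opr n F \<in> ops m \<longleftrightarrow> n = m"
  by (auto simp: opr_def ops_def)

lemma fst_opr [simp]: "fst (opr n F) = n"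
  by (simp add: opr_def)

lemma snd_opr [simp]: "length xs = n \<Longrightarrow> snd (opr n F) xs = F xs"
  by (simp add: opr_def)

lemma opr_in_all_ops [simp]: "opr n F \<in> all_ops \<longleftrightarrow> n \<ge> 1"
  by (auto simp: all_ops_def)

lemma ops_eq_opr: "f \<in> ops n \<Longrightarrow> f = opr n (snd f)"
  by (auto simp: ops_def opr_def PiE_restrict)

lemma all_ops_cases:
  assumes "f \<in> all_ops" obtains n F where "f = opr n F" "n \<ge> 1"
proof -
  obtain n where "n \<ge> 1" "f \<in> ops n"
    using assms by (auto simp: all_ops_def)
  then show ?thesis
    using ops_eq_opr that by blast
qed

lemma proj_eq_opr: "proj n i = opr n (\<lambda>xs. xs ! i)"
  by (simp add: proj_def opr_def)

lemma op_comp_eq_opr: "op_comp m f gs = opr m (\<lambda>xs. snd f (map (\<lambda>g. snd g xs) gs))"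
  by (simp add: op_comp_def opr_def)

lemma unary_eq_opr: "unary g = opr 1 (\<lambda>xs. g (hd xs))"
  by (simp add: unary_def opr_def)

text \<open>A basic open set of the product prescribes finitely many values, so a limit of the set
  is an operation that its members match on each finite set of arguments. Every later use of the
  topology goes through this criterion.\<close>

lemma locally_closed_iff:
  assumes "C \<subseteq> all_ops"
  shows "locally_closed C \<longleftrightarrow> (\<forall>n\<ge>1. \<forall>F. (\<forall>A. finite A \<longrightarrow> A \<subseteq> tuples n \<longrightarrow>
    (\<exists>G. opr n G \<in> C \<and> (\<forall>a\<in>A. G a = F a))) \<longrightarrow> opr n F \<in> C)"
proof -
  have "closedin (product_topology (\<lambda>_. discrete_topology UNIV) (tuples n)) {f. (n, f) \<in> C} \<longleftrightarrow>
    (\<forall>F. (\<forall>A. finite A \<longrightarrow> A \<subseteq> tuples n \<longrightarrow>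
      (\<exists>G. opr n G \<in> C \<and> (\<forall>a\<in>A. G a = F a))) \<longrightarrow> opr n F \<in> C)" (is "?L \<longleftrightarrow> ?R") for n
  proof -
    define E where "E = tuples n \<rightarrow>\<^sub>E (UNIV :: nat set)"
    define S where "S = {f. (n, f) \<in> C}"
    have sub: "S \<subseteq> E"
      using assms by (auto simp: all_ops_def ops_def PiE_iff E_def S_def)
    have "?L \<longleftrightarrow> (\<forall>x\<in>E - S. \<exists>U. finite {i \<in> tuples n. U i \<noteq> (UNIV :: nat set)} \<and>
        x \<in> Pi\<^sub>E (tuples n) U \<and> Pi\<^sub>E (tuples n) U \<subseteq> E - S)"
      using sub by (simp add: closedin_def openin_product_topology_alt E_def S_def)
    also have "\<dots> \<longleftrightarrow> (\<forall>x\<in>E - S. \<exists>A. finite A \<and> A \<subseteq> tuples n \<and>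
        (\<forall>y\<in>E. (\<forall>a\<in>A. y a = x a) \<longrightarrow> y \<notin> S))"
    proof (intro ball_cong refl iffI; elim exE conjE)
      fix x U
      assume x: "x \<in> E - S" and U: "finite {i \<in> tuples n. U i \<noteq> (UNIV :: nat set)}"
        "x \<in> Pi\<^sub>E (tuples n) U" "Pi\<^sub>E (tuples n) U \<subseteq> E - S"
      \<comment> \<open>\<open>U\<close> constrains only these finitely many coordinates, so
        agreement with \<open>x\<close> on them already puts \<open>y\<close> into the box.\<close>
      let ?A = "{i \<in> tuples n. U i \<noteq> (UNIV :: nat set)}"
      have "y \<in> Pi\<^sub>E (tuples n) U" if "y \<in> E" "\<forall>a\<in>?A. y a = x a" for y
      proof (rule PiE_I)
        fix i assume i: "i \<in> tuples n"
        show "y i \<in> U i"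
          using U(2) i that by (cases "U i = UNIV") (auto simp: PiE_iff)
      qed (use that in \<open>auto simp: E_def PiE_iff extensional_def\<close>)
      then show "\<exists>A. finite A \<and> A \<subseteq> tuples n \<and> (\<forall>y\<in>E. (\<forall>a\<in>A. y a = x a) \<longrightarrow> y \<notin> S)"
        using U by (intro exI[of _ ?A]) blast
    next
      fix x A
      assume x: "x \<in> E - S" and A: "finite A" "A \<subseteq> tuples n"
        "\<forall>y\<in>E. (\<forall>a\<in>A. y a = x a) \<longrightarrow> y \<notin> S"
      let ?U = "\<lambda>i. if i \<in> A then {x i} else UNIV"
      have "finite {i \<in> tuples n. ?U i \<noteq> UNIV}"
        using A(1) by (rule rev_finite_subset) auto
      moreover have "x \<in> Pi\<^sub>E (tuples n) ?U"
        using x by (auto simp: E_def PiE_iff)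
      moreover have "Pi\<^sub>E (tuples n) ?U \<subseteq> E - S"
      proof
        fix y assume y: "y \<in> Pi\<^sub>E (tuples n) ?U"
        have "y a = x a" if "a \<in> A" for a
          using PiE_mem[OF y, of a] that A(2) by auto
        moreover have "y \<in> E"
          using y by (auto simp: E_def PiE_iff)
        ultimately show "y \<in> E - S"
          using A(3) by blast
      qed
      ultimately show "\<exists>U. finite {i \<in> tuples n. U i \<noteq> (UNIV :: nat set)} \<and>
        x \<in> Pi\<^sub>E (tuples n) U \<and> Pi\<^sub>E (tuples n) U \<subseteq> E - S"
        by (intro exI[of _ ?U] conjI)
    qed
    also have "\<dots> \<longleftrightarrow> ?R"
    proof (intro iffI allI impI)
      fix F
      assume L: "\<forall>x\<in>E - S. \<exists>A. finite A \<and> A \<subseteq> tuples n \<and>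
          (\<forall>y\<in>E. (\<forall>a\<in>A. y a = x a) \<longrightarrow> y \<notin> S)"
        and F: "\<forall>A. finite A \<longrightarrow> A \<subseteq> tuples n \<longrightarrow> (\<exists>G. opr n G \<in> C \<and> (\<forall>a\<in>A. G a = F a))"
      show "opr n F \<in> C"
      proof (rule ccontr)
        assume "opr n F \<notin> C"
        then have "restrict F (tuples n) \<in> E - S"
          by (simp add: opr_def E_def S_def)
        from bspec[OF L this] obtain A where A: "finite A" "A \<subseteq> tuples n"
          "\<forall>y\<in>E. (\<forall>a\<in>A. y a = restrict F (tuples n) a) \<longrightarrow> y \<notin> S"
          by (elim exE conjE)
        from F[rule_format, OF A(1,2)] obtain G where G: "opr n G \<in> C" "\<forall>a\<in>A. G a = F a"
          by (elim exE conjE) simp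
        have "restrict G (tuples n) \<in> E"
          by (simp add: E_def)
        moreover have "\<forall>a\<in>A. restrict G (tuples n) a = restrict F (tuples n) a"
          using G(2) by (simp add: restrict_def)
        ultimately show False
          using A(3) G(1) by (auto simp: opr_def S_def)
      qed
    next
      assume R: ?R
      show "\<forall>x\<in>E - S. \<exists>A. finite A \<and> A \<subseteq> tuples n \<and>
          (\<forall>y\<in>E. (\<forall>a\<in>A. y a = x a) \<longrightarrow> y \<notin> S)"
      proof (rule ballI, rule ccontr)
        fix x assume x: "x \<in> E - S" and
          "\<nexists>A. finite A \<and> A \<subseteq> tuples n \<and> (\<forall>y\<in>E. (\<forall>a\<in>A. y a = x a) \<longrightarrow> y \<notin> S)"
        then have *: "\<exists>y\<in>E. (\<forall>a\<in>A. y a = x a) \<and> y \<in> S" if "finite A" "A \<subseteq> tuples n" for A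
          using that by blast
        have "\<exists>G. opr n G \<in> C \<and> (\<forall>a\<in>A. G a = x a)" if A: "finite A" "A \<subseteq> tuples n" for A
        proof -
          obtain y where "y \<in> E" "\<forall>a\<in>A. y a = x a" "y \<in> S"
            using *[OF A] by blast
          then show ?thesis
            by (intro exI[of _ y]) (simp add: opr_def PiE_restrict E_def S_def)
        qed
        then have "opr n x \<in> C"
          using R by blast
        moreover have "opr n x = (n, x)"
          using x PiE_restrict[of x "tuples n" "\<lambda>_. UNIV"] by (simp add: opr_def E_def)
        ultimately show False
          using x by (simp add: S_def)
      qed
    qed
    finally show ?thesis .
  qed
  then show ?thesis
    unfolding locally_closed_def by simp
qed

lemma clone_iff:
  "clone C \<longleftrightarrow> C \<subseteq> all_ops \<and> (\<forall>n. \<forall>i<n. opr n (\<lambda>xs. xs ! i) \<in> C) \<and>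
    (\<forall>n\<ge>1. \<forall>m\<ge>1. \<forall>F G. opr n F \<in> C \<longrightarrow> (\<forall>j<n. opr m (G j) \<in> C) \<longrightarrow>
      opr m (\<lambda>xs. F (map (\<lambda>j. G j xs) [0..<n])) \<in> C)" (is "?L \<longleftrightarrow> ?R")
proof
  assume L: ?L
  have "opr m (\<lambda>xs. F (map (\<lambda>j. G j xs) [0..<n])) \<in> C"
    if "n \<ge> 1" "m \<ge> 1" "opr n F \<in> C" "\<forall>j<n. opr m (G j) \<in> C" for n m :: nat and F G
  proof -
    let ?gs = "map (\<lambda>j. opr m (G j)) [0..<n]"
    have "op_comp m (opr n F) ?gs \<in> C"
    proof -
      have "set ?gs \<subseteq> C \<inter> ops m"
        using that(4) by auto
      moreover have "opr n F \<in> C \<inter> ops n"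
        using that(3) by simp
      moreover have "length ?gs = n"
        by simp
      ultimately show ?thesis
        using L that(1,2) unfolding clone_def by blast
    qed
    moreover have "op_comp m (opr n F) ?gs = opr m (\<lambda>xs. F (map (\<lambda>j. G j xs) [0..<n]))"
      unfolding op_comp_eq_opr by (rule opr_cong) (simp add: comp_def)
    ultimately show ?thesis
      by simp
  qed
  then show ?R
    using L unfolding clone_def proj_eq_opr by simp
next
  assume R: ?R
  have "op_comp m f gs \<in> C"
    if "n \<ge> 1" "m \<ge> 1" "f \<in> C" "f \<in> ops n" "length gs = n" "set gs \<subseteq> C \<inter> ops m" for n m f gs
  proof -
    have "opr m (snd (gs ! j)) \<in> C" if "j < n" for j
      using that \<open>length gs = n\<close> \<open>set gs \<subseteq> C \<inter> ops m\<close> ops_eq_opr[of "gs ! j" m] nth_mem[of j gs]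
      by (metis IntE subsetD)
    moreover have "opr n (snd f) \<in> C"
      using that ops_eq_opr by metis
    ultimately have "opr m (\<lambda>xs. snd f (map (\<lambda>j. snd (gs ! j) xs) [0..<n])) \<in> C"
      using R[THEN conjunct2, THEN conjunct2, rule_format, of n m "snd f" "\<lambda>j. snd (gs ! j)"]
        that(1,2) by simp
    moreover have "map (\<lambda>j. snd (gs ! j) xs) [0..<n] = map (\<lambda>g. snd g xs) gs" for xs
      using \<open>length gs = n\<close> by (intro nth_equalityI) auto
    ultimately show ?thesis
      by (simp add: op_comp_eq_opr)
  qed
  then show ?L
    using R unfolding clone_def proj_eq_opr by simp
qed

lemma local_cloneI:
  assumes "C \<subseteq> all_ops"
    and "\<And>n i. i < n \<Longrightarrow> opr n (\<lambda>xs. xs ! i) \<in> C"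
    and "\<And>n m F G. n \<ge> 1 \<Longrightarrow> m \<ge> 1 \<Longrightarrow> opr n F \<in> C \<Longrightarrow> (\<And>j. j < n \<Longrightarrow> opr m (G j) \<in> C) \<Longrightarrow>
      opr m (\<lambda>xs. F (map (\<lambda>j. G j xs) [0..<n])) \<in> C"
    and "\<And>n F. n \<ge> 1 \<Longrightarrow> (\<And>A. finite A \<Longrightarrow> A \<subseteq> tuples n \<Longrightarrow>
      \<exists>G. opr n G \<in> C \<and> (\<forall>a\<in>A. G a = F a)) \<Longrightarrow> opr n F \<in> C"
  shows "local_clone C"
  unfolding local_clone_def clone_iff locally_closed_iff[OF assms(1)]
proof (intro conjI allI impI)
  show "C \<subseteq> all_ops"
    by fact
next
  fix n i :: nat
  assume "i < n"
  then show "opr n (\<lambda>xs. xs ! i) \<in> C"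
    by (rule assms(2))
next
  fix n m :: nat and F G
  assume "1 \<le> n" "1 \<le> m" "opr n F \<in> C" "\<forall>j<n. opr m (G j) \<in> C"
  then show "opr m (\<lambda>xs. F (map (\<lambda>j. G j xs) [0..<n])) \<in> C"
    by (intro assms(3)) simp_all
next
  fix n :: nat and F
  assume "1 \<le> n" "\<forall>A. finite A \<longrightarrow> A \<subseteq> tuples n \<longrightarrow> (\<exists>G. opr n G \<in> C \<and> (\<forall>a\<in>A. G a = F a))"
  then show "opr n F \<in> C"
    by (intro assms(4)) simp_all
qed

lemma local_clone_subset: "local_clone C \<Longrightarrow> C \<subseteq> all_ops"
  by (simp add: local_clone_def clone_def)

lemma local_clone_proj: "local_clone C \<Longrightarrow> i < n \<Longrightarrow> opr n (\<lambda>xs. xs ! i) \<in> C"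
  by (simp add: local_clone_def clone_iff)

lemma local_clone_comp:
  assumes "local_clone C" "n \<ge> 1" "m \<ge> 1" "opr n F \<in> C" "\<And>j. j < n \<Longrightarrow> opr m (G j) \<in> C"
  shows "opr m (\<lambda>xs. F (map (\<lambda>j. G j xs) [0..<n])) \<in> C"
  using assms unfolding local_clone_def clone_iff by simp

lemma local_clone_limit:
  assumes "local_clone C" "n \<ge> 1"
    and "\<And>A. finite A \<Longrightarrow> A \<subseteq> tuples n \<Longrightarrow> \<exists>G. opr n G \<in> C \<and> (\<forall>a\<in>A. G a = F a)"
  shows "opr n F \<in> C"
proof -
  have "locally_closed C"
    using assms(1) by (simp add: local_clone_def)
  from this[unfolded locally_closed_iff[OF local_clone_subset[OF assms(1)]], rule_format, OF assms(2)]
  show ?thesis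
    using assms(3) by simp
qed

lemma local_clone_all_ops: "local_clone all_ops"
  by (rule local_cloneI) auto

lemma local_clone_Inter:
  assumes "\<And>C. C \<in> T \<Longrightarrow> local_clone C" "T \<noteq> {}"
  shows "local_clone (\<Inter>T)"
proof (rule local_cloneI)
  obtain C where "C \<in> T" "C \<subseteq> all_ops"
    using assms local_clone_subset by fast
  then show "\<Inter>T \<subseteq> all_ops"
    by auto
next
  fix n i :: nat
  assume "i < n"
  then show "opr n (\<lambda>xs. xs ! i) \<in> \<Inter>T"
    using assms(1) local_clone_proj by simp
next
  fix n m :: nat and F G
  assume nm: "n \<ge> 1" "m \<ge> 1" "opr n F \<in> \<Inter>T" "\<And>j. j < n \<Longrightarrow> opr m (G j) \<in> \<Inter>T"
  show "opr m (\<lambda>xs. F (map (\<lambda>j. G j xs) [0..<n])) \<in> \<Inter>T"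
  proof
    fix C assume "C \<in> T"
    then show "opr m (\<lambda>xs. F (map (\<lambda>j. G j xs) [0..<n])) \<in> C"
      using nm by (intro local_clone_comp assms(1)) auto
  qed
next
  fix n :: nat and F
  assume n: "n \<ge> 1"
    and *: "\<And>A. finite A \<Longrightarrow> A \<subseteq> tuples n \<Longrightarrow> \<exists>G. opr n G \<in> \<Inter>T \<and> (\<forall>a\<in>A. G a = F a)"
  show "opr n F \<in> \<Inter>T"
  proof
    fix C assume C: "C \<in> T"
    show "opr n F \<in> C"
    proof (rule local_clone_limit[OF assms(1)[OF C] n])
      fix A :: "nat list set"
      assume "finite A" "A \<subseteq> tuples n"
      from *[OF this] obtain G where "opr n G \<in> \<Inter>T" "\<forall>a\<in>A. G a = F a"
        by (elim exE conjE)
      then show "\<exists>G. opr n G \<in> C \<and> (\<forall>a\<in>A. G a = F a)"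
        using C by (intro exI[of _ G]) simp
    qed
  qed
qed

lemma permutations_subset_all_ops: "permutations \<subseteq> all_ops"
  by (auto simp: permutations_def unary_eq_opr)

lemma local_clone_generated: "F \<subseteq> all_ops \<Longrightarrow> local_clone (generated F)"
  unfolding generated_def hull_def
  by (rule local_clone_Inter) (use local_clone_all_ops permutations_subset_all_ops in auto)

lemma subset_generated: "F \<subseteq> generated F" and permutations_subset_generated: "permutations \<subseteq> generated F"
  using hull_subset[of "F \<union> permutations" local_clone] by (auto simp: generated_def)

lemma generated_minimal: "F \<subseteq> C \<Longrightarrow> permutations \<subseteq> C \<Longrightarrow> local_clone C \<Longrightarrow> generated F \<subseteq> C"
  unfolding generated_def by (rule hull_minimal) auto

section \<open>Polymorphisms of relations\<close>

lemma preserves_opr: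
  "preserves (opr n F) (k, R) \<longleftrightarrow>
    (\<forall>ts. length ts = n \<longrightarrow> set ts \<subseteq> R \<longrightarrow> map (\<lambda>j. F (map (\<lambda>t. t ! j) ts)) [0..<k] \<in> R)"
proof -
  have "map (\<lambda>j. snd (opr n F) (map (\<lambda>t. t ! j) ts)) [0..<k] = map (\<lambda>j. F (map (\<lambda>t. t ! j) ts)) [0..<k]"
    if "length ts = n" for ts :: "nat list list"
    using that by simp
  then show ?thesis
    unfolding preserves_def by simp
qed

text \<open>Preservation of a \<open>k\<close>-ary relation looks at only \<open>k\<close> argument
  tuples at a time, so it passes to limits. For compositions, the inner operations turn the given
  rows into rows \<open>us\<close> of the relation, to which the outer one is applied.\<close>

lemma local_clone_Pol:
  assumes "\<Gamma> \<subseteq> all_rels"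
  shows "local_clone (Pol \<Gamma>)"
proof (rule local_cloneI)
  show "Pol \<Gamma> \<subseteq> all_ops"
    by (auto simp: Pol_def)
next
  fix n i :: nat
  assume i: "i < n"
  have "preserves (opr n (\<lambda>xs. xs ! i)) (k, R)" if "(k, R) \<in> \<Gamma>" for k R
    unfolding preserves_opr
  proof (intro allI impI)
    fix ts :: "nat list list"
    assume ts: "length ts = n" "set ts \<subseteq> R"
    then have "ts ! i \<in> R"
      using i nth_mem by blast
    moreover have "length (ts ! i) = k"
      using assms that calculation mem_tuples by (fastforce simp: all_rels_def)
    then have "map (\<lambda>j. map (\<lambda>t. t ! j) ts ! i) [0..<k] = ts ! i"
      using ts i by (intro nth_equalityI) auto
    ultimately show "map (\<lambda>j. map (\<lambda>t. t ! j) ts ! i) [0..<k] \<in> R"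
      by simp
  qed
  then show "opr n (\<lambda>xs. xs ! i) \<in> Pol \<Gamma>"
    using i by (auto simp: Pol_def)
next
  fix n m :: nat and F G
  assume nm: "n \<ge> 1" "m \<ge> 1" and F: "opr n F \<in> Pol \<Gamma>" and G: "\<And>j. j < n \<Longrightarrow> opr m (G j) \<in> Pol \<Gamma>"
  have "preserves (opr m (\<lambda>xs. F (map (\<lambda>j. G j xs) [0..<n]))) (k, R)" if "(k, R) \<in> \<Gamma>" for k R
    unfolding preserves_opr
  proof (intro allI impI)
    fix ts :: "nat list list"
    assume ts: "length ts = m" "set ts \<subseteq> R"
    define us where "us = map (\<lambda>l. map (\<lambda>j. G l (map (\<lambda>t. t ! j) ts)) [0..<k]) [0..<n]"
    have "set us \<subseteq> R"
      using G that ts unfolding us_def Pol_def by (fastforce simp: preserves_opr)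
    moreover have "length us = n"
      by (simp add: us_def)
    ultimately have "map (\<lambda>j. F (map (\<lambda>t. t ! j) us)) [0..<k] \<in> R"
      using F that by (auto simp: Pol_def preserves_opr)
    moreover have "map (\<lambda>t. t ! j) us = map (\<lambda>l. G l (map (\<lambda>t. t ! j) ts)) [0..<n]" if "j < k" for j
      using that by (simp add: us_def)
    ultimately show "map (\<lambda>j. F (map (\<lambda>l. G l (map (\<lambda>t. t ! j) ts)) [0..<n])) [0..<k] \<in> R"
      by (metis (mono_tags, lifting) atLeastLessThan_iff map_cong set_upt)
  qed
  then show "opr m (\<lambda>xs. F (map (\<lambda>j. G j xs) [0..<n])) \<in> Pol \<Gamma>"
    using nm by (auto simp: Pol_def)
next
  fix n :: nat and F
  assume n: "n \<ge> 1" and *: "\<And>A. finite A \<Longrightarrow> A \<subseteq> tuples n \<Longrightarrow> \<exists>G. opr n G \<in> Pol \<Gamma> \<and> (\<forall>a\<in>A. G a = F a)"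
  have "preserves (opr n F) (k, R)" if "(k, R) \<in> \<Gamma>" for k R
    unfolding preserves_opr
  proof (intro allI impI)
    fix ts :: "nat list list"
    assume ts: "length ts = n" "set ts \<subseteq> R"
    obtain G where G: "opr n G \<in> Pol \<Gamma>" "\<forall>a\<in>(\<lambda>j. map (\<lambda>t. t ! j) ts) ` {..<k}. G a = F a"
      using *[of "(\<lambda>j. map (\<lambda>t. t ! j) ts) ` {..<k}"] ts by (auto simp: image_subset_iff)
    have "map (\<lambda>j. G (map (\<lambda>t. t ! j) ts)) [0..<k] \<in> R"
      using G(1) that ts by (auto simp: Pol_def preserves_opr)
    moreover have "map (\<lambda>j. G (map (\<lambda>t. t ! j) ts)) [0..<k] = map (\<lambda>j. F (map (\<lambda>t. t ! j) ts)) [0..<k]"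
      using G(2) by simp
    ultimately show "map (\<lambda>j. F (map (\<lambda>t. t ! j) ts)) [0..<k] \<in> R"
      by simp
  qed
  then show "opr n F \<in> Pol \<Gamma>"
    using n by (auto simp: Pol_def)
qed

text \<open>Inside the finite set formed by \<open>A\<close> and its image, the complements of
  \<open>A\<close> and of the image have equal size, so a bijection between them completes
  \<open>f\<close>; elsewhere the identity is used.\<close>

lemma bij_extension:
  fixes f :: "nat \<Rightarrow> nat"
  assumes "finite A" "inj_on f A"
  obtains g where "bij g" "\<And>a. a \<in> A \<Longrightarrow> g a = f a"
proof -
  let ?B = "A \<union> f ` A"
  have fin: "finite ?B"
    using assms by simp
  have "card (?B - A) = card (?B - f ` A)"
    using assms fin by (simp add: card_Diff_subset card_image)
  then obtain h where h: "bij_betw h (?B - A) (?B - f ` A)"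
    using fin by (metis finite_Diff finite_same_card_bij)
  define g where "g x = (if x \<in> A then f x else if x \<in> ?B then h x else x)" for x
  have "bij_betw g A (f ` A)"
    using assms(2) by (auto simp: bij_betw_def g_def inj_on_def)
  moreover have "bij_betw g (?B - A) (?B - f ` A)"
    using h by (rule bij_betw_cong[THEN iffD1, rotated]) (auto simp: g_def)
  ultimately have "bij_betw g (A \<union> (?B - A)) (f ` A \<union> (?B - f ` A))"
    by (rule bij_betw_combine) auto
  then have "bij_betw g ?B ?B"
    by (metis Un_Diff_cancel Un_commute Un_left_absorb)
  moreover have "bij_betw g (- ?B) (- ?B)"
    by (auto simp: bij_betw_def inj_on_def g_def)
  ultimately have "bij_betw g (?B \<union> - ?B) (?B \<union> - ?B)"
    by (rule bij_betw_combine) auto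
  then have "bij g"
    by (simp only: sup_compl_top)
  then show ?thesis
    by (rule that) (simp add: g_def)
qed

text \<open>Needed for substitutions into an operation that is known to behave well only on
  arguments below \<open>M\<close>: all of \<open>X\<close> must stay below \<open>M\<close>, while
  the values on \<open>D\<close> are prescribed.\<close>

lemma bij_extension_into:
  fixes f :: "nat \<Rightarrow> nat"
  assumes "finite X" "card X \<le> M" "D \<subseteq> X" "inj_on f D" "f ` D \<subseteq> {..<M}"
  obtains g where "bij g" "\<And>a. a \<in> D \<Longrightarrow> g a = f a" "\<And>a. a \<in> X \<Longrightarrow> g a < M"
proof -
  have finD: "finite D"
    using assms(1,3) finite_subset by blast
  have "card (X - D) \<le> card ({..<M} - f ` D)"
    using assms finD by (simp add: card_Diff_subset card_image)
  then obtain h where h: "h ` (X - D) \<subseteq> {..<M} - f ` D" "inj_on h (X - D)"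
    using card_le_inj[of "X - D" "{..<M} - f ` D"] assms(1) by auto
  define k where "k x = (if x \<in> D then f x else h x)" for x
  have "inj_on k X"
  proof (rule inj_onI)
    fix x y
    assume xy: "x \<in> X" "y \<in> X" "k x = k y"
    have "h z \<notin> f ` D" if "z \<in> X" "z \<notin> D" for z
      using h(1) that by blast
    then show "x = y"
      using xy inj_onD[OF h(2)] inj_onD[OF assms(4)] unfolding k_def
      by (metis DiffI imageI)
  qed
  then obtain g where g: "bij g" "\<And>a. a \<in> X \<Longrightarrow> g a = k a"
    using bij_extension[OF assms(1)] by blast
  show ?thesis
  proof (rule that[OF g(1)])
    show "g a = f a" if "a \<in> D" for a
      using that g(2) assms(3) by (auto simp: k_def)
    show "g a < M" if "a \<in> X" for a
      using that g(2) h(1) assms(5) by (auto simp: k_def)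
  qed
qed

lemma inj_extension2:
  fixes x0 x1 y0 y1 :: nat
  assumes "x0 \<noteq> x1" "y0 \<noteq> y1"
  obtains g where "inj g" "g x0 = y0" "g x1 = y1"
proof (rule bij_extension)
  let ?f = "\<lambda>x. if x = x0 then y0 else y1"
  show "finite {x0, x1}" "inj_on ?f {x0, x1}"
    using assms by auto
  fix g
  assume "bij g" "\<And>a. a \<in> {x0, x1} \<Longrightarrow> g a = ?f a"
  then show thesis
    using assms by (intro that[of g]) (auto simp: bij_is_inj)
qed

lemma inj_extension3:
  fixes x0 x1 x2 y0 y1 y2 :: nat
  assumes "x0 \<noteq> x1" "x0 \<noteq> x2" "x1 \<noteq> x2" "y0 \<noteq> y1" "y0 \<noteq> y2" "y1 \<noteq> y2"
  obtains g where "inj g" "g x0 = y0" "g x1 = y1" "g x2 = y2"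
proof (rule bij_extension)
  let ?f = "\<lambda>x. if x = x0 then y0 else if x = x1 then y1 else y2"
  show "finite {x0, x1, x2}" "inj_on ?f {x0, x1, x2}"
    using assms by auto
  fix g
  assume "bij g" "\<And>a. a \<in> {x0, x1, x2} \<Longrightarrow> g a = ?f a"
  then show thesis
    using assms by (intro that[of g]) (auto simp: bij_is_inj)
qed

lemma inj_extension4:
  fixes x0 x1 x2 x3 y0 y1 y2 y3 :: nat
  assumes "distinct [x0, x1, x2, x3]" "distinct [y0, y1, y2, y3]"
  obtains g where "inj g" "g x0 = y0" "g x1 = y1" "g x2 = y2" "g x3 = y3"
proof (rule bij_extension)
  let ?f = "\<lambda>x. if x = x0 then y0 else if x = x1 then y1 else if x = x2 then y2 else y3"
  show "finite {x0, x1, x2, x3}" "inj_on ?f {x0, x1, x2, x3}"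
    using assms by auto
  fix g
  assume "bij g" "\<And>a. a \<in> {x0, x1, x2, x3} \<Longrightarrow> g a = ?f a"
  then show thesis
    using assms by (intro that[of g]) (auto simp: bij_is_inj)
qed

lemma finite_lists_bounded:
  assumes "finite (A :: nat list set)"
  obtains M where "\<And>a x. a \<in> A \<Longrightarrow> x \<in> set a \<Longrightarrow> x < M"
proof -
  have "finite (\<Union>a\<in>A. set a)"
    using assms by simp
  then obtain M where "\<forall>x\<in>(\<Union>a\<in>A. set a). x < M"
    using finite_nat_set_iff_bounded by blast
  then show ?thesis
    using that by blast
qed

text \<open>The \<beta> k act as paths from \<open>a ! k\<close> to \<open>b ! k\<close>: inserting
  them into an operation places the two tuples at 0 and 1 of a single variable.\<close>

lemma all_neqE:
  assumes "length a = n" "length b = n"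
  obtains \<beta> :: "nat \<Rightarrow> nat \<Rightarrow> nat" where "\<And>k. k < n \<Longrightarrow> a ! k \<noteq> b ! k \<Longrightarrow> inj (\<beta> k) \<and> \<beta> k 0 = a ! k \<and> \<beta> k 1 = b ! k"
proof -
  have "\<exists>g :: nat \<Rightarrow> nat. a ! k \<noteq> b ! k \<longrightarrow> inj g \<and> g 0 = a ! k \<and> g 1 = b ! k" for k
    using inj_extension2[of 0 1 "a ! k" "b ! k"] by (metis zero_neq_one)
  then show ?thesis
    using that by metis
qed

section \<open>Preservation of inequality and the interval of clones\<close>

definition pres_neq :: "nat \<Rightarrow> (nat list \<Rightarrow> nat) \<Rightarrow> bool" where
  "pres_neq n F \<longleftrightarrow> (\<forall>a b. length a = n \<longrightarrow> length b = n \<longrightarrow> (\<forall>k<n. a ! k \<noteq> b ! k) \<longrightarrow> F a \<noteq> F b)"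

lemma neq_rel_in_all_rels [simp]: "neq_rel \<in> all_rels"
  by (auto simp: neq_rel_def all_rels_def)

lemma opr_in_Pol_neq: "opr n F \<in> Pol {neq_rel} \<longleftrightarrow> n \<ge> 1 \<and> pres_neq n F"
proof -
  have "preserves (opr n F) neq_rel \<longleftrightarrow> pres_neq n F"
  proof
    assume *: "preserves (opr n F) neq_rel"
    show "pres_neq n F"
      unfolding pres_neq_def
    proof (intro allI impI)
      fix a b :: "nat list"
      assume ab: "length a = n" "length b = n" "\<forall>k<n. a ! k \<noteq> b ! k"
      define ts where "ts = map (\<lambda>k. [a ! k, b ! k]) [0..<n]"
      have "length ts = n" "set ts \<subseteq> {[x, y] |x y. x \<noteq> y}"
        using ab(3) by (auto simp: ts_def)
      then have "map (\<lambda>j. F (map (\<lambda>t. t ! j) ts)) [0..<2] \<in> {[x, y] |x y. x \<noteq> y}"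
        using *[unfolded neq_rel_def preserves_opr] by blast
      moreover have "map (\<lambda>t. t ! 0) ts = a" "map (\<lambda>t. t ! 1) ts = b"
        using ab by (auto simp: ts_def intro: nth_equalityI)
      ultimately show "F a \<noteq> F b"
        by (simp add: numeral_2_eq_2)
    qed
  next
    assume *: "pres_neq n F"
    show "preserves (opr n F) neq_rel"
      unfolding neq_rel_def preserves_opr
    proof (intro allI impI)
      fix ts :: "nat list list"
      assume ts: "length ts = n" "set ts \<subseteq> {[x, y] |x y. x \<noteq> y}"
      have "(ts ! k) ! 0 \<noteq> (ts ! k) ! 1" if "k < n" for k
        using ts nth_mem[of k ts] that by fastforce
      then have "F (map (\<lambda>t. t ! 0) ts) \<noteq> F (map (\<lambda>t. t ! 1) ts)"
        using *[unfolded pres_neq_def, rule_format, of "map (\<lambda>t. t ! 0) ts" "map (\<lambda>t. t ! 1) ts"] ts(1)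
        by simp
      then show "map (\<lambda>j. F (map (\<lambda>t. t ! j) ts)) [0..<2] \<in> {[x, y] |x y. x \<noteq> y}"
        by (simp add: numeral_2_eq_2)
    qed
  qed
  then show ?thesis
    by (auto simp: Pol_def)
qed

lemma opr_in_injective_unary: "opr n F \<in> injective_unary \<longleftrightarrow> n = 1 \<and> inj (\<lambda>x. F [x])"
proof
  assume "opr n F \<in> injective_unary"
  then obtain g where g: "inj g" "opr n F = opr 1 (\<lambda>xs. g (hd xs))"
    by (auto simp: injective_unary_def unary_eq_opr)
  then have "n = 1" "F [x] = g x" for x
    by (auto simp: opr_eq_iff)
  then show "n = 1 \<and> inj (\<lambda>x. F [x])"
    using g(1) by simp
next
  assume *: "n = 1 \<and> inj (\<lambda>x. F [x])"
  then have "opr n F = unary (\<lambda>x. F [x])"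
    unfolding unary_eq_opr by (auto simp: opr_eq_iff length_Suc_conv)
  then show "opr n F \<in> injective_unary"
    using * by (simp add: injective_unary_def)
qed

lemma injective_unary_subset_ops: "injective_unary \<subseteq> ops 1"
  by (auto simp: injective_unary_def unary_eq_opr)

lemma permutations_subset_injective_unary: "permutations \<subseteq> injective_unary"
  unfolding permutations_def injective_unary_def by (auto simp: bij_is_inj)

lemma pres_neq_1: "pres_neq 1 F \<longleftrightarrow> inj (\<lambda>x. F [x])"
  by (fastforce simp: pres_neq_def inj_def length_Suc_conv)

lemma Pol_neq_unary: "Pol {neq_rel} \<inter> ops 1 = injective_unary"
proof -
  have "f \<in> Pol {neq_rel} \<longleftrightarrow> f \<in> injective_unary" if "f \<in> ops 1" for f
    using opr_in_Pol_neq[of 1 "snd f"] opr_in_injective_unary[of 1 "snd f"] ops_eq_opr[OF that]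
    by (simp add: pres_neq_1[unfolded One_nat_def])
  then show ?thesis
    using injective_unary_subset_ops by blast
qed

lemma local_clone_Pol_neq: "local_clone (Pol {neq_rel})"
  by (rule local_clone_Pol) simp

lemma op_comp_unaries:
  "op_comp 1 (opr n F) (map (\<lambda>k. unary (\<beta> k)) [0..<n]) = opr 1 (\<lambda>xs. F (map (\<lambda>k. \<beta> k (hd xs)) [0..<n]))"
  unfolding op_comp_eq_opr by (rule opr_cong) (simp add: unary_eq_opr comp_def)

text \<open>Tuples that differ in every coordinate are the values at 0 and 1 of suitable injections,
  so a violation of \<noteq> becomes a unary composite that is not injective. Conversely, injections
  evaluated at two distinct arguments yield such tuples.\<close>

lemma Pol_monoid_injective_unary: "Pol_monoid injective_unary = Pol {neq_rel}"
proof -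
  have "opr n F \<in> Pol_monoid injective_unary \<longleftrightarrow> opr n F \<in> Pol {neq_rel}" if "n \<ge> 1" for n F
  proof
    assume *: "opr n F \<in> Pol_monoid injective_unary"
    have "F a \<noteq> F b" if ab: "length a = n" "length b = n" "\<forall>k<n. a ! k \<noteq> b ! k" for a b
    proof -
      obtain \<beta> :: "nat \<Rightarrow> nat \<Rightarrow> nat"
        where \<beta>: "\<And>k. k < n \<Longrightarrow> inj (\<beta> k) \<and> \<beta> k 0 = a ! k \<and> \<beta> k 1 = b ! k"
        using all_neqE[OF ab(1,2)] ab(3) by metis
      have "op_comp 1 (opr n F) (map (\<lambda>k. unary (\<beta> k)) [0..<n]) \<in> injective_unary"
      proof -
        have "set (map (\<lambda>k. unary (\<beta> k)) [0..<n]) \<subseteq> injective_unary"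
          using \<beta> by (auto simp: injective_unary_def)
        then show ?thesis
          using * unfolding Pol_monoid_def by simp
      qed
      then have "inj (\<lambda>x. F (map (\<lambda>k. \<beta> k x) [0..<n]))"
        unfolding op_comp_unaries opr_in_injective_unary by simp
      moreover have "map (\<lambda>k. \<beta> k 0) [0..<n] = a" "map (\<lambda>k. \<beta> k 1) [0..<n] = b"
        using \<beta> ab by (auto intro: nth_equalityI)
      ultimately show ?thesis
        by (metis injD zero_neq_one)
    qed
    then show "opr n F \<in> Pol {neq_rel}"
      using that unfolding opr_in_Pol_neq pres_neq_def by blast
  next
    assume "opr n F \<in> Pol {neq_rel}"
    then have *: "pres_neq n F"
      by (simp add: opr_in_Pol_neq)
    have "op_comp 1 (opr n F) gs \<in> injective_unary" if gs: "length gs = n" "set gs \<subseteq> injective_unary" for gs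
    proof -
      have "\<exists>g. inj g \<and> gs ! k = unary g" if "k < n" for k
        using gs that subsetD[OF gs(2) nth_mem[of k gs]] unfolding injective_unary_def by blast
      then obtain \<beta> where \<beta>: "\<And>k. k < n \<Longrightarrow> inj (\<beta> k) \<and> gs ! k = unary (\<beta> k)"
        by metis
      have "gs = map (\<lambda>k. unary (\<beta> k)) [0..<n]"
        using \<beta> gs(1) by (auto intro: nth_equalityI)
      moreover have "inj (\<lambda>x. F (map (\<lambda>k. \<beta> k x) [0..<n]))"
      proof (rule injI, rule ccontr)
        fix x y :: nat
        assume xy: "F (map (\<lambda>k. \<beta> k x) [0..<n]) = F (map (\<lambda>k. \<beta> k y) [0..<n])" "x \<noteq> y"
        have "\<beta> k x \<noteq> \<beta> k y" if "k < n" for k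
          using \<beta>[OF that] xy(2) by (auto dest: injD)
        then show False
          using *[unfolded pres_neq_def, rule_format, of "map (\<lambda>k. \<beta> k x) [0..<n]"
              "map (\<lambda>k. \<beta> k y) [0..<n]"] xy(1) by simp
      qed
      ultimately show ?thesis
        by (simp add: op_comp_unaries opr_in_injective_unary del: One_nat_def)
    qed
    then show "opr n F \<in> Pol_monoid injective_unary"
      using \<open>n \<ge> 1\<close> by (simp add: Pol_monoid_def)
  qed
  moreover have "f \<in> all_ops" if "f \<in> Pol_monoid injective_unary \<or> f \<in> Pol {neq_rel}" for f
    using that by (auto simp: Pol_monoid_def Pol_def)
  ultimately have "f \<in> Pol_monoid injective_unary \<longleftrightarrow> f \<in> Pol {neq_rel}" for f
    by (cases "f \<in> all_ops") (erule all_ops_cases, simp, blast)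
  then show ?thesis
    by blast
qed

text \<open>On a finite set an injection coincides with a permutation, so every injection is a limit
  of permutations.\<close>

lemma injective_unary_smallest:
  assumes sub: "M \<subseteq> all_ops" and "locally_closed M" "permutations \<subseteq> M"
  shows "injective_unary \<subseteq> M"
proof
  fix f assume "f \<in> injective_unary"
  then obtain g where g: "inj g" "f = opr 1 (\<lambda>xs. g (hd xs))"
    by (auto simp: injective_unary_def unary_eq_opr)
  have "\<exists>G. opr 1 G \<in> M \<and> (\<forall>a\<in>A. G a = g (hd a))" if "finite A" for A :: "nat list set"
  proof -
    have "finite (hd ` A)" "inj_on g (hd ` A)"
      using that g(1) by (auto intro: inj_on_subset)
    from bij_extension[OF this] obtain h where h: "bij h" "\<And>a. a \<in> hd ` A \<Longrightarrow> h a = g a"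
      by blast
    have "opr 1 (\<lambda>xs. h (hd xs)) \<in> M"
      using assms(3) h(1) by (auto simp: permutations_def unary_eq_opr)
    then show ?thesis
      using h(2) by (intro exI[of _ "\<lambda>xs. h (hd xs)"]) simp
  qed
  then show "f \<in> M"
    using assms(2) unfolding locally_closed_iff[OF sub] g(2) by simp
qed

lemma injective_unary_subset_local_clone: "local_clone C \<Longrightarrow> permutations \<subseteq> C \<Longrightarrow> injective_unary \<subseteq> C"
  by (intro injective_unary_smallest local_clone_subset) (simp_all add: local_clone_def)

lemma monoidal_intervalI:
  assumes "local_clone C" "permutations \<subseteq> C" "C \<subseteq> Pol {neq_rel}"
  shows "C \<in> monoidal_interval injective_unary"
  using assms injective_unary_subset_local_clone[OF assms(1,2)] Pol_neq_unary injective_unary_subset_ops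
  unfolding monoidal_interval_def by blast

lemma monoidal_interval_subset_Pol_neq:
  assumes "C \<in> monoidal_interval injective_unary"
  shows "C \<subseteq> Pol {neq_rel}"
proof
  fix f assume f: "f \<in> C"
  have C: "local_clone C" "C \<inter> ops 1 = injective_unary"
    using assms by (auto simp: monoidal_interval_def)
  then obtain n F where nF: "f = opr n F" "n \<ge> 1"
    using all_ops_cases local_clone_subset f by (metis subsetD)
  have "op_comp 1 f gs \<in> injective_unary" if gs: "length gs = n" "set gs \<subseteq> injective_unary" for gs
  proof -
    have "set gs \<subseteq> C \<inter> ops 1" "f \<in> C \<inter> ops n"
      using gs C f nF by auto
    then have "op_comp 1 f gs \<in> C"
      using C(1) gs(1) nF(2) unfolding local_clone_def clone_def by blast
    then show ?thesis
      using C(2) by (metis IntI op_comp_eq_opr opr_in_ops)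
  qed
  then have "f \<in> Pol_monoid injective_unary"
    using nF by (simp add: Pol_monoid_def)
  then show "f \<in> Pol {neq_rel}"
    by (simp add: Pol_monoid_injective_unary)
qed

lemma permutations_subset_Pol_neq: "permutations \<subseteq> Pol {neq_rel}"
  using permutations_subset_injective_unary Pol_neq_unary by blast

text \<open>Replaces the condition on the unary part by two inclusions, so that for a generated
  clone it can be checked on the generators.\<close>

lemma monoidal_interval_iff:
  "C \<in> monoidal_interval injective_unary \<longleftrightarrow>
    local_clone C \<and> permutations \<subseteq> C \<and> C \<subseteq> Pol {neq_rel}"
proof
  assume C: "C \<in> monoidal_interval injective_unary"
  then show "local_clone C \<and> permutations \<subseteq> C \<and> C \<subseteq> Pol {neq_rel}"
    using monoidal_interval_subset_Pol_neq[OF C] permutations_subset_injective_unary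
    by (auto simp: monoidal_interval_def)
qed (use monoidal_intervalI in blast)

lemma generated_in_monoidal_interval:
  assumes "F \<subseteq> Pol {neq_rel}"
  shows "generated F \<in> monoidal_interval injective_unary"
proof (rule monoidal_intervalI)
  show "local_clone (generated F)"
    using assms by (intro local_clone_generated) (auto simp: Pol_def)
  show "generated F \<subseteq> Pol {neq_rel}"
    using assms by (intro generated_minimal permutations_subset_Pol_neq local_clone_Pol_neq)
qed (rule permutations_subset_generated)

definition bin :: "(nat \<Rightarrow> nat \<Rightarrow> nat) \<Rightarrow> nat list \<Rightarrow> nat" where
  "bin f xs = f (xs ! 0) (xs ! 1)"

lemma bin_simp [simp]: "bin f [x, y] = f x y"
  by (simp add: bin_def)

lemma length_2_iff: "length xs = 2 \<longleftrightarrow> (\<exists>x y. xs = [x, y])"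
  by (auto simp: numeral_2_eq_2 length_Suc_conv)

section \<open>Closure rules for local clones containing the permutations\<close>

locale perm_clone =
  fixes C :: "oper set"
  assumes local_clone: "local_clone C" and permutations_subset: "permutations \<subseteq> C"
begin

abbreviation mem :: "nat \<Rightarrow> (nat list \<Rightarrow> nat) \<Rightarrow> bool" where
  "mem n F \<equiv> opr n F \<in> C"

lemma mem_pos: "mem n F \<Longrightarrow> n \<ge> 1"
  using local_clone_subset[OF local_clone] by auto

lemma mem_proj: "i < n \<Longrightarrow> mem n (\<lambda>xs. xs ! i)"
  using local_clone_proj[OF local_clone] .

lemma mem_comp:
  assumes "mem k F" "n \<ge> 1" "\<And>j. j < k \<Longrightarrow> mem n (G j)"
  shows "mem n (\<lambda>xs. F (map (\<lambda>j. G j xs) [0..<k]))"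
  using local_clone_comp[OF local_clone mem_pos[OF assms(1)] assms(2,1)] assms(3) by simp

lemma mem_inj:
  assumes "inj g" "mem n F"
  shows "mem n (\<lambda>xs. g (F xs))"
proof -
  have "mem 1 (\<lambda>xs. g (hd xs))"
    using injective_unary_subset_local_clone[OF local_clone permutations_subset] assms(1)
    by (auto simp: injective_unary_def unary_eq_opr)
  from mem_comp[OF this mem_pos[OF assms(2)], of "\<lambda>_. F"] show ?thesis
    using assms(2) by simp
qed

lemma mem_inj_proj: "inj g \<Longrightarrow> i < n \<Longrightarrow> mem n (\<lambda>xs. g (xs ! i))"
  by (rule mem_inj[OF _ mem_proj])

lemma mem_bin:
  assumes "mem 2 (bin f)" "mem n F" "mem n G"
  shows "mem n (\<lambda>xs. f (F xs) (G xs))"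
proof -
  have "mem n (\<lambda>xs. bin f (map (\<lambda>j. (if j = 0 then F else G) xs) [0..<2]))"
    by (rule mem_comp[OF assms(1) mem_pos[OF assms(2)]]) (use assms(2,3) in auto)
  then show ?thesis
    by (simp add: numeral_2_eq_2)
qed

text \<open>The main membership test. If the kernels agree on \<open>A\<close>, the values of
  \<open>F\<close> are an injective function of those of \<open>G\<close>; it extends to a
  permutation, which may be composed with \<open>G\<close>, and local closure does the rest.\<close>

lemma mem_if_kernels:
  assumes "n \<ge> 1"
    and "\<And>A. finite A \<Longrightarrow> A \<subseteq> tuples n \<Longrightarrow> \<exists>G. mem n G \<and> (\<forall>a\<in>A. \<forall>b\<in>A. G a = G b \<longleftrightarrow> F a = F b)"
  shows "mem n F"
proof (rule local_clone_limit[OF local_clone assms(1)])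
  fix A :: "nat list set"
  assume A: "finite A" "A \<subseteq> tuples n"
  from assms(2)[OF A] obtain G where G: "mem n G" "\<forall>a\<in>A. \<forall>b\<in>A. G a = G b \<longleftrightarrow> F a = F b"
    by (elim exE conjE)
  \<comment> \<open>Reads off \<open>F\<close> at any point of \<open>A\<close> with
    \<open>G\<close>-value \<open>v\<close>; the choice does not matter since the kernels agree on
    \<open>A\<close>.\<close>
  define \<phi> where "\<phi> v = F (SOME a. a \<in> A \<and> G a = v)" for v
  have \<phi>: "\<phi> (G a) = F a" if "a \<in> A" for a
  proof -
    have "(SOME b. b \<in> A \<and> G b = G a) \<in> A \<and> G (SOME b. b \<in> A \<and> G b = G a) = G a"
      by (rule someI[of "\<lambda>b. b \<in> A \<and> G b = G a" a]) (simp add: that)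
    then show ?thesis
      using bspec[OF bspec[OF G(2)] that] unfolding \<phi>_def by blast
  qed
  have "inj_on \<phi> (G ` A)"
    using G(2) by (auto simp: inj_on_def \<phi>)
  from bij_extension[OF finite_imageI[OF A(1)] this]
  obtain g where g: "bij g" "\<And>v. v \<in> G ` A \<Longrightarrow> g v = \<phi> v"
    by blast
  have "mem n (\<lambda>xs. g (G xs))"
    by (rule mem_inj[OF bij_is_inj[OF g(1)] G(1)])
  moreover have "\<forall>a\<in>A. g (G a) = F a"
    using g(2) \<phi> by simp
  ultimately show "\<exists>G. mem n G \<and> (\<forall>a\<in>A. G a = F a)"
    by (intro exI[of _ "\<lambda>xs. g (G xs)"] conjI)
qed

lemma mem_if_kernel:
  assumes "mem n G" "\<And>a b. length a = n \<Longrightarrow> length b = n \<Longrightarrow> G a = G b \<longleftrightarrow> F a = F b"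
  shows "mem n F"
proof (rule mem_if_kernels[OF mem_pos[OF assms(1)]])
  fix A assume "A \<subseteq> tuples n"
  then have "length a = n" if "a \<in> A" for a
    using that by auto
  then show "\<exists>G. mem n G \<and> (\<forall>a\<in>A. \<forall>b\<in>A. G a = G b \<longleftrightarrow> F a = F b)"
    using assms by (intro exI[of _ G]) simp
qed

lemma mem_bin_if_kernel:
  assumes "mem 2 (bin g)" "\<And>x y x' y'. g x y = g x' y' \<longleftrightarrow> f x y = f x' y'"
  shows "mem 2 (bin f)"
  by (rule mem_if_kernel[OF assms(1)]) (use assms(2) in \<open>auto simp: length_2_iff\<close>)

lemma mem_bin_if_kernels:
  assumes "\<And>N. \<exists>g. mem 2 (bin g) \<and>
    (\<forall>x<N. \<forall>y<N. \<forall>x'<N. \<forall>y'<N. g x y = g x' y' \<longleftrightarrow> f x y = f x' y')"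
  shows "mem 2 (bin f)"
proof (rule mem_if_kernels)
  fix A :: "nat list set"
  assume A: "finite A" "A \<subseteq> tuples 2"
  obtain M where M: "\<And>a x. a \<in> A \<Longrightarrow> x \<in> set a \<Longrightarrow> x < M"
    using finite_lists_bounded[OF A(1)] by blast
  have lt: "a ! 0 < M" "a ! 1 < M" if "a \<in> A" for a
    using that M[OF that] A(2) by (auto simp: subset_iff)
  from assms[of M] obtain g where "mem 2 (bin g)"
    "\<forall>x<M. \<forall>y<M. \<forall>x'<M. \<forall>y'<M. g x y = g x' y' \<longleftrightarrow> f x y = f x' y'"
    by (elim exE conjE)
  then show "\<exists>G. mem 2 G \<and> (\<forall>a\<in>A. \<forall>b\<in>A. G a = G b \<longleftrightarrow> bin f a = bin f b)"
    using lt by (intro exI[of _ "bin g"]) (simp add: bin_def)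
qed simp

end

section \<open>Essential variables\<close>

definition depends :: "nat \<Rightarrow> (nat list \<Rightarrow> nat) \<Rightarrow> nat \<Rightarrow> bool" where
  "depends n F i \<longleftrightarrow> (\<exists>a b. length a = n \<and> length b = n \<and> (\<forall>k<n. k \<noteq> i \<longrightarrow> a ! k = b ! k) \<and> F a \<noteq> F b)"

text \<open>\<open>a\<close> is turned into \<open>b\<close> one coordinate at a time; each move
  alters an inessential coordinate or nothing at all.\<close>

lemma eq_if_agree_on_depends:
  assumes "length a = n" "length b = n" "\<And>k. k < n \<Longrightarrow> depends n F k \<Longrightarrow> a ! k = b ! k"
  shows "F a = F b"
proof -
  define mix where "mix m = map (\<lambda>k. if k < m then b ! k else a ! k) [0..<n]" for m
  have "F (mix m) = F a" if "m \<le> n" for m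
    using that
  proof (induction m)
    case 0
    have "mix 0 = a"
      using assms(1) by (auto simp: mix_def intro: nth_equalityI)
    then show ?case
      by simp
  next
    case (Suc m)
    have "F (mix (Suc m)) = F (mix m)"
    proof (cases "depends n F m")
      case True
      then have "mix (Suc m) = mix m"
        using assms(3)[of m] Suc.prems by (auto simp: mix_def less_Suc_eq)
      then show ?thesis
        by simp
    next
      case False
      have "\<forall>k<n. k \<noteq> m \<longrightarrow> mix (Suc m) ! k = mix m ! k"
        by (auto simp: mix_def less_Suc_eq)
      moreover have "length (mix (Suc m)) = n" "length (mix m) = n"
        by (auto simp: mix_def)
      ultimately show ?thesis
        using False unfolding depends_def by blast
    qed
    then show ?case
      using Suc by simp
  qed
  moreover have "mix n = b"
    using assms(2) by (auto simp: mix_def intro: nth_equalityI)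
  ultimately show ?thesis
    by fastforce
qed

subsection \<open>Binary injections\<close>

locale inj_clone = perm_clone +
  assumes subset_Pol_neq: "C \<subseteq> Pol {neq_rel}"
begin

lemma mem_neq:
  assumes "mem n F" "length a = n" "length b = n" "\<And>k. k < n \<Longrightarrow> a ! k \<noteq> b ! k"
  shows "F a \<noteq> F b"
proof -
  have "pres_neq n F"
    using assms(1) subset_Pol_neq opr_in_Pol_neq by blast
  then show ?thesis
    using assms(2-4) unfolding pres_neq_def by simp
qed

lemma mem_bin_neq:
  assumes "mem 2 (bin f)" "x \<noteq> x'" "y \<noteq> y'"
  shows "f x y \<noteq> f x' y'"
proof -
  have "[x, y] ! k \<noteq> [x', y'] ! k" if "k < 2" for k
    using that assms(2,3) by (auto simp: less_2_cases_iff)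
  then show ?thesis
    using mem_neq[OF assms(1), of "[x, y]" "[x', y']"] by simp
qed

text \<open>
  Rows \<open>r\<close> and \<open>r'\<close> that differ in every coordinate other than \<open>i\<close> give a binary operation
  \<open>g\<close> with \<open>g x 0 = F (r[i := x])\<close> and \<open>g x 1 = F (r'[i := x])\<close>.
\<close>

lemma ex_essentially_binary:
  assumes F: "mem n F" and i: "i < n" "depends n F i" and j: "depends n F j" "i \<noteq> j"
  obtains g where "mem 2 (bin g)" "\<exists>x y y'. g x y \<noteq> g x y'" "\<exists>x x' y. g x y \<noteq> g x' y"
proof (rule ccontr)
  assume not_thesis: "\<not> thesis"
  note ex = that
  have unary: "(\<forall>x y y'. g x y = g x y') \<or> (\<forall>x x' y. g x y = g x' y)" if "mem 2 (bin g)" for g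
    using ex[OF that] not_thesis by blast
  \<comment> \<open>If \<open>F\<close> varies along the \<open>i\<close>-line through
    \<open>r\<close>, then \<open>g\<close> depends on its first argument, hence by assumption not
    on its second; so the \<open>i\<close>-line through \<open>r'\<close> carries the same
    values.\<close>
  have step: "F (r'[i := x]) = F (r[i := x])"
    if r: "length r = n" "length r' = n" "\<And>k. k < n \<Longrightarrow> k \<noteq> i \<Longrightarrow> r ! k \<noteq> r' ! k"
      and nonconst: "F (r[i := u]) \<noteq> F (r[i := v])" for r r' x u v
  proof -
    obtain \<beta> :: "nat \<Rightarrow> nat \<Rightarrow> nat"
      where \<beta>: "\<And>k. k < n \<Longrightarrow> r ! k \<noteq> r' ! k \<Longrightarrow> inj (\<beta> k) \<and> \<beta> k 0 = r ! k \<and> \<beta> k 1 = r' ! k"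
      using all_neqE[OF r(1,2)] by metis
    define g where "g x y = F (map (\<lambda>k. if k = i then x else \<beta> k y) [0..<n])" for x y
    have "mem 2 (\<lambda>xs. F (map (\<lambda>k. (if k = i then (\<lambda>xs. xs ! 0) else (\<lambda>xs. \<beta> k (xs ! 1))) xs) [0..<n]))"
      by (rule mem_comp[OF F]) (use \<beta> r(3) in \<open>auto intro: mem_proj mem_inj_proj\<close>)
    then have g: "mem 2 (bin g)"
      by (rule mem_if_kernel) (auto simp: bin_def g_def if_distrib[of "\<lambda>f. f _"] cong: if_cong)
    have "map (\<lambda>k. if k = i then x else \<beta> k 0) [0..<n] = r[i := x]"
      "map (\<lambda>k. if k = i then x else \<beta> k 1) [0..<n] = r'[i := x]" for x
      using \<beta> r by (auto intro!: nth_equalityI simp: nth_list_update)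
    then have g0: "g x 0 = F (r[i := x])" "g x 1 = F (r'[i := x])" for x
      by (simp_all only: g_def)
    have "g u 0 \<noteq> g v 0"
      using nonconst by (simp add: g0)
    then have "g x 0 = g x 1"
      using unary[OF g] by blast
    then show ?thesis
      unfolding g0 by simp
  qed
  obtain a b where ab: "length a = n" "length b = n" "\<forall>k<n. k \<noteq> i \<longrightarrow> a ! k = b ! k" "F a \<noteq> F b"
    using i(2) unfolding depends_def by blast
  obtain c d where cd: "length c = n" "length d = n" "\<forall>k<n. k \<noteq> j \<longrightarrow> c ! k = d ! k" "F c \<noteq> F d"
    using j(1) unfolding depends_def by blast
  \<comment> \<open>The row \<open>r\<close> with constant entry \<open>M\<close> differs everywhere
    from all four tuples, so \<open>step\<close> leads from \<open>a\<close> to \<open>r\<close> and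
    from \<open>r\<close> to \<open>c\<close> and \<open>d\<close>. Then \<open>F\<close> sees only
    coordinate \<open>i\<close> of \<open>c\<close> and \<open>d\<close>, where they agree.\<close>
  obtain M where M: "\<And>e x. e \<in> {a, b, c, d} \<Longrightarrow> x \<in> set e \<Longrightarrow> x < M"
    using finite_lists_bounded[of "{a, b, c, d}"] by auto
  define r where "r = replicate n M"
  have r: "length r = n"
    by (simp add: r_def)
  have fresh: "e ! k \<noteq> r ! k" if "e \<in> {a, b, c, d}" "k < n" for e k
  proof -
    have "length e = n"
      using that(1) ab cd by auto
    then have "e ! k < M"
      using M[OF that(1)] that(2) by simp
    then show ?thesis
      using that(2) by (simp add: r_def)
  qed
  have "a[i := a ! i] = a" "a[i := b ! i] = b"
    using ab(1-3) i(1) by (auto intro!: nth_equalityI simp: nth_list_update)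
  then have a_nonconst: "F (a[i := a ! i]) \<noteq> F (a[i := b ! i])"
    using ab(4) by simp
  have "F (r[i := x]) = F (a[i := x])" for x
    by (rule step[OF ab(1) r fresh a_nonconst]) simp_all
  then have r_nonconst: "F (r[i := a ! i]) \<noteq> F (r[i := b ! i])"
    using a_nonconst by simp
  have er: "F (e[i := x]) = F (r[i := x])" if "e \<in> {c, d}" for e x
    by (rule step[OF r _ fresh[symmetric] r_nonconst]) (use that cd in auto)
  have "F c = F (r[i := c ! i])" "F d = F (r[i := d ! i])"
    using er[of c "c ! i"] er[of d "d ! i"] by simp_all
  moreover have "c ! i = d ! i"
    using cd(3) i(1) j(2) by blast
  ultimately show False
    using cd(4) by simp
qed

text \<open>At this point a value can be parked while \<open>g\<close> still varies along both lines
  away from it. Otherwise all but two horizontal lines are constant off \<open>x0\<close> and all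
  but two vertical ones are constant off \<open>y0\<close>; far out, one horizontal and one vertical
  move then join points that differ in both arguments.\<close>

lemma ex_crossing_point:
  assumes g: "mem 2 (bin g)" and "\<exists>x y y'. g x y \<noteq> g x y'" "\<exists>x x' y. g x y \<noteq> g x' y"
  obtains x0 y0 where "\<exists>x1 x2. x1 \<noteq> x0 \<and> x2 \<noteq> x0 \<and> g x1 y0 \<noteq> g x2 y0"
    "\<exists>y1 y2. y1 \<noteq> y0 \<and> y2 \<noteq> y0 \<and> g x0 y1 \<noteq> g x0 y2"
proof (rule ccontr)
  assume "\<not> thesis"
  then have no: "(\<forall>x1 x2. x1 \<noteq> x \<longrightarrow> x2 \<noteq> x \<longrightarrow> g x1 y = g x2 y) \<or>
      (\<forall>y1 y2. y1 \<noteq> y \<longrightarrow> y2 \<noteq> y \<longrightarrow> g x y1 = g x y2)" for x y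
    using that[of x y] by metis
  obtain x0 u0 u1 where u: "g x0 u0 \<noteq> g x0 u1"
    using assms(2) by blast
  obtain y0 x1 x2 where x: "g x1 y0 \<noteq> g x2 y0"
    using assms(3) by blast
  have row: "g x y = g x' y" if "y \<notin> {u0, u1}" "x \<noteq> x0" "x' \<noteq> x0" for x x' y
    using no[of x0 y] u that by (metis insertCI)
  have col: "g x y = g x y'" if "x \<notin> {x1, x2}" "y \<noteq> y0" "y' \<noteq> y0" for x y y'
    using no[of x y0] x that by (metis insertCI)
  define s where "s = Suc (x0 + x1 + x2)"
  define t where "t = Suc (u0 + u1 + y0)"
  have "g s t = g (Suc s) t"
    by (rule row) (auto simp: s_def t_def)
  also have "\<dots> = g (Suc s) (Suc t)"
    by (rule col) (auto simp: s_def t_def)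
  finally show False
    using mem_bin_neq[OF g, of s "Suc s" t "Suc t"] by simp
qed

end

text \<open>The parked value \<open>v\<close> may coincide with \<open>w0\<close> or
  \<open>w1\<close>. Variation of \<open>f\<close> away from \<open>x0\<close> covers this too: of
  two places with different values, at least one also differs from the value at
  \<open>x0\<close>.\<close>

lemma inj_separating:
  fixes f :: "nat \<Rightarrow> nat"
  assumes "\<exists>x1 x2. x1 \<noteq> x0 \<and> x2 \<noteq> x0 \<and> f x1 \<noteq> f x2" and "w0 \<noteq> w1"
  obtains \<alpha> :: "nat \<Rightarrow> nat" where "inj \<alpha>" "\<alpha> v = x0" "f (\<alpha> w0) \<noteq> f (\<alpha> w1)"
proof -
  obtain x1 x2 where x: "x1 \<noteq> x0" "x2 \<noteq> x0" "f x1 \<noteq> f x2"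
    using assms(1) by blast
  obtain x3 where x3: "x3 \<noteq> x0" "f x3 \<noteq> f x0"
    using x by metis
  consider "v = w0" | "v = w1" | "v \<noteq> w0" "v \<noteq> w1"
    by blast
  then show thesis
  proof cases
    case 1
    obtain \<alpha> :: "nat \<Rightarrow> nat" where "inj \<alpha>" "\<alpha> w0 = x0" "\<alpha> w1 = x3"
      using inj_extension2[OF assms(2), of x0 x3] x3 by metis
    then show thesis
      using that[of \<alpha>] 1 x3 by metis
  next
    case 2
    obtain \<alpha> :: "nat \<Rightarrow> nat" where "inj \<alpha>" "\<alpha> w0 = x3" "\<alpha> w1 = x0"
      using inj_extension2[OF assms(2), of x3 x0] x3 by metis
    then show thesis
      using that[of \<alpha>] 2 x3 by metis
  next
    case 3
    have "x1 \<noteq> x2"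
      using x by auto
    then obtain \<alpha> :: "nat \<Rightarrow> nat" where "inj \<alpha>" "\<alpha> v = x0" "\<alpha> w0 = x1" "\<alpha> w1 = x2"
      using inj_extension3[OF 3 assms(2), of x0 x1 x2] x by metis
    then show thesis
      using that[of \<alpha>] x by metis
  qed
qed

context inj_clone
begin

text \<open>In \<open>g (\<alpha> (h x y)) (\<beta> x)\<close> no horizontal pair separated by
  \<open>h\<close> can collapse, since \<beta> keeps different \<open>x\<close> apart and
  \<open>g\<close> preserves \<noteq>. With the crossing point, \<open>\<alpha> (h s t) = x0\<close>
  lets \<open>g\<close> separate the chosen pair, and \<open>\<beta> z = y0\<close> keeps the
  dependence on \<open>y\<close>, which distinguishes the result from the first projection.\<close>

lemma ex_separating_horizontal:
  assumes g: "mem 2 (bin g)" and ess: "\<exists>x y y'. g x y \<noteq> g x y'" "\<exists>x x' y. g x y \<noteq> g x' y"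
    and N: "N \<ge> 2"
  obtains h where "mem 2 (bin h)" "\<And>x x' y. x < N \<Longrightarrow> x' < N \<Longrightarrow> y < N \<Longrightarrow> h x y = h x' y \<Longrightarrow> x = x'"
    "\<exists>x<N. \<exists>y<N. \<exists>y'<N. h x y \<noteq> h x y'"
proof -
  define Q where "Q h \<longleftrightarrow> mem 2 (bin h) \<and> (\<exists>x<N. \<exists>y<N. \<exists>y'<N. h x y \<noteq> h x y')" for h
  define bad where "bad h = {(x, x', y). x < N \<and> x' < N \<and> y < N \<and> x \<noteq> x' \<and> h x y = h x' y}"
    for h :: "nat \<Rightarrow> nat \<Rightarrow> nat"
  have fin: "finite (bad h)" for h
    by (rule finite_subset[of _ "{..<N} \<times> {..<N} \<times> {..<N}"]) (auto simp: bad_def)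
  obtain x0 y0 where x0: "\<exists>x1 x2. x1 \<noteq> x0 \<and> x2 \<noteq> x0 \<and> g x1 y0 \<noteq> g x2 y0"
    and y0: "\<exists>y1 y2. y1 \<noteq> y0 \<and> y2 \<noteq> y0 \<and> g x0 y1 \<noteq> g x0 y2"
    by (rule ex_crossing_point[OF g ess])
  \<comment> \<open>Two points of column \<open>x0\<close> separated by \<open>g\<close> are moved
    to \<open>(0, 0)\<close> and \<open>(0, 1)\<close>, which lie in the grid since
    \<open>N \<ge> 2\<close>.\<close>
  have "\<exists>h. Q h"
  proof -
    obtain y1 y2 where y: "g x0 y1 \<noteq> g x0 y2"
      using y0 by blast
    obtain \<beta> :: "nat \<Rightarrow> nat" where \<beta>: "inj \<beta>" "\<beta> 0 = y1" "\<beta> 1 = y2"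
      using inj_extension2[of 0 1 y1 y2] y by (metis zero_neq_one)
    obtain \<alpha> :: "nat \<Rightarrow> nat" where \<alpha>: "inj \<alpha>" "\<alpha> 0 = x0"
      using inj_extension2[of 0 1 x0 "Suc x0"] by (metis zero_neq_one n_not_Suc_n)
    have "mem 2 (\<lambda>xs. g (\<alpha> (xs ! 0)) (\<beta> (xs ! 1)))"
      by (rule mem_bin[OF g]) (use \<alpha> \<beta> in \<open>auto intro: mem_inj_proj\<close>)
    then have "mem 2 (bin (\<lambda>x y. g (\<alpha> x) (\<beta> y)))"
      by (rule mem_if_kernel) (simp add: bin_def)
    moreover have "g (\<alpha> 0) (\<beta> 0) \<noteq> g (\<alpha> 0) (\<beta> 1)"
      using \<alpha> \<beta> y by simp
    ultimately have "Q (\<lambda>x y. g (\<alpha> x) (\<beta> y))"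
      unfolding Q_def using N by (metis One_nat_def less_le_trans pos2 lessI numeral_2_eq_2)
    then show ?thesis
      by blast
  qed
  then obtain h where h: "Q h" "\<And>h'. Q h' \<Longrightarrow> card (bad h) \<le> card (bad h')"
    using ex_has_least_nat[of Q _ "\<lambda>h. card (bad h)"] by blast
  have "bad h = {}"
  proof (rule ccontr)
    assume "bad h \<noteq> {}"
    then obtain s s' t where st: "(s, s', t) \<in> bad h"
      by auto
    obtain z t0 t1 where z: "z < N" "t0 < N" "t1 < N" "h z t0 \<noteq> h z t1"
      using h(1) unfolding Q_def by blast
    obtain \<alpha> :: "nat \<Rightarrow> nat" where \<alpha>: "inj \<alpha>" "\<alpha> (h s t) = x0" "g (\<alpha> (h z t0)) y0 \<noteq> g (\<alpha> (h z t1)) y0"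
      using inj_separating[OF x0 z(4)] by blast
    have "s \<noteq> s'"
      using st by (simp add: bad_def)
    then obtain \<beta> :: "nat \<Rightarrow> nat" where \<beta>: "inj \<beta>" "\<beta> z = y0" "g x0 (\<beta> s) \<noteq> g x0 (\<beta> s')"
      using inj_separating[OF y0] by blast
    define h' where "h' x y = g (\<alpha> (h x y)) (\<beta> x)" for x y
    have "mem 2 (\<lambda>xs. g (\<alpha> (bin h xs)) (\<beta> (xs ! 0)))"
      by (rule mem_bin[OF g]) (use \<alpha> \<beta> h(1) in \<open>auto intro: mem_inj_proj mem_inj simp: Q_def\<close>)
    then have "mem 2 (bin h')"
      by (rule mem_if_kernel) (simp add: bin_def h'_def)
    moreover have "h' z t0 \<noteq> h' z t1"
      using \<alpha>(3) \<beta>(2) by (simp add: h'_def)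
    ultimately have Q': "Q h'"
      unfolding Q_def using z by blast
    have "bad h' \<subseteq> bad h"
    proof (clarsimp simp: bad_def)
      fix x x' y
      assume "x \<noteq> x'" "h' x y = h' x' y"
      then show "h x y = h x' y"
        using mem_bin_neq[OF g, of "\<alpha> (h x y)" "\<alpha> (h x' y)" "\<beta> x" "\<beta> x'"] \<alpha>(1) \<beta>(1)
        by (auto simp: h'_def inj_eq)
    qed
    moreover have "(s, s', t) \<notin> bad h'"
      using st \<alpha>(2) \<beta>(3) by (auto simp: bad_def h'_def)
    ultimately have "bad h' \<subset> bad h"
      using st by blast
    then have "card (bad h') < card (bad h)"
      by (rule psubset_card_mono[OF fin])
    then show False
      using h(2)[OF Q'] by simp
  qed
  then have "x = x'" if "x < N" "x' < N" "y < N" "h x y = h x' y" for x x' y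
    using that by (auto simp: bad_def)
  then show thesis
    using that h(1) unfolding Q_def by blast
qed

text \<open>Now \<open>h\<close> is inserted into the argument in which \<open>k\<close> is
  injective, so horizontal injectivity persists while the vertical pairs are repaired one by one,
  using that \<open>k\<close> also depends on its other argument. Pairs differing in both
  coordinates are separated by \<noteq>.\<close>

lemma ex_separating_grid:
  assumes g: "mem 2 (bin g)" and ess: "\<exists>x y y'. g x y \<noteq> g x y'" "\<exists>x x' y. g x y \<noteq> g x' y"
  obtains h where "mem 2 (bin h)"
    "\<And>x y x' y'. x < N \<Longrightarrow> y < N \<Longrightarrow> x' < N \<Longrightarrow> y' < N \<Longrightarrow> h x y = h x' y' \<Longrightarrow> x = x' \<and> y = y'"
proof -
  \<comment> \<open>\<open>h\<close> has at most \<open>N * N\<close> values on the grid, which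
    \<alpha> has to fit below \<open>M\<close>, where \<open>k\<close> is controlled; \<beta> has to
    fit \<open>N\<close> arguments, and \<open>ex_separating_horizontal\<close> asks for at least
    2.\<close>
  define M where "M = N * N + N + 2"
  have "M \<ge> 2"
    by (simp add: M_def)
  from ex_separating_horizontal[OF g ess this] obtain k where k: "mem 2 (bin k)"
    "\<And>x x' y. x < M \<Longrightarrow> x' < M \<Longrightarrow> y < M \<Longrightarrow> k x y = k x' y \<Longrightarrow> x = x'"
    "\<exists>x<M. \<exists>y<M. \<exists>y'<M. k x y \<noteq> k x y'"
    by blast
  then obtain x0 u0 u1 where u: "x0 < M" "u0 < M" "u1 < M" "k x0 u0 \<noteq> k x0 u1"
    by blast
  define Q where "Q h \<longleftrightarrow> mem 2 (bin h) \<and>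
    (\<forall>x<N. \<forall>x'<N. \<forall>y<N. h x y = h x' y \<longrightarrow> x = x')" for h
  define bad where "bad h = {(x, y, y'). x < N \<and> y < N \<and> y' < N \<and> y \<noteq> y' \<and> h x y = h x y'}"
    for h :: "nat \<Rightarrow> nat \<Rightarrow> nat"
  have fin: "finite (bad h)" for h
    by (rule finite_subset[of _ "{..<N} \<times> {..<N} \<times> {..<N}"]) (auto simp: bad_def)
  have "mem 2 (bin (\<lambda>x y. x))"
    unfolding bin_def by (rule mem_proj) simp
  then have "Q (\<lambda>x y. x)"
    by (simp add: Q_def)
  then obtain h where h: "Q h" "\<And>h'. Q h' \<Longrightarrow> card (bad h) \<le> card (bad h')"
    using ex_has_least_nat[of Q _ "\<lambda>h. card (bad h)"] by blast
  have "bad h = {}"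
  proof (rule ccontr)
    assume "bad h \<noteq> {}"
    then obtain s t t' where st: "(s, t, t') \<in> bad h"
      by auto
    define X where "X = (\<lambda>(x, y). h x y) ` ({..<N} \<times> {..<N})"
    have "card X \<le> N * N"
      unfolding X_def by (rule order_trans[OF card_image_le]) auto
    then have X: "finite X" "card X \<le> M"
      by (auto simp: X_def M_def)
    have hX: "h x y \<in> X" if "x < N" "y < N" for x y
      using that by (force simp: X_def)
    obtain \<alpha> where \<alpha>: "bij \<alpha>" "\<And>v. v \<in> {h s t} \<Longrightarrow> \<alpha> v = x0" "\<And>v. v \<in> X \<Longrightarrow> \<alpha> v < M"
      using bij_extension_into[OF X, of "{h s t}" "\<lambda>_. x0"] hX st u(1) by (auto simp: bad_def)
    have "u0 \<noteq> u1" "t \<noteq> t'"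
      using u st by (auto simp: bad_def)
    then obtain \<beta> where \<beta>: "bij \<beta>" "\<And>v. v \<in> {t, t'} \<Longrightarrow> \<beta> v = (if v = t then u0 else u1)"
      "\<And>v. v \<in> {..<N} \<Longrightarrow> \<beta> v < M"
      using bij_extension_into[of "{..<N}" M "{t, t'}" "\<lambda>v. if v = t then u0 else u1"] st u(2,3)
      by (auto simp: bad_def M_def)
    define h' where "h' x y = k (\<alpha> (h x y)) (\<beta> y)" for x y
    have inj: "inj \<alpha>" "inj \<beta>"
      using \<alpha>(1) \<beta>(1) by (simp_all add: bij_is_inj)
    have "mem 2 (\<lambda>xs. k (\<alpha> (bin h xs)) (\<beta> (xs ! 1)))"
      by (rule mem_bin[OF k(1)]) (use inj h(1) in \<open>auto intro: mem_inj_proj mem_inj simp: Q_def\<close>)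
    then have "mem 2 (bin h')"
      by (rule mem_if_kernel) (simp add: bin_def h'_def)
    moreover have "x = x'" if "x < N" "x' < N" "y < N" "h' x y = h' x' y" for x x' y
    proof -
      have "\<alpha> (h x y) = \<alpha> (h x' y)"
        using k(2)[of "\<alpha> (h x y)" "\<alpha> (h x' y)" "\<beta> y"] that hX \<alpha>(3) \<beta>(3) by (simp add: h'_def)
      then show ?thesis
        using h(1) that inj by (auto simp: inj_eq Q_def)
    qed
    ultimately have Q': "Q h'"
      unfolding Q_def by blast
    have "bad h' \<subseteq> bad h"
    proof (clarsimp simp: bad_def)
      fix x y y'
      assume "y \<noteq> y'" "h' x y = h' x y'"
      then show "h x y = h x y'"
        using mem_bin_neq[OF k(1), of "\<alpha> (h x y)" "\<alpha> (h x y')" "\<beta> y" "\<beta> y'"] inj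
        by (auto simp: h'_def inj_eq)
    qed
    moreover have "(s, t, t') \<notin> bad h'"
      using st \<alpha>(2) \<beta>(2) u(4) by (auto simp: bad_def h'_def)
    ultimately have "bad h' \<subset> bad h"
      using st by blast
    then have "card (bad h') < card (bad h)"
      by (rule psubset_card_mono[OF fin])
    then show False
      using h(2)[OF Q'] by simp
  qed
  then have "x = x' \<and> y = y'" if "x < N" "y < N" "x' < N" "y' < N" "h x y = h x' y'" for x y x' y'
    using that h(1) mem_bin_neq[of h x x' y y'] unfolding bad_def Q_def by blast
  then show thesis
    using that h(1) unfolding Q_def by blast
qed

lemma mem_pair:
  assumes "mem 2 (bin g)" "\<exists>x y y'. g x y \<noteq> g x y'" "\<exists>x x' y. g x y \<noteq> g x' y"
  shows "mem 2 (bin (\<lambda>x y. prod_encode (x, y)))"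
proof (rule mem_bin_if_kernels)
  fix N
  obtain h where h: "mem 2 (bin h)"
    "\<And>x y x' y'. x < N \<Longrightarrow> y < N \<Longrightarrow> x' < N \<Longrightarrow> y' < N \<Longrightarrow> h x y = h x' y' \<Longrightarrow> x = x' \<and> y = y'"
    using ex_separating_grid[OF assms, where N = N] by blast
  then show "\<exists>g. mem 2 (bin g) \<and> (\<forall>x<N. \<forall>y<N. \<forall>x'<N. \<forall>y'<N.
      g x y = g x' y' \<longleftrightarrow> prod_encode (x, y) = prod_encode (x', y'))"
    by (intro exI[of _ h]) auto
qed

end

subsection \<open>The clone of operations injective up to fictitious variables\<close>

text \<open>\<open>J\<close> is the set of essential variables, and the operation is injective in
  them: a description of \<open>clone_H\<close> that does not mention the injection.\<close>

definition agree_kernel :: "nat \<Rightarrow> (nat list \<Rightarrow> nat) \<Rightarrow> nat set \<Rightarrow> bool" where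
  "agree_kernel n F J \<longleftrightarrow> J \<subseteq> {..<n} \<and> J \<noteq> {} \<and>
    (\<forall>a b. length a = n \<longrightarrow> length b = n \<longrightarrow> (F a = F b \<longleftrightarrow> (\<forall>i\<in>J. a ! i = b ! i)))"

lemma agree_kernelD:
  "agree_kernel n F J \<Longrightarrow> length a = n \<Longrightarrow> length b = n \<Longrightarrow> F a = F b \<longleftrightarrow> (\<forall>i\<in>J. a ! i = b ! i)"
  by (simp add: agree_kernel_def)

lemma agree_kernel_nonempty: "agree_kernel n F J \<Longrightarrow> J \<noteq> {}"
  and agree_kernel_subset: "agree_kernel n F J \<Longrightarrow> J \<subseteq> {..<n}"
  by (simp_all add: agree_kernel_def)

lemma opr_in_clone_H: "opr n F \<in> clone_H \<longleftrightarrow> (\<exists>J. agree_kernel n F J)"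
proof
  assume "opr n F \<in> clone_H"
  then obtain m i js where i: "n \<ge> 1" "m \<ge> 1" "i \<in> ops m" "injective_op i" "length js = m" "set js \<subseteq> {..<n}"
    and F: "opr n F = op_comp n i (map (proj n) js)"
    unfolding clone_H_def op_comp_eq_opr by (auto simp: opr_eq_iff)
  have F': "F a = snd i (map ((!) a) js)" if "length a = n" for a
    using F that by (simp add: op_comp_eq_opr proj_eq_opr opr_eq_iff comp_def)
  have "inj_on (snd i) (tuples m)"
    using i(3,4) by (auto simp: injective_op_def ops_def)
  then have "F a = F b \<longleftrightarrow> map ((!) a) js = map ((!) b) js" if "length a = n" "length b = n" for a b
    using that i(5) by (simp add: F' inj_on_eq_iff)
  then have "agree_kernel n F (set js)"
    using i by (auto simp: agree_kernel_def)
  then show "\<exists>J. agree_kernel n F J"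
    by blast
next
  assume "\<exists>J. agree_kernel n F J"
  then obtain J where J: "agree_kernel n F J"
    by blast
  then have "finite J"
    by (auto simp: agree_kernel_def intro: finite_subset)
  then obtain js where js: "set js = J" "distinct js"
    using finite_distinct_list by blast
  define m where "m = length js"
  \<comment> \<open>A section of the restriction to \<open>J\<close>; the fictitious coordinates are
    filled with 0.\<close>
  define ext where "ext ys = map (\<lambda>i. case map_of (zip js ys) i of Some y \<Rightarrow> y | None \<Rightarrow> 0) [0..<n]" for ys :: "nat list"
  have Jn: "J \<subseteq> {..<n}" "J \<noteq> {}"
    using J by (auto simp: agree_kernel_def)
  have ext_nth: "ext ys ! (js ! k) = ys ! k" if "length ys = m" "k < m" for ys k
  proof -
    have "js ! k < n"
      using that js(1) Jn(1) nth_mem[of k js] by (auto simp: m_def)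
    then show ?thesis
      using that js(2) by (simp add: ext_def m_def map_of_zip_nth)
  qed
  have length_ext: "length (ext ys) = n" for ys
    by (simp add: ext_def)
  let ?i = "opr m (\<lambda>ys. F (ext ys))"
  have "ys = zs" if "length ys = m" "length zs = m" "F (ext ys) = F (ext zs)" for ys zs
  proof (rule nth_equalityI)
    fix k assume "k < length ys"
    then have k: "k < m" "js ! k \<in> J"
      using that(1) js(1) nth_mem[of k js] by (auto simp: m_def)
    then have "ext ys ! (js ! k) = ext zs ! (js ! k)"
      using agree_kernelD[OF J length_ext length_ext] that(3) by blast
    then show "ys ! k = zs ! k"
      using ext_nth that k(1) by simp
  qed (use that in simp)
  then have "injective_op ?i"
    by (auto simp: injective_op_def inj_on_def)
  moreover have "m \<ge> 1" "n \<ge> 1"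
    using Jn js(1) by (auto simp: m_def Suc_le_eq)
  moreover have "opr n F = op_comp n ?i (map (proj n) js)"
    unfolding op_comp_eq_opr
  proof (rule opr_cong)
    fix a :: "nat list"
    assume a: "length a = n"
    have "\<forall>i\<in>J. a ! i = ext (map ((!) a) js) ! i"
      using ext_nth[of "map ((!) a) js"] js(1) by (auto simp: m_def in_set_conv_nth)
    then have "F a = F (ext (map ((!) a) js))"
      using agree_kernelD[OF J a length_ext] by blast
    then show "F a = snd ?i (map (\<lambda>g. snd g a) (map (proj n) js))"
      using a by (simp add: proj_eq_opr m_def comp_def)
  qed
  ultimately show "opr n F \<in> clone_H"
    unfolding clone_H_def mem_Collect_eq using js(1) Jn(1) m_def
    by (intro exI[of _ n] exI[of _ m] exI[of _ ?i] exI[of _ js]) simp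
qed

lemma clone_H_subset: "clone_H \<subseteq> all_ops"
  by (auto simp: clone_H_def op_comp_eq_opr)

text \<open>Under composition the sets of essential variables are united. For limits, there are only
  finitely many candidates for \<open>J\<close> and a wrong one is refuted by a single pair of
  tuples, so one finite set of arguments refutes all of them.\<close>

lemma local_clone_H: "local_clone clone_H"
proof (rule local_cloneI[OF clone_H_subset])
  fix n i :: nat
  assume "i < n"
  then have "agree_kernel n (\<lambda>xs. xs ! i) {i}"
    by (simp add: agree_kernel_def)
  then show "opr n (\<lambda>xs. xs ! i) \<in> clone_H"
    unfolding opr_in_clone_H by blast
next
  fix n m :: nat and F G
  assume F: "opr n F \<in> clone_H" and G: "\<And>j. j < n \<Longrightarrow> opr m (G j) \<in> clone_H"
  obtain J where J: "agree_kernel n F J"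
    using F opr_in_clone_H by blast
  have "\<forall>j. \<exists>K. j < n \<longrightarrow> agree_kernel m (G j) K"
    using G opr_in_clone_H by blast
  then obtain K where K: "\<And>j. j < n \<Longrightarrow> agree_kernel m (G j) (K j)"
    by metis
  have "agree_kernel m (\<lambda>xs. F (map (\<lambda>j. G j xs) [0..<n])) (\<Union>j\<in>J. K j)"
    unfolding agree_kernel_def
  proof (intro conjI allI impI)
    have sub: "j < n" if "j \<in> J" for j
      using agree_kernel_subset[OF J] that by auto
    show "(\<Union>j\<in>J. K j) \<subseteq> {..<m}"
      using agree_kernel_subset[OF K] sub by blast
    obtain j where "j \<in> J"
      using agree_kernel_nonempty[OF J] by blast
    then show "(\<Union>j\<in>J. K j) \<noteq> {}"
      using agree_kernel_nonempty[OF K[OF sub]] by blast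
    fix a b :: "nat list"
    assume ab: "length a = m" "length b = m"
    have "F (map (\<lambda>j. G j a) [0..<n]) = F (map (\<lambda>j. G j b) [0..<n]) \<longleftrightarrow> (\<forall>j\<in>J. G j a = G j b)"
      using sub by (simp add: agree_kernelD[OF J])
    also have "\<dots> \<longleftrightarrow> (\<forall>j\<in>J. \<forall>i\<in>K j. a ! i = b ! i)"
      using sub agree_kernelD[OF K ab] by simp
    finally show "F (map (\<lambda>j. G j a) [0..<n]) = F (map (\<lambda>j. G j b) [0..<n]) \<longleftrightarrow>
        (\<forall>i\<in>\<Union>j\<in>J. K j. a ! i = b ! i)"
      by blast
  qed
  then show "opr m (\<lambda>xs. F (map (\<lambda>j. G j xs) [0..<n])) \<in> clone_H"
    unfolding opr_in_clone_H by blast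
next
  fix n :: nat and F
  assume *: "\<And>A. finite A \<Longrightarrow> A \<subseteq> tuples n \<Longrightarrow> \<exists>G. opr n G \<in> clone_H \<and> (\<forall>a\<in>A. G a = F a)"
  show "opr n F \<in> clone_H"
  proof (rule ccontr)
    assume no: "opr n F \<notin> clone_H"
    define I where "I = {J. J \<subseteq> {..<n} \<and> J \<noteq> {}}"
    have "\<exists>a b. length a = n \<and> length b = n \<and> (F a = F b) \<noteq> (\<forall>i\<in>J. a ! i = b ! i)" if "J \<in> I" for J
    proof -
      have "\<not> agree_kernel n F J"
        using no opr_in_clone_H by blast
      then show ?thesis
        using that unfolding agree_kernel_def I_def by blast
    qed
    then obtain a b where ab: "\<And>J. J \<in> I \<Longrightarrow> length (a J) = n \<and> length (b J) = n \<and>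
        (F (a J) = F (b J)) \<noteq> (\<forall>i\<in>J. a J ! i = b J ! i)"
      by metis
    have "finite I"
      unfolding I_def by simp
    then have "finite (a ` I \<union> b ` I)"
      by simp
    moreover have "a ` I \<union> b ` I \<subseteq> tuples n"
      using ab by auto
    ultimately have "\<exists>G. opr n G \<in> clone_H \<and> (\<forall>x\<in>a ` I \<union> b ` I. G x = F x)"
      by (rule *)
    then obtain G where G: "opr n G \<in> clone_H" "\<forall>x\<in>a ` I \<union> b ` I. G x = F x"
      by (elim exE conjE)
    then obtain J where J: "agree_kernel n G J"
      using opr_in_clone_H by blast
    then have "J \<in> I"
      by (simp add: I_def agree_kernel_def)
    moreover from this have "G (a J) = F (a J)" "G (b J) = F (b J)"
      using G(2) by auto
    moreover have "G (a J) = G (b J) \<longleftrightarrow> (\<forall>i\<in>J. a J ! i = b J ! i)"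
      using agree_kernelD[OF J] ab[OF \<open>J \<in> I\<close>] by blast
    ultimately show False
      using ab[of J] by metis
  qed
qed

lemma permutations_subset_clone_H: "permutations \<subseteq> clone_H"
proof
  fix f assume "f \<in> permutations"
  then obtain g where g: "bij g" "f = opr 1 (\<lambda>xs. g (hd xs))"
    by (auto simp: permutations_def unary_eq_opr)
  have "agree_kernel 1 (\<lambda>xs. g (hd xs)) {0}"
    using bij_is_inj[OF g(1)] by (auto simp: agree_kernel_def length_Suc_conv inj_eq)
  then show "f \<in> clone_H"
    using g opr_in_clone_H by blast
qed

lemma clone_H_subset_Pol_neq: "clone_H \<subseteq> Pol {neq_rel}"
proof
  fix f assume f: "f \<in> clone_H"
  obtain n F where nF: "f = opr n F" "n \<ge> 1"
    using f clone_H_subset all_ops_cases by blast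
  then obtain J where J: "agree_kernel n F J"
    using f opr_in_clone_H by blast
  obtain i where "i \<in> J" "i < n"
    using agree_kernel_nonempty[OF J] agree_kernel_subset[OF J] by blast
  then have "pres_neq n F"
    using agree_kernelD[OF J] unfolding pres_neq_def by blast
  then show "f \<in> Pol {neq_rel}"
    using nF opr_in_Pol_neq by simp
qed

lemma clone_H_in_monoidal_interval: "clone_H \<in> monoidal_interval injective_unary"
  by (rule monoidal_intervalI[OF local_clone_H permutations_subset_clone_H clone_H_subset_Pol_neq])

definition pair_op :: "nat list \<Rightarrow> nat" where
  "pair_op = bin (\<lambda>x y. prod_encode (x, y))"

lemma pair_op_in_clone_H: "opr 2 pair_op \<in> clone_H"
proof -
  have "agree_kernel 2 pair_op {0, 1}"
    by (auto simp: agree_kernel_def pair_op_def length_2_iff)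
  then show ?thesis
    unfolding opr_in_clone_H by blast
qed

context perm_clone
begin

text \<open>Each pairing with a further projection intersects the kernel with equality in one more
  coordinate.\<close>

lemma mem_agree_kernel:
  assumes pair: "mem 2 pair_op" and J: "agree_kernel n F J"
  shows "mem n F"
proof -
  have "finite J" "J \<noteq> {}" "J \<subseteq> {..<n}"
    using agree_kernel_nonempty[OF J] agree_kernel_subset[OF J] finite_subset by auto
  then have "\<exists>G. mem n G \<and> (\<forall>a b. G a = G b \<longleftrightarrow> (\<forall>i\<in>J. a ! i = b ! i))"
  proof (induction J rule: finite_ne_induct)
    case (singleton i)
    then show ?case
      by (intro exI[of _ "\<lambda>xs. xs ! i"]) (simp add: mem_proj)
  next
    case (insert i J)
    then obtain G where G: "mem n G" "\<forall>a b. G a = G b \<longleftrightarrow> (\<forall>i\<in>J. a ! i = b ! i)"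
      by auto
    have "mem n (\<lambda>xs. prod_encode (xs ! i, G xs))"
      by (rule mem_bin[OF pair[unfolded pair_op_def]]) (use G(1) insert.prems in \<open>auto intro: mem_proj\<close>)
    then show ?case
      by (intro exI[of _ "\<lambda>xs. prod_encode (xs ! i, G xs)"]) (simp add: G(2))
  qed
  then obtain G where G: "mem n G" "\<forall>a b. G a = G b \<longleftrightarrow> (\<forall>i\<in>J. a ! i = b ! i)"
    by (elim exE conjE)
  show ?thesis
    by (rule mem_if_kernel[OF G(1)]) (simp add: G(2) agree_kernelD[OF J])
qed

lemma clone_H_subset_if_pair:
  assumes "mem 2 pair_op"
  shows "clone_H \<subseteq> C"
proof
  fix f assume f: "f \<in> clone_H"
  then obtain n F where nF: "f = opr n F" "n \<ge> 1"
    using clone_H_subset all_ops_cases by blast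
  then show "f \<in> C"
    using f opr_in_clone_H mem_agree_kernel[OF assms] by blast
qed

end

text \<open>All binary injections have the same kernel, namely equality, so each of them produces
  \<open>pair_op\<close>.\<close>

lemma generated_binary_injection:
  assumes p: "p \<in> ops 2" "injective_op p"
  shows "generated {p} = clone_H"
proof
  have p_eq: "p = opr 2 (snd p)"
    by (rule ops_eq_opr[OF p(1)])
  have p_kernel: "snd p a = snd p b \<longleftrightarrow> a = b" if "length a = 2" "length b = 2" for a b
  proof -
    have "inj_on (snd p) (tuples 2)"
      using p by (auto simp: injective_op_def ops_def)
    then show ?thesis
      using that by (simp add: inj_on_eq_iff)
  qed
  have "agree_kernel 2 (snd p) {0, 1}"
    by (auto simp: agree_kernel_def p_kernel length_2_iff)
  then have "p \<in> clone_H"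
    using p_eq opr_in_clone_H by metis
  then show "generated {p} \<subseteq> clone_H"
    by (intro generated_minimal permutations_subset_clone_H local_clone_H) auto
  interpret perm_clone "generated {p}"
  proof
    show "local_clone (generated {p})"
      using \<open>p \<in> clone_H\<close> clone_H_subset by (intro local_clone_generated) blast
  qed (rule permutations_subset_generated)
  have "mem 2 (snd p)"
    using p_eq subset_generated[of "{p}"] by auto
  then have "mem 2 pair_op"
    by (rule mem_if_kernel) (auto simp: p_kernel pair_op_def length_2_iff)
  then show "clone_H \<subseteq> generated {p}"
    by (rule clone_H_subset_if_pair)
qed

context inj_clone
begin

lemma ex_depends:
  assumes "mem n F"
  obtains i where "i < n" "depends n F i"
proof (rule ccontr)
  assume not_thesis: "\<not> thesis"
  note ex = that
  have "F (replicate n 0) = F (replicate n 1)"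
  proof (rule eq_if_agree_on_depends[where n = n and F = F])
    fix k assume "k < n" "depends n F k"
    then show "replicate n 0 ! k = replicate n 1 ! k"
      using ex not_thesis by blast
  qed simp_all
  then show False
    using mem_neq[OF assms, of "replicate n 0" "replicate n 1"] by simp
qed

lemma mem_if_depends_on_one:
  assumes F: "mem n F" and one: "\<And>i j. i < n \<Longrightarrow> j < n \<Longrightarrow> depends n F i \<Longrightarrow> depends n F j \<Longrightarrow> i = j"
  shows "opr n F \<in> generated injective_unary"
proof -
  have "generated injective_unary \<in> monoidal_interval injective_unary"
    by (rule generated_in_monoidal_interval) (use Pol_neq_unary in blast)
  then interpret U: perm_clone "generated injective_unary"
    by unfold_locales (auto simp: monoidal_interval_iff)
  obtain i where i: "i < n" "depends n F i"
    using ex_depends[OF F] by blast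
  define g where "g x = F (replicate n x)" for x
  have "inj g"
  proof (rule injI, rule ccontr)
    fix x y assume "g x = g y" "x \<noteq> y"
    then show False
      using mem_neq[OF F, of "replicate n x" "replicate n y"] by (simp add: g_def)
  qed
  then have "U.mem n (\<lambda>xs. g (xs ! i))"
    using i(1) by (rule U.mem_inj_proj)
  moreover have "opr n (\<lambda>xs. g (xs ! i)) = opr n F"
  proof (rule opr_cong)
    fix xs :: "nat list"
    assume xs: "length xs = n"
    show "g (xs ! i) = F xs"
      unfolding g_def
    proof (rule eq_if_agree_on_depends[where n = n and F = F])
      fix k assume "k < n" "depends n F k"
      then show "replicate n (xs ! i) ! k = xs ! k"
        using i one[of i k] by simp
    qed (simp_all add: xs)
  qed
  ultimately show ?thesis
    by simp
qed

lemma clone_H_subset_or_trivial: "C \<subseteq> generated injective_unary \<or> clone_H \<subseteq> C"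
proof (rule disjCI)
  assume no: "\<not> clone_H \<subseteq> C"
  show "C \<subseteq> generated injective_unary"
  proof
    fix f assume f: "f \<in> C"
    then obtain n F where nF: "f = opr n F" "n \<ge> 1"
      using local_clone_subset[OF local_clone] all_ops_cases by blast
    then have F: "mem n F"
      using f by simp
    have "i = j" if ij: "i < n" "j < n" "depends n F i" "depends n F j" for i j
    proof (rule ccontr)
      assume "i \<noteq> j"
      then obtain g where "mem 2 (bin g)" "\<exists>x y y'. g x y \<noteq> g x y'" "\<exists>x x' y. g x y \<noteq> g x' y"
        using ex_essentially_binary[OF F ij(1,3,4)] by metis
      then have "mem 2 pair_op"
        using mem_pair unfolding pair_op_def by blast
      then show False
        using no clone_H_subset_if_pair by blast
    qed
    then show "f \<in> generated injective_unary"
      using mem_if_depends_on_one[OF F] nF(1) by blast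
  qed
qed

end

lemma monoidal_interval_inj_clone: "C \<in> monoidal_interval injective_unary \<Longrightarrow> inj_clone C"
  unfolding monoidal_interval_iff by (simp add: inj_clone_def perm_clone_def inj_clone_axioms_def)

lemma generated_injective_unary_subset:
  assumes "C \<in> monoidal_interval injective_unary"
  shows "generated injective_unary \<subseteq> C"
  using assms unfolding monoidal_interval_iff
  by (intro generated_minimal) (auto simp: assms monoidal_interval_def dest: injective_unary_subset_local_clone)

lemma clone_H_subset_if_nontrivial:
  assumes "C \<in> monoidal_interval injective_unary" "C \<noteq> generated injective_unary"
  shows "clone_H \<subseteq> C"
  using inj_clone.clone_H_subset_or_trivial[OF monoidal_interval_inj_clone[OF assms(1)]]
    generated_injective_unary_subset[OF assms(1)] assms(2) by blast

lemma generated_injective_unary_in_monoidal_interval: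
  "generated injective_unary \<in> monoidal_interval injective_unary"
  by (rule generated_in_monoidal_interval) (use Pol_neq_unary in blast)

text \<open>Unary operations preserve \<open>a = b \<or> c = d\<close>. A binary injection, applied
  to a tuple satisfying only the first equation and one satisfying only the second, destroys
  both.\<close>

lemma clone_H_nontrivial: "clone_H \<noteq> generated injective_unary"
proof
  assume eq: "clone_H = generated injective_unary"
  define \<rho> :: rel where "\<rho> = (4, {[a, b, c, d] |a b c d. a = b \<or> c = d})"
  have "\<rho> \<in> all_rels"
    by (auto simp: \<rho>_def all_rels_def)
  have "f \<in> Pol {\<rho>}" if f: "f \<in> injective_unary" for f
  proof -
    obtain g where g: "f = opr 1 (\<lambda>xs. g (hd xs))"
      using f by (auto simp: injective_unary_def unary_eq_opr)
    have "preserves (opr 1 (\<lambda>xs. g (hd xs))) \<rho>"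
      unfolding \<rho>_def preserves_opr by (auto simp: length_Suc_conv numeral_eq_Suc)
    then show ?thesis
      using g by (simp add: Pol_def)
  qed
  then have "generated injective_unary \<subseteq> Pol {\<rho>}"
    using \<open>\<rho> \<in> all_rels\<close> permutations_subset_injective_unary
    by (intro generated_minimal local_clone_Pol) auto
  then have "preserves (opr 2 pair_op) \<rho>"
    using pair_op_in_clone_H eq by (auto simp: Pol_def)
  moreover have "length [[0, 0, 0, 1], [0, 1, 0, 0 :: nat]] = 2"
    "set [[0, 0, 0, 1], [0, 1, 0, 0]] \<subseteq> {[a, b, c, d] |a b c d. a = b \<or> c = (d :: nat)}"
    by auto
  ultimately have "map (\<lambda>j. pair_op (map (\<lambda>t. t ! j) [[0, 0, 0, 1], [0, 1, 0, 0]])) [0..<4] \<in>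
      {[a, b, c, d] |a b c d. a = b \<or> c = d}"
    unfolding \<rho>_def preserves_opr by blast
  then show False
    by (simp add: numeral_eq_Suc pair_op_def)
qed

lemma unique_coverI:
  assumes "C \<in> P" "D \<in> P" "C \<subset> D" "\<And>E. E \<in> P \<Longrightarrow> C \<subset> E \<Longrightarrow> D \<subseteq> E"
  shows "unique_cover P D C"
  unfolding unique_cover_def covers_def
proof (intro conjI allI impI assms(1-3))
  show "\<not> (\<exists>E\<in>P. C \<subset> E \<and> E \<subset> D)"
    using assms(4) by blast
next
  fix E assume "C \<in> P \<and> E \<in> P \<and> C \<subset> E \<and> \<not> (\<exists>D\<in>P. C \<subset> D \<and> D \<subset> E)"
  then show "E = D"
    using assms by blast
qed

lemma unique_cover_clone_H:
  "unique_cover (monoidal_interval injective_unary) clone_H (generated injective_unary)"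
  by (rule unique_coverI)
    (use generated_injective_unary_in_monoidal_interval clone_H_in_monoidal_interval clone_H_nontrivial
      generated_injective_unary_subset clone_H_subset_if_nontrivial in blast)+

subsection \<open>Horn relations\<close>

lemma Horn_Pos_unique:
  assumes "length (filter is_Pos c) \<le> 1" "Pos i j \<in> set c" "Pos i' j' \<in> set c"
  shows "i = i' \<and> j = j'"
proof -
  have "Pos i j \<in> set (filter is_Pos c)" "Pos i' j' \<in> set (filter is_Pos c)"
    using assms(2,3) by auto
  moreover obtain l where "set (filter is_Pos c) \<subseteq> {l}"
    using assms(1) by (cases "filter is_Pos c") auto
  ultimately have "Pos i j = Pos i' j'"
    by (metis singletonD subsetD)
  then show ?thesis
    by simp
qed

lemma agree_kernel_list_encode: "n \<ge> 1 \<Longrightarrow> agree_kernel n list_encode {..<n}"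
  by (auto simp: agree_kernel_def list_encode_eq list_eq_iff_nth_eq lessThan_empty_iff)

text \<open>If a clause fails at the result, its negative literals fail there, hence in every row
  with index in \<open>J\<close>. Each of these rows must therefore satisfy a positive literal of
  the clause; there is at most one, so all of them satisfy the same equation, and the result
  inherits it.\<close>

lemma Horn_definable_preserved:
  assumes "Horn_definable (k, R)" and J: "agree_kernel n F J"
  shows "preserves (opr n F) (k, R)"
proof -
  obtain \<phi> where \<phi>: "Horn \<phi>" "cnf_vars \<phi> \<subseteq> {..<k}" "R = {xs \<in> tuples k. cnf_holds xs \<phi>}"
    using assms(1) by (auto simp: Horn_definable_def)
  show ?thesis
    unfolding preserves_opr
  proof (intro allI impI)
    fix ts :: "nat list list"
    assume ts: "length ts = n" "set ts \<subseteq> R"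
    define t where "t = map (\<lambda>j. F (map (\<lambda>s. s ! j) ts)) [0..<k]"
    have Jn: "l < n" if "l \<in> J" for l
      using agree_kernel_subset[OF J] that by auto
    have t: "t ! i = t ! j \<longleftrightarrow> (\<forall>l\<in>J. ts ! l ! i = ts ! l ! j)" if "i < k" "j < k" for i j
      using that ts(1) Jn by (simp add: t_def agree_kernelD[OF J])
    have "\<exists>l\<in>set c. literal_holds t l" if c: "c \<in> set \<phi>" for c
    proof (rule ccontr)
      assume no: "\<not> (\<exists>l\<in>set c. literal_holds t l)"
      have vars: "i < k \<and> j < k" if "Pos i j \<in> set c \<or> Neg i j \<in> set c" for i j
      proof -
        have "{i, j} \<subseteq> cnf_vars \<phi>"
          unfolding cnf_vars_def using c that by (force simp del: insert_subset)
        then show ?thesis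
          using \<phi>(2) by auto
      qed
      have "\<exists>i j. Pos i j \<in> set c \<and> ts ! l ! i = ts ! l ! j" if l: "l \<in> J" for l
      proof -
        have "ts ! l \<in> R"
          using ts Jn[OF l] nth_mem[of l ts] by auto
        then obtain lit where lit: "lit \<in> set c" "literal_holds (ts ! l) lit"
          using c by (auto simp: \<phi>(3) cnf_holds_def)
        show ?thesis
        proof (cases lit)
          case (Neg i j)
          then have "t ! i \<noteq> t ! j"
            using lit t[of i j] vars[of i j] l by auto
          then show ?thesis
            using no lit Neg by auto
        qed (use lit in auto)
      qed
      then obtain i j where ij: "\<And>l. l \<in> J \<Longrightarrow> Pos (i l) (j l) \<in> set c \<and> ts ! l ! i l = ts ! l ! j l"
        by metis
      obtain l0 where l0: "l0 \<in> J"
        using agree_kernel_nonempty[OF J] by blast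
      have one: "length (filter is_Pos c) \<le> 1"
        using \<phi>(1) c by (simp add: Horn_def)
      have "i l = i l0 \<and> j l = j l0" if "l \<in> J" for l
        using Horn_Pos_unique[OF one] ij l0 that by blast
      then have "\<forall>l\<in>J. ts ! l ! i l0 = ts ! l ! j l0"
        using ij by metis
      then have "t ! i l0 = t ! j l0"
        using t vars ij[OF l0] by blast
      then show False
        using no ij[OF l0] literal_holds.simps(1) by blast
    qed
    then have "t \<in> R"
      by (simp add: \<phi>(3) cnf_holds_def t_def)
    then show "map (\<lambda>j. F (map (\<lambda>s. s ! j) ts)) [0..<k] \<in> R"
      by (simp add: t_def)
  qed
qed

text \<open>
  The equality patterns of the tuples of \<open>R\<close> are closed under intersection, so \<open>R\<close> is defined by the
  Horn clauses (with premises an arbitrary set of equations) that it satisfies.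
\<close>

lemma Horn_definable_if_preserved:
  assumes R: "R \<subseteq> tuples k" and pres: "\<And>f. f \<in> clone_H \<Longrightarrow> preserves f (k, R)"
  shows "Horn_definable (k, R)"
proof -
  define K where "K = {..<k} \<times> {..<k}"
  have "finite K"
    by (simp add: K_def)
  then have "\<forall>S. \<exists>l. S \<subseteq> K \<longrightarrow> set l = S"
    using finite_list finite_subset by metis
  then obtain L where L: "\<And>S. S \<subseteq> K \<Longrightarrow> set (L S) = S"
    by metis
  define cl where "cl S d = map (\<lambda>(i, j). Neg i j) (L S) @ d" for S and d :: "literal list"
  \<comment> \<open>The possible heads of a Horn clause: none, or one equation.\<close>
  define D where "D = insert [] ((\<lambda>(i, j). [Pos i j]) ` K)"
  define V where "V = {c \<in> (\<lambda>(S, d). cl S d) ` (Pow K \<times> D). \<forall>s\<in>R. \<exists>l\<in>set c. literal_holds s l}"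
  have "finite V"
    unfolding V_def D_def using \<open>finite K\<close> by simp
  then obtain \<phi> where \<phi>: "set \<phi> = V"
    using finite_list by blast
  have cl_holds: "(\<exists>l\<in>set (cl S d). literal_holds s l) \<longleftrightarrow>
      (\<forall>(i, j)\<in>S. s ! i = s ! j) \<longrightarrow> (\<exists>l\<in>set d. literal_holds s l)" if "S \<subseteq> K" for S d s
    unfolding cl_def using L[OF that] by (auto simp: split_beta) force
  have "filter is_Pos (map (\<lambda>(i, j). Neg i j) l) = []" for l
    by (auto simp: filter_empty_conv)
  then have "length (filter is_Pos c) \<le> 1" if "c \<in> V" for c
    using that by (auto simp: V_def D_def cl_def)
  then have "Horn \<phi>"
    by (simp add: Horn_def \<phi>)
  moreover have "cnf_vars \<phi> \<subseteq> {..<k}"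
  proof
    fix v assume "v \<in> cnf_vars \<phi>"
    then obtain S d l where "S \<subseteq> K" "d \<in> D" "l \<in> set (cl S d)" "v \<in> literal_vars l"
      by (auto simp: cnf_vars_def \<phi> V_def)
    then show "v \<in> {..<k}"
      using L[of S] by (auto simp: cl_def D_def K_def)
  qed
  moreover have "R = {xs \<in> tuples k. cnf_holds xs \<phi>}"
  proof (intro equalityI subsetI CollectI conjI)
    fix t assume "t \<in> R"
    then show "t \<in> tuples k" "cnf_holds t \<phi>"
      using R by (auto simp: cnf_holds_def \<phi> V_def)
  next
    fix t assume "t \<in> {xs \<in> tuples k. cnf_holds xs \<phi>}"
    then have t: "length t = k" "cnf_holds t \<phi>"
      by auto
    \<comment> \<open>The equality pattern of \<open>t\<close>. A clause with premises
      \<open>S\<close> and a head false at \<open>t\<close> fails at \<open>t\<close>, so it is not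
      valid in \<open>R\<close>: some tuple of \<open>R\<close> satisfies \<open>S\<close> but not
      the head.\<close>
    define S where "S = {(i, j). i < k \<and> j < k \<and> t ! i = t ! j}"
    have S: "S \<subseteq> K"
      by (auto simp: S_def K_def)
    have St: "\<forall>(i, j)\<in>S. t ! i = t ! j"
      by (auto simp: S_def)
    have ex: "\<exists>s\<in>R. (\<forall>(i, j)\<in>S. s ! i = s ! j) \<and> \<not> (\<exists>l\<in>set d. literal_holds s l)"
      if d: "d \<in> D" "\<not> (\<exists>l\<in>set d. literal_holds t l)" for d
    proof -
      have "\<not> (\<exists>l\<in>set (cl S d). literal_holds t l)"
        using cl_holds[OF S] St d(2) by simp
      then have "cl S d \<notin> V"
        using t(2) unfolding cnf_holds_def \<phi> by blast
      then show ?thesis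
        using cl_holds[OF S] S d(1) unfolding V_def by blast
    qed
    have "\<exists>s. \<forall>p\<in>K - S. s p \<in> R \<and> (\<forall>(i, j)\<in>S. s p ! i = s p ! j) \<and> s p ! fst p \<noteq> s p ! snd p"
    proof (rule bchoice, rule ballI)
      fix p assume p: "p \<in> K - S"
      have "[Pos (fst p) (snd p)] \<in> D"
        using p by (force simp: D_def)
      moreover have "t ! fst p \<noteq> t ! snd p"
        using p by (auto simp: S_def K_def)
      ultimately obtain s where "s \<in> R" "\<forall>(i, j)\<in>S. s ! i = s ! j" "s ! fst p \<noteq> s ! snd p"
        using ex[of "[Pos (fst p) (snd p)]"] by auto
      then show "\<exists>s. s \<in> R \<and> (\<forall>(i, j)\<in>S. s ! i = s ! j) \<and> s ! fst p \<noteq> s ! snd p"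
        by (intro exI[of _ s] conjI)
    qed
    then obtain s where s: "\<And>p. p \<in> K - S \<Longrightarrow> s p \<in> R \<and> (\<forall>(i, j)\<in>S. s p ! i = s p ! j) \<and> s p ! fst p \<noteq> s p ! snd p"
      by blast
    \<comment> \<open>The empty head supplies a tuple of \<open>R\<close> even if \<open>t\<close>
      is constant and \<open>K - S\<close> is empty; so \<open>ts\<close> has positive
      length.\<close>
    obtain s0 where s0: "s0 \<in> R" "\<forall>(i, j)\<in>S. s0 ! i = s0 ! j"
      using ex[of "[]"] by (auto simp: D_def)
    obtain ps where ps: "set ps = K - S"
      using \<open>finite K\<close> finite_list by blast
    define ts where "ts = s0 # map s ps"
    define n where "n = length ts"
    have "n \<ge> 1"
      by (simp add: n_def ts_def)
    then have enc: "opr n list_encode \<in> clone_H"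
      using opr_in_clone_H agree_kernel_list_encode by blast
    define r where "r = map (\<lambda>j. list_encode (map (\<lambda>s. s ! j) ts)) [0..<k]"
    have "set ts \<subseteq> R"
      using s0(1) s ps by (auto simp: ts_def)
    then have r: "r \<in> R"
      using pres[OF enc] unfolding preserves_opr r_def n_def by blast
    have r_eq: "r ! i = r ! j \<longleftrightarrow> t ! i = t ! j" if ij: "i < k" "j < k" for i j
    proof -
      have "r ! i = r ! j \<longleftrightarrow> (\<forall>u\<in>set ts. u ! i = u ! j)"
        using ij by (simp add: r_def list_encode_eq)
      also have "\<dots> \<longleftrightarrow> (i, j) \<in> S"
      proof
        assume *: "\<forall>u\<in>set ts. u ! i = u ! j"
        show "(i, j) \<in> S"
        proof (rule ccontr)
          assume "(i, j) \<notin> S"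
          then have p: "(i, j) \<in> K - S"
            using ij by (simp add: K_def)
          then have "s (i, j) \<in> set ts"
            using ps by (auto simp: ts_def)
          then show False
            using s[OF p] * by auto
        qed
      next
        assume "(i, j) \<in> S"
        then show "\<forall>u\<in>set ts. u ! i = u ! j"
          using s0(2) s ps by (fastforce simp: ts_def)
      qed
      finally show ?thesis
        using ij by (simp add: S_def)
    qed
    \<comment> \<open>\<open>r\<close> and \<open>t\<close> have the same equality pattern, so a
      permutation extending \<open>h\<close> carries \<open>r\<close> to \<open>t\<close>.\<close>
    define h where "h v = t ! (SOME j. j < k \<and> r ! j = v)" for v
    have h: "h (r ! j) = t ! j" if "j < k" for j
    proof -
      have "(SOME i. i < k \<and> r ! i = r ! j) < k \<and> r ! (SOME i. i < k \<and> r ! i = r ! j) = r ! j"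
        by (rule someI[of "\<lambda>i. i < k \<and> r ! i = r ! j" j]) (simp add: that)
      then show ?thesis
        using r_eq that unfolding h_def by blast
    qed
    have "inj_on h ((!) r ` {..<k})"
      using h r_eq by (auto simp: inj_on_def)
    from bij_extension[OF _ this] obtain g where g: "bij g" "\<And>v. v \<in> (!) r ` {..<k} \<Longrightarrow> g v = h v"
      by blast
    have "unary g \<in> clone_H"
      using g(1) permutations_subset_clone_H by (auto simp: permutations_def)
    then have "preserves (opr 1 (\<lambda>xs. g (hd xs))) (k, R)"
      using pres unfolding unary_eq_opr by blast
    then have "map (\<lambda>j. g (hd (map (\<lambda>t. t ! j) [r]))) [0..<k] \<in> R"
      unfolding preserves_opr by (elim allE[of _ "[r]"]) (use r in simp)
    moreover have "map (\<lambda>j. g (hd (map (\<lambda>t. t ! j) [r]))) [0..<k] = t"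
      using t(1) g(2) h by (auto intro: nth_equalityI)
    ultimately show "t \<in> R"
      by simp
  qed
  ultimately show ?thesis
    unfolding Horn_definable_def by auto
qed

lemma Inv_clone_H: "Inv clone_H = {\<rho> \<in> all_rels. Horn_definable \<rho>}"
proof (rule set_eqI)
  fix \<rho> :: rel
  obtain k R where \<rho>: "\<rho> = (k, R)"
    by (cases \<rho>)
  show "\<rho> \<in> Inv clone_H \<longleftrightarrow> \<rho> \<in> {\<rho> \<in> all_rels. Horn_definable \<rho>}"
  proof
    assume "\<rho> \<in> Inv clone_H"
    then have "\<rho> \<in> all_rels" "\<And>f. f \<in> clone_H \<Longrightarrow> preserves f \<rho>"
      by (auto simp: Inv_def)
    then show "\<rho> \<in> {\<rho> \<in> all_rels. Horn_definable \<rho>}"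
      using Horn_definable_if_preserved[of R k] by (auto simp: \<rho> all_rels_def)
  next
    assume \<rho>': "\<rho> \<in> {\<rho> \<in> all_rels. Horn_definable \<rho>}"
    have "preserves f \<rho>" if "f \<in> clone_H" for f
    proof -
      obtain n F where nF: "f = opr n F" "n \<ge> 1"
        using \<open>f \<in> clone_H\<close> clone_H_subset all_ops_cases by blast
      then obtain J where "agree_kernel n F J"
        using \<open>f \<in> clone_H\<close> opr_in_clone_H by blast
      then show ?thesis
        using Horn_definable_preserved \<rho>' nF by (simp add: \<rho>)
    qed
    then show "\<rho> \<in> Inv clone_H"
      using \<rho>' by (simp add: Inv_def)
  qed
qed

subsection \<open>Bar functions\<close>

lemma finite_lists_nth_bounded:
  assumes "finite (A :: nat list set)"
  obtains M where "\<And>a k. a \<in> A \<Longrightarrow> k < length a \<Longrightarrow> a ! k < M"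
  using finite_lists_bounded[OF assms] nth_mem by metis

lemma pres_neq_binI:
  assumes "\<And>x y x' y'. x \<noteq> x' \<Longrightarrow> y \<noteq> y' \<Longrightarrow> g x y \<noteq> g x' y'"
  shows "pres_neq 2 (bin g)"
  unfolding pres_neq_def bin_def using assms by simp

text \<open>A representative of the kernel common to all \<open>k\<close>-bar functions: the rows
  \<open>x < k\<close> shrink to a point each, and everything else stays apart.\<close>

definition bar :: "nat \<Rightarrow> nat \<Rightarrow> nat \<Rightarrow> nat" where
  "bar k x y = prod_encode (x, if x < k then 0 else Suc y)"

lemma bar_eq_iff: "bar k x y = bar k x' y' \<longleftrightarrow> x = x' \<and> (x < k \<or> y = y')"
  by (auto simp: bar_def)

lemma k_bar_function_kernel:
  assumes "k_bar_function k f"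
  obtains g where "f = opr 2 (bin g)" "k \<ge> 1" "\<And>x y x' y'. g x y = g x' y' \<longleftrightarrow> bar k x y = bar k x' y'"
proof -
  obtain p where p: "p \<in> ops 2" "injective_op p"
    and ge: "\<forall>x y. x \<ge> k \<longrightarrow> snd f [x, y] = snd p [x, y]"
    and lt: "\<forall>x y. x < k \<longrightarrow> snd f [x, y] = snd p [x, 0] \<and> snd p [x, 0] = x"
    and f: "f \<in> ops 2" "k \<ge> 1"
    using assms unfolding k_bar_function_def by blast
  define g where "g x y = snd f [x, y]" for x y
  have "f = opr 2 (snd f)"
    by (rule ops_eq_opr[OF f(1)])
  also have "\<dots> = opr 2 (bin g)"
    by (rule opr_cong) (auto simp: g_def bin_def length_2_iff)
  finally have "f = opr 2 (bin g)" .
  have "inj_on (snd p) (tuples 2)"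
    using p by (auto simp: injective_op_def ops_def)
  then have p_eq: "snd p [x, y] = snd p [x', y'] \<longleftrightarrow> x = x' \<and> y = y'" for x y x' y'
    by (simp add: inj_on_eq_iff)
  have g: "g x y = snd p [x, if x < k then 0 else y]" for x y
    using ge lt by (simp add: g_def)
  have "g x y = g x' y' \<longleftrightarrow> bar k x y = bar k x' y'" for x y x' y'
    by (auto simp: g p_eq bar_eq_iff)
  then show thesis
    by (rule that[OF \<open>f = opr 2 (bin g)\<close> f(2)])
qed

context perm_clone
begin

text \<open>The shift by \<open>k - 1\<close> makes row 0 the last collapsed one and moves every
  other row beyond the collapsed ones.\<close>

lemma mem_bar_1:
  assumes "mem 2 (bin (bar k))" "k \<ge> 1"
  shows "mem 2 (bin (bar 1))"
proof -
  have "inj (\<lambda>x. x + (k - 1))"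
    by (simp add: inj_def)
  then have "mem 2 (\<lambda>xs. bar k (xs ! 0 + (k - 1)) (xs ! 1))"
    by (intro mem_bin[OF assms(1)] mem_inj_proj[where g = "\<lambda>x. x + (k - 1)"] mem_proj) auto
  then show ?thesis
    by (rule mem_if_kernel) (use assms(2) in \<open>auto simp: bin_def bar_eq_iff\<close>)
qed

text \<open>Inserting \<open>bar 1\<close>, with row \<open>Suc k\<close> renamed to 0, into the
  second argument collapses one more row. With \<open>mem_bar_1\<close> this gives the independence
  of \<open>k\<close>.\<close>

lemma mem_bar:
  assumes "mem 2 (bin (bar 1))"
  shows "mem 2 (bin (bar (Suc k)))"
proof (induction k)
  case (Suc k)
  obtain \<alpha> :: "nat \<Rightarrow> nat" where \<alpha>: "inj \<alpha>" "\<alpha> (Suc k) = 0"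
    using inj_extension2[of "Suc k" 0 0 1] by (metis nat.distinct(1) zero_neq_one)
  have "mem 2 (\<lambda>xs. bar 1 (\<alpha> (xs ! 0)) (xs ! 1))"
    by (rule mem_bin[OF assms]) (use \<alpha> in \<open>auto intro: mem_proj mem_inj_proj\<close>)
  then have "mem 2 (\<lambda>xs. bar (Suc k) (xs ! 0) (bar 1 (\<alpha> (xs ! 0)) (xs ! 1)))"
    by (intro mem_bin[OF Suc] mem_proj) auto
  then show ?case
  proof (rule mem_if_kernel)
    fix a b :: "nat list"
    have \<alpha>0: "\<alpha> x < 1 \<longleftrightarrow> x = Suc k" for x
      using inj_eq[OF \<alpha>(1), of x "Suc k"] \<alpha>(2) by simp
    show "bar (Suc k) (a ! 0) (bar 1 (\<alpha> (a ! 0)) (a ! 1)) =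
        bar (Suc k) (b ! 0) (bar 1 (\<alpha> (b ! 0)) (b ! 1)) \<longleftrightarrow>
        bin (bar (Suc (Suc k))) a = bin (bar (Suc (Suc k))) b"
      unfolding bar_eq_iff bin_def \<alpha>0 less_Suc_eq[of _ "Suc k"] by metis
  qed
qed (use assms in simp)

lemma k_bar_function_mem_iff:
  assumes "k_bar_function k f"
  shows "f \<in> C \<longleftrightarrow> mem 2 (bin (bar 1))"
proof -
  obtain g where g: "f = opr 2 (bin g)" "k \<ge> 1" "\<And>x y x' y'. g x y = g x' y' \<longleftrightarrow> bar k x y = bar k x' y'"
    using k_bar_function_kernel[OF assms] by metis
  have "mem 2 (bin g) \<longleftrightarrow> mem 2 (bin (bar k))"
    using mem_bin_if_kernel[of g "bar k"] mem_bin_if_kernel[of "bar k" g] g(3) by blast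
  also have "\<dots> \<longleftrightarrow> mem 2 (bin (bar 1))"
    using mem_bar_1[of k] mem_bar[of "k - 1"] g(2) by fastforce
  finally show ?thesis
    using g(1) by simp
qed

text \<open>Pairing intersects kernels. On a finite set the kernel of \<open>F\<close> is an
  intersection of larger kernels available in the clone, one for each pair to be separated;
  \<open>K0\<close> starts the induction with no pair at all.\<close>

lemma mem_if_separated:
  assumes pair: "mem 2 pair_op" and n: "n \<ge> 1"
    and K0: "mem n K0" "\<And>a b. length a = n \<Longrightarrow> length b = n \<Longrightarrow> F a = F b \<Longrightarrow> K0 a = K0 b"
    and sep: "\<And>A p q. finite A \<Longrightarrow> A \<subseteq> tuples n \<Longrightarrow> p \<in> A \<Longrightarrow> q \<in> A \<Longrightarrow> F p \<noteq> F q \<Longrightarrow>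
      \<exists>K. mem n K \<and> K p \<noteq> K q \<and> (\<forall>a\<in>A. \<forall>b\<in>A. F a = F b \<longrightarrow> K a = K b)"
  shows "mem n F"
proof (rule mem_if_kernels[OF n])
  fix A :: "nat list set"
  assume A: "finite A" "A \<subseteq> tuples n"
  define P where "P = {(p, q) \<in> A \<times> A. F p \<noteq> F q}"
  have "finite P"
    using A(1) by (auto simp: P_def intro: finite_subset[of _ "A \<times> A"])
  then have "P \<subseteq> P \<Longrightarrow> \<exists>G. mem n G \<and> (\<forall>a\<in>A. \<forall>b\<in>A. F a = F b \<longrightarrow> G a = G b) \<and> (\<forall>r\<in>P. G (fst r) \<noteq> G (snd r))"
  proof (induction P rule: finite_subset_induct')
    case empty
    then show ?case
      using K0 A(2) by (intro exI[of _ K0]) (auto simp: subset_iff)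
  next
    case (insert r P')
    then obtain G where G: "mem n G" "\<forall>a\<in>A. \<forall>b\<in>A. F a = F b \<longrightarrow> G a = G b" "\<forall>r\<in>P'. G (fst r) \<noteq> G (snd r)"
      by (elim exE conjE)
    have "fst r \<in> A" "snd r \<in> A" "F (fst r) \<noteq> F (snd r)"
      using insert.hyps by (auto simp: P_def)
    from sep[OF A this] obtain K where K: "mem n K" "K (fst r) \<noteq> K (snd r)"
      "\<forall>a\<in>A. \<forall>b\<in>A. F a = F b \<longrightarrow> K a = K b"
      by (elim exE conjE)
    have "mem n (\<lambda>xs. prod_encode (G xs, K xs))"
      by (rule mem_bin[OF pair[unfolded pair_op_def] G(1) K(1)])
    moreover have "\<forall>a\<in>A. \<forall>b\<in>A. F a = F b \<longrightarrow> prod_encode (G a, K a) = prod_encode (G b, K b)"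
      using G(2) K(3) by metis
    moreover have "\<forall>s\<in>insert r P'. prod_encode (G (fst s), K (fst s)) \<noteq> prod_encode (G (snd s), K (snd s))"
      using G(3) K(2) by simp
    ultimately show ?case
      by (intro exI[of _ "\<lambda>xs. prod_encode (G xs, K xs)"] conjI)
  qed
  then obtain G where G: "mem n G" "\<forall>a\<in>A. \<forall>b\<in>A. F a = F b \<longrightarrow> G a = G b" "\<forall>r\<in>P. G (fst r) \<noteq> G (snd r)"
    by auto
  have "F a = F b" if "a \<in> A" "b \<in> A" "G a = G b" for a b
    using G(3) that by (force simp: P_def)
  then show "\<exists>G. mem n G \<and> (\<forall>a\<in>A. \<forall>b\<in>A. G a = G b \<longleftrightarrow> F a = F b)"
    using G(1,2) by (intro exI[of _ G]) blast
qed

end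

context inj_clone
begin

text \<open>
  A pair agreeing exactly on \<open>I\<close> and generic to both a collapsed and an uncollapsed such pair is
  itself collapsed or not, so the two pairs can be taken generic to each other.
\<close>

lemma ex_generic_pairs:
  assumes F: "mem n F" "opr n F \<notin> clone_H"
  obtains a b c d I where "length a = n" "length b = n" "length c = n" "length d = n"
    "F a = F b" "F c \<noteq> F d"
    "\<And>k. k < n \<Longrightarrow> k \<in> I \<Longrightarrow> a ! k = b ! k \<and> c ! k = d ! k \<and> a ! k \<noteq> c ! k"
    "\<And>k. k < n \<Longrightarrow> k \<notin> I \<Longrightarrow> distinct [a ! k, b ! k, c ! k, d ! k]"
proof -
  define J where "J = {i. i < n \<and> depends n F i}"
  have J: "J \<subseteq> {..<n}" "J \<noteq> {}"
    using ex_depends[OF F(1)] by (auto simp: J_def)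
  have "\<not> agree_kernel n F J"
    using F(2) opr_in_clone_H by blast
  then obtain a b where ab: "length a = n" "length b = n" "(F a = F b) \<noteq> (\<forall>i\<in>J. a ! i = b ! i)"
    using J unfolding agree_kernel_def by blast
  moreover have "F a = F b" if "length a = n" "length b = n" "\<forall>i\<in>J. a ! i = b ! i" for a b
    by (rule eq_if_agree_on_depends[where n = n]) (use that in \<open>auto simp: J_def\<close>)
  ultimately have "F a = F b" "\<not> (\<forall>i\<in>J. a ! i = b ! i)"
    by metis+
  then obtain i where i: "i < n" "depends n F i" "a ! i \<noteq> b ! i"
    by (auto simp: J_def)
  note ab = ab(1,2) \<open>F a = F b\<close>
  define I where "I = {k. k < n \<and> a ! k = b ! k}"
  obtain c0 d0 where cd0: "length c0 = n" "length d0 = n" "\<forall>k<n. k \<noteq> i \<longrightarrow> c0 ! k = d0 ! k" "F c0 \<noteq> F d0"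
    using i(2) unfolding depends_def by blast
  obtain M where M: "\<And>e k. e \<in> {a, b, c0, d0} \<Longrightarrow> k < length e \<Longrightarrow> e ! k < M"
    using finite_lists_nth_bounded[of "{a, b, c0, d0}"] by blast
  have lt: "a ! k < M" "b ! k < M" "c0 ! k < M" "d0 ! k < M" if "k < n" for k
    using M that ab cd0 by auto
  define e where "e = map (\<lambda>k. if k \<in> I then c0 ! k else M) [0..<n]"
  have e: "length e = n"
    by (simp add: e_def)
  have "i \<notin> I"
    using i by (simp add: I_def)
  \<comment> \<open>\<open>c0\<close> and \<open>d0\<close> differ only at \<open>i\<close>, which
    is not in \<open>I\<close>, so both agree with \<open>e\<close> exactly on \<open>I\<close>. As
    \<open>F\<close> separates them, it separates at least one of them from
    \<open>e\<close>.\<close>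
  obtain c where c: "c \<in> {c0, d0}" "F c \<noteq> F e"
    using cd0(4) by (metis insertCI)
  have cM: "length c = n" "\<And>k. k < n \<Longrightarrow> c ! k < M" "\<And>k. k < n \<Longrightarrow> k \<in> I \<Longrightarrow> c ! k = c0 ! k"
    using c(1) cd0 lt \<open>i \<notin> I\<close> by auto
  \<comment> \<open>The entries start at \<open>M + 1\<close> because \<open>M\<close> already
    occurs in \<open>e\<close>. If \<open>F\<close> collapses this pair, it replaces
    \<open>a\<close>, \<open>b\<close>; otherwise it serves as the uncollapsed pair.\<close>
  define r where "r = map (\<lambda>k. M + 1) [0..<n]"
  define r' where "r' = map (\<lambda>k. if k \<in> I then M + 1 else M + 2) [0..<n]"
  have r: "length r = n" "length r' = n"
    by (simp_all add: r_def r'_def)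
  show thesis
  proof (cases "F r = F r'")
    case True
    show thesis
    proof (rule that[OF r cM(1) e True c(2), of I])
      show "r ! k = r' ! k \<and> c ! k = e ! k \<and> r ! k \<noteq> c ! k" if "k < n" "k \<in> I" for k
        using that cM(2)[of k] cM(3)[of k] by (simp add: r_def r'_def e_def)
      show "distinct [r ! k, r' ! k, c ! k, e ! k]" if "k < n" "k \<notin> I" for k
        using that cM(2)[of k] by (simp add: r_def r'_def e_def)
    qed
  next
    case False
    show thesis
    proof (rule that[OF ab(1,2) r ab(3) False, of I])
      show "a ! k = b ! k \<and> r ! k = r' ! k \<and> a ! k \<noteq> r ! k" if "k < n" "k \<in> I" for k
        using that lt[of k] by (simp add: r_def r'_def I_def)
      show "distinct [a ! k, b ! k, r ! k, r' ! k]" if "k < n" "k \<notin> I" for k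
        using that lt[of k] by (auto simp: r_def r'_def I_def)
    qed
  qed
qed

text \<open>Coordinates in \<open>I\<close> receive only the row number \<open>x\<close>, the others
  an injective image of \<open>x\<close> together with \<open>h x y\<close>. So
  \<open>(0, y)\<close>, \<open>(0, y')\<close>, \<open>(1, 0)\<close>, \<open>(1, 1)\<close> can be
  sent to \<open>a\<close>, \<open>b\<close>, \<open>c\<close>, \<open>d\<close>. The new row 0 is a
  function of the old one, so merging two of its values strictly lowers their number.\<close>

lemma ex_row_collapsing:
  assumes pair: "mem 2 pair_op" and F: "mem n F" "opr n F \<notin> clone_H"
  obtains h where "mem 2 (bin h)" "\<And>y y'. y < N \<Longrightarrow> y' < N \<Longrightarrow> h 0 y = h 0 y'" "h 1 0 \<noteq> h 1 1"
proof -
  obtain a b c d I where len: "length a = n" "length b = n" "length c = n" "length d = n"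
    and F_ab: "F a = F b" and F_cd: "F c \<noteq> F d"
    and I: "\<And>k. k < n \<Longrightarrow> k \<in> I \<Longrightarrow> a ! k = b ! k \<and> c ! k = d ! k \<and> a ! k \<noteq> c ! k"
    and nI: "\<And>k. k < n \<Longrightarrow> k \<notin> I \<Longrightarrow> distinct [a ! k, b ! k, c ! k, d ! k]"
    using ex_generic_pairs[OF F] by metis
  define Q where "Q h \<longleftrightarrow> mem 2 (bin h) \<and> h 1 0 \<noteq> h 1 1" for h
  have "mem 2 (bin (\<lambda>x y. y))"
    unfolding bin_def by (rule mem_proj) simp
  then have "Q (\<lambda>x y. y)"
    by (simp add: Q_def)
  then obtain h where h: "Q h" "\<And>h'. Q h' \<Longrightarrow> card (h 0 ` {..<N}) \<le> card (h' 0 ` {..<N})"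
    using ex_has_least_nat[of Q _ "\<lambda>h. card (h 0 ` {..<N})"] by blast
  have "h 0 y = h 0 y'" if y: "y < N" "y' < N" for y y'
  proof (rule ccontr)
    assume neq: "h 0 y \<noteq> h 0 y'"
    have "h 1 0 \<noteq> h 1 1" and h_mem: "mem 2 (bin h)"
      using h(1) by (auto simp: Q_def)
    have "\<exists>\<beta> :: nat \<Rightarrow> nat. k \<in> I \<longrightarrow> inj \<beta> \<and> \<beta> 0 = a ! k \<and> \<beta> 1 = c ! k" if "k < n" for k
      using inj_extension2[of 0 1 "a ! k" "c ! k"] I[OF that] by (metis zero_neq_one)
    then obtain \<beta> :: "nat \<Rightarrow> nat \<Rightarrow> nat"
      where \<beta>: "\<And>k. k < n \<Longrightarrow> k \<in> I \<Longrightarrow> inj (\<beta> k) \<and> \<beta> k 0 = a ! k \<and> \<beta> k 1 = c ! k"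
      by metis
    let ?e = "\<lambda>x y. prod_encode (x, h x y)"
    have "\<exists>\<gamma> :: nat \<Rightarrow> nat. inj \<gamma> \<and> \<gamma> (?e 0 y) = a ! k \<and> \<gamma> (?e 0 y') = b ! k \<and>
        \<gamma> (?e 1 0) = c ! k \<and> \<gamma> (?e 1 1) = d ! k" if "k < n" "k \<notin> I" for k
    proof -
      have "distinct [?e 0 y, ?e 0 y', ?e 1 0, ?e 1 1]"
        using neq \<open>h 1 0 \<noteq> h 1 1\<close> by simp
      from inj_extension4[OF this nI[OF that]] show ?thesis
        by metis
    qed
    then obtain \<gamma> :: "nat \<Rightarrow> nat \<Rightarrow> nat"
      where \<gamma>: "\<And>k. k < n \<Longrightarrow> k \<notin> I \<Longrightarrow> inj (\<gamma> k) \<and> \<gamma> k (?e 0 y) = a ! k \<and> \<gamma> k (?e 0 y') = b ! k \<and>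
        \<gamma> k (?e 1 0) = c ! k \<and> \<gamma> k (?e 1 1) = d ! k"
      by metis
    define u where "u x v = map (\<lambda>k. if k \<in> I then \<beta> k x else \<gamma> k (prod_encode (x, v))) [0..<n]" for x v
    define h' where "h' x y = F (u x (h x y))" for x y
    have e_mem: "mem 2 (\<lambda>xs. prod_encode (xs ! 0, bin h xs))"
      by (rule mem_bin[OF pair[unfolded pair_op_def]]) (use h_mem in \<open>auto intro: mem_proj\<close>)
    have "mem 2 (\<lambda>xs. F (map (\<lambda>k. (if k \<in> I then (\<lambda>xs. \<beta> k (xs ! 0))
        else (\<lambda>xs. \<gamma> k (prod_encode (xs ! 0, bin h xs)))) xs) [0..<n]))"
      by (rule mem_comp[OF F(1)]) (use \<beta> \<gamma> in \<open>auto intro: mem_inj_proj mem_inj[OF _ e_mem]\<close>)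
    then have "mem 2 (bin h')"
      by (rule mem_if_kernel) (simp add: bin_def h'_def u_def if_distrib[of "\<lambda>f. f _"] cong: if_cong)
    moreover have u: "u 0 (h 0 y) = a" "u 0 (h 0 y') = b" "u 1 (h 1 0) = c" "u 1 (h 1 1) = d"
      using \<beta> \<gamma> I len by (auto simp: u_def intro!: nth_equalityI)
    then have "h' 1 0 \<noteq> h' 1 1"
      unfolding h'_def using F_cd by simp
    ultimately have "Q h'"
      by (simp add: Q_def)
    have "h' 0 ` {..<N} = (\<lambda>v. F (u 0 v)) ` (h 0 ` {..<N})"
      by (auto simp: h'_def)
    moreover have "\<not> inj_on (\<lambda>v. F (u 0 v)) (h 0 ` {..<N})"
      using y neq u F_ab by (auto simp: inj_on_def)
    ultimately have "card (h' 0 ` {..<N}) < card (h 0 ` {..<N})"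
      using card_image_le[of "h 0 ` {..<N}" "\<lambda>v. F (u 0 v)"] eq_card_imp_inj_on[of "h 0 ` {..<N}"]
      by (metis finite_imageI finite_lessThan le_neq_implies_less)
    then show False
      using h(2)[OF \<open>Q h'\<close>] by simp
  qed
  then show thesis
    using that[of h] h(1) unfolding Q_def by blast
qed

text \<open>The first projection separates different rows, so only pairs inside a row other than 0
  need work. That row is renamed to 1 with row 0 fixed, and the two columns are renamed to 0 and 1
  without leaving the range on which \<open>h\<close> is constant in row 0.\<close>

lemma mem_bar_if_not_in_clone_H:
  assumes pair: "mem 2 pair_op" and F: "mem n F" "opr n F \<notin> clone_H"
  shows "mem 2 (bin (bar 1))"
proof (rule mem_if_separated[OF pair])
  show "mem 2 (\<lambda>xs. xs ! 0)"
    by (rule mem_proj) simp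
  show "a ! 0 = b ! 0" if "bin (bar 1) a = bin (bar 1) b" for a b
    using that by (simp add: bin_def bar_eq_iff)
next
  fix A p q
  assume A: "finite A" "A \<subseteq> tuples 2" "p \<in> A" "q \<in> A" "bin (bar 1) p \<noteq> bin (bar 1) q"
  show "\<exists>K. mem 2 K \<and> K p \<noteq> K q \<and> (\<forall>a\<in>A. \<forall>b\<in>A. bin (bar 1) a = bin (bar 1) b \<longrightarrow> K a = K b)"
  proof (cases "p ! 0 = q ! 0")
    case False
    then show ?thesis
      by (intro exI[of _ "\<lambda>xs. xs ! 0"]) (auto simp: bin_def bar_eq_iff mem_proj)
  next
    case True
    then have neq: "p ! 0 \<noteq> 0" "p ! 1 \<noteq> q ! 1"
      using A(5) by (auto simp: bin_def bar_eq_iff)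
    obtain M where M: "\<And>a k. a \<in> A \<Longrightarrow> k < length a \<Longrightarrow> a ! k < M"
      using finite_lists_nth_bounded[OF A(1)] by blast
    have lt: "a ! 1 < M" if "a \<in> A" for a
      using M[OF that] A(2) that by (auto simp: subset_iff)
    have "p ! 1 < M" "q ! 1 < M"
      using lt A by auto
    then have "2 \<le> M"
      using neq(2) by linarith
    then obtain \<beta> where \<beta>: "bij \<beta>" "\<And>v. v \<in> {p ! 1, q ! 1} \<Longrightarrow> \<beta> v = (if v = p ! 1 then 0 else 1)"
      "\<And>v. v \<in> {..<M} \<Longrightarrow> \<beta> v < M"
      using bij_extension_into[of "{..<M}" M "{p ! 1, q ! 1}" "\<lambda>v. if v = p ! 1 then 0 else 1"]
        \<open>p ! 1 < M\<close> \<open>q ! 1 < M\<close> neq(2) by auto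
    obtain \<alpha> :: "nat \<Rightarrow> nat" where \<alpha>: "inj \<alpha>" "\<alpha> 0 = 0" "\<alpha> (p ! 0) = 1"
      using inj_extension2[of 0 "p ! 0" 0 1] neq(1) by (metis zero_neq_one)
    obtain h where h: "mem 2 (bin h)" "\<And>y y'. y < M \<Longrightarrow> y' < M \<Longrightarrow> h 0 y = h 0 y'" "h 1 0 \<noteq> h 1 1"
      using ex_row_collapsing[OF pair F] by metis
    define K where "K xs = h (\<alpha> (xs ! 0)) (\<beta> (xs ! 1))" for xs
    have "mem 2 K"
      unfolding K_def by (rule mem_bin[OF h(1)]) (use \<alpha> \<beta> in \<open>auto intro: mem_inj_proj bij_is_inj\<close>)
    moreover have "K p \<noteq> K q"
      using \<alpha>(3) \<beta>(2) neq True h(3) by (auto simp: K_def)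
    moreover have "K a = K b" if "a \<in> A" "b \<in> A" "bin (bar 1) a = bin (bar 1) b" for a b
      using that \<alpha>(2) h(2) \<beta>(3) lt by (auto simp: K_def bin_def bar_eq_iff)
    ultimately show ?thesis
      by blast
  qed
qed simp

end

lemma bar_not_in_clone_H: "opr 2 (bin (bar 1)) \<notin> clone_H"
proof
  assume "opr 2 (bin (bar 1)) \<in> clone_H"
  then obtain J where J: "agree_kernel 2 (bin (bar 1)) J"
    using opr_in_clone_H by blast
  have "\<forall>i\<in>J. [0, 0] ! i = [0, 1 :: nat] ! i"
    using agree_kernelD[OF J, of "[0, 0]" "[0, 1]"] by (simp add: bar_eq_iff)
  then have "1 \<notin> J"
    by fastforce
  then have "\<forall>i\<in>J. i = 0"
    using agree_kernel_subset[OF J] by (auto simp: less_2_cases_iff)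
  then have "\<forall>i\<in>J. [1, 0] ! i = [1, 1 :: nat] ! i"
    by auto
  then show False
    using agree_kernelD[OF J, of "[1, 0]" "[1, 1]"] by (simp add: bar_eq_iff)
qed

lemma bar_in_if_not_subset_clone_H:
  assumes C: "C \<in> monoidal_interval injective_unary" "C \<noteq> generated injective_unary" and not_H: "\<not> C \<subseteq> clone_H"
  shows "opr 2 (bin (bar 1)) \<in> C"
proof -
  interpret inj_clone C
    by (rule monoidal_interval_inj_clone[OF C(1)])
  have "mem 2 pair_op"
    using clone_H_subset_if_nontrivial[OF C] pair_op_in_clone_H by blast
  obtain f where f: "f \<in> C" "f \<notin> clone_H"
    using not_H by blast
  then obtain n F where "f = opr n F"
    using local_clone_subset[OF local_clone] all_ops_cases by blast
  then show ?thesis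
    using mem_bar_if_not_in_clone_H[OF \<open>mem 2 pair_op\<close>] f by blast
qed

lemma bar_function_clone:
  assumes b: "bar_function b"
  shows "generated {b} \<in> monoidal_interval injective_unary" "clone_H \<subset> generated {b}"
    "\<And>C. C \<in> monoidal_interval injective_unary \<Longrightarrow> C \<noteq> generated injective_unary \<Longrightarrow> C \<noteq> clone_H \<Longrightarrow>
      generated {b} \<subseteq> C"
proof -
  obtain k where k: "k_bar_function k b"
    using b by (auto simp: bar_function_def)
  obtain g where g: "b = opr 2 (bin g)" "k \<ge> 1" "\<And>x y x' y'. g x y = g x' y' \<longleftrightarrow> bar k x y = bar k x' y'"
    using k_bar_function_kernel[OF k] by metis
  have "pres_neq 2 (bin g)"
    by (rule pres_neq_binI) (simp add: g(3) bar_eq_iff)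
  then have "b \<in> Pol {neq_rel}"
    using g(1) opr_in_Pol_neq by simp
  then show II: "generated {b} \<in> monoidal_interval injective_unary"
    by (intro generated_in_monoidal_interval) simp
  then interpret B: perm_clone "generated {b}"
    by unfold_locales (auto simp: monoidal_interval_iff)
  have "B.mem 2 (bin (bar 1))"
    using B.k_bar_function_mem_iff[OF k] subset_generated[of "{b}"] by blast
  then have "\<not> generated {b} \<subseteq> clone_H"
    using bar_not_in_clone_H by blast
  moreover from this have "generated {b} \<noteq> generated injective_unary"
    using generated_injective_unary_subset[OF clone_H_in_monoidal_interval] by blast
  ultimately show "clone_H \<subset> generated {b}"
    using clone_H_subset_if_nontrivial[OF II] by blast
  fix C
  assume C: "C \<in> monoidal_interval injective_unary" "C \<noteq> generated injective_unary" "C \<noteq> clone_H"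
  then have "opr 2 (bin (bar 1)) \<in> C"
    using bar_in_if_not_subset_clone_H clone_H_subset_if_nontrivial by blast
  moreover have C': "perm_clone C" "local_clone C" "permutations \<subseteq> C"
    using C(1) by (auto simp: monoidal_interval_iff perm_clone_def)
  ultimately have "b \<in> C"
    using perm_clone.k_bar_function_mem_iff[OF C'(1) k] by blast
  then show "generated {b} \<subseteq> C"
    using C' by (intro generated_minimal) auto
qed

lemma unique_cover_bar:
  assumes "bar_function b"
  shows "unique_cover (monoidal_interval injective_unary) (generated {b}) clone_H"
proof (rule unique_coverI[OF clone_H_in_monoidal_interval bar_function_clone(1,2)[OF assms]])
  fix E
  assume "E \<in> monoidal_interval injective_unary" "clone_H \<subset> E"
  then show "generated {b} \<subseteq> E"
    using bar_function_clone(3)[OF assms] generated_injective_unary_subset[OF clone_H_in_monoidal_interval]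
    by blast
qed

subsection \<open>Operations injective in one direction\<close>

lemma opr_in_clone_R:
  "opr n F \<in> clone_R \<longleftrightarrow> (\<exists>i<n. \<forall>a b. length a = n \<longrightarrow> length b = n \<longrightarrow> a ! i \<noteq> b ! i \<longrightarrow> F a \<noteq> F b)"
proof -
  have "injective_in_direction (opr n F) i \<longleftrightarrow>
      (\<forall>a b. length a = n \<longrightarrow> length b = n \<longrightarrow> a ! i \<noteq> b ! i \<longrightarrow> F a \<noteq> F b)" for i
    unfolding injective_in_direction_def by (simp add: Ball_def)
  then show ?thesis
    unfolding clone_R_def by auto
qed

lemma clone_R_subset: "clone_R \<subseteq> all_ops"
  by (auto simp: clone_R_def)

text \<open>A direction of the outer operation selects an inner one, whose direction serves for the
  composite. If every direction fails for \<open>F\<close>, one pair per direction witnesses this,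
  and these finitely many tuples exclude all approximations by members.\<close>

lemma local_clone_R: "local_clone clone_R"
proof (rule local_cloneI[OF clone_R_subset])
  show "opr n (\<lambda>xs. xs ! i) \<in> clone_R" if "i < n" for n i
    using that opr_in_clone_R by auto
next
  fix n m :: nat and F G
  assume F: "opr n F \<in> clone_R" and G: "\<And>j. j < n \<Longrightarrow> opr m (G j) \<in> clone_R"
  obtain i where i: "i < n" "\<And>a b. length a = n \<Longrightarrow> length b = n \<Longrightarrow> a ! i \<noteq> b ! i \<Longrightarrow> F a \<noteq> F b"
    using F opr_in_clone_R by auto
  obtain j where j: "j < m" "\<And>a b. length a = m \<Longrightarrow> length b = m \<Longrightarrow> a ! j \<noteq> b ! j \<Longrightarrow> G i a \<noteq> G i b"
    using G[OF i(1)] opr_in_clone_R by auto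
  have "F (map (\<lambda>j. G j a) [0..<n]) \<noteq> F (map (\<lambda>j. G j b) [0..<n])"
    if "length a = m" "length b = m" "a ! j \<noteq> b ! j" for a b
    using i(1) j(2)[OF that] by (intro i(2)) simp_all
  then show "opr m (\<lambda>xs. F (map (\<lambda>j. G j xs) [0..<n])) \<in> clone_R"
    unfolding opr_in_clone_R using j(1) by blast
next
  fix n :: nat and F
  assume *: "\<And>A. finite A \<Longrightarrow> A \<subseteq> tuples n \<Longrightarrow> \<exists>G. opr n G \<in> clone_R \<and> (\<forall>a\<in>A. G a = F a)"
  show "opr n F \<in> clone_R"
  proof (rule ccontr)
    assume "opr n F \<notin> clone_R"
    then have "\<exists>a b. length a = n \<and> length b = n \<and> a ! i \<noteq> b ! i \<and> F a = F b" if "i < n" for i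
      using that unfolding opr_in_clone_R by blast
    then obtain a b where ab: "\<And>i. i < n \<Longrightarrow> length (a i) = n \<and> length (b i) = n \<and> a i ! i \<noteq> b i ! i \<and> F (a i) = F (b i)"
      by metis
    have "finite (a ` {..<n} \<union> b ` {..<n})" "a ` {..<n} \<union> b ` {..<n} \<subseteq> tuples n"
      using ab by auto
    from *[OF this] obtain G where G: "opr n G \<in> clone_R" "\<forall>x\<in>a ` {..<n} \<union> b ` {..<n}. G x = F x"
      by (elim exE conjE)
    then obtain i where i: "i < n" "\<And>a b. length a = n \<Longrightarrow> length b = n \<Longrightarrow> a ! i \<noteq> b ! i \<Longrightarrow> G a \<noteq> G b"
      using opr_in_clone_R by auto
    moreover have "G (a i) = F (a i)" "G (b i) = F (b i)"
      using G(2) i(1) by auto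
    ultimately show False
      using ab[of i] by metis
  qed
qed

lemma permutations_subset_clone_R: "permutations \<subseteq> clone_R"
proof
  fix f assume "f \<in> permutations"
  then obtain g where g: "bij g" "f = opr 1 (\<lambda>xs. g (hd xs))"
    by (auto simp: permutations_def unary_eq_opr)
  have "opr 1 (\<lambda>xs. g (hd xs)) \<in> clone_R"
    unfolding opr_in_clone_R using bij_is_inj[OF g(1)] by (auto simp: length_Suc_conv inj_eq)
  then show "f \<in> clone_R"
    by (simp add: g(2))
qed

lemma clone_R_subset_Pol_neq: "clone_R \<subseteq> Pol {neq_rel}"
proof
  fix f assume f: "f \<in> clone_R"
  then obtain n F where nF: "f = opr n F" "n \<ge> 1"
    using clone_R_subset all_ops_cases by blast
  then have "pres_neq n F"
    using f unfolding pres_neq_def by (auto simp: opr_in_clone_R)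
  then show "f \<in> Pol {neq_rel}"
    using nF opr_in_Pol_neq by simp
qed

lemma clone_R_in_monoidal_interval: "clone_R \<in> monoidal_interval injective_unary"
  by (rule monoidal_intervalI[OF local_clone_R permutations_subset_clone_R clone_R_subset_Pol_neq])

section \<open>Violations of "all equal or all distinct"\<close>

definition eq_or_distinct :: "nat \<Rightarrow> nat \<Rightarrow> nat \<Rightarrow> bool" where
  "eq_or_distinct x y z \<longleftrightarrow> (x = y \<and> y = z) \<or> (x \<noteq> y \<and> x \<noteq> z \<and> y \<noteq> z)"

lemma eq_or_distinct_swap: "eq_or_distinct x y z \<Longrightarrow> eq_or_distinct x z y"
  and eq_or_distinct_rotate: "eq_or_distinct x y z \<Longrightarrow> eq_or_distinct y z x"
  by (auto simp: eq_or_distinct_def)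

definition eod_rel :: rel where
  "eod_rel = (3, {[x, y, z] |x y z. eq_or_distinct x y z})"

lemma eod_rel_in_all_rels: "eod_rel \<in> all_rels"
  by (auto simp: eod_rel_def all_rels_def)

definition pres_eod :: "nat \<Rightarrow> (nat list \<Rightarrow> nat) \<Rightarrow> bool" where
  "pres_eod n F \<longleftrightarrow> (\<forall>a b c. length a = n \<longrightarrow> length b = n \<longrightarrow> length c = n \<longrightarrow>
    (\<forall>k<n. eq_or_distinct (a ! k) (b ! k) (c ! k)) \<longrightarrow> eq_or_distinct (F a) (F b) (F c))"

lemma map_3: "map f [0..<3] = [f 0, f 1, f 2]"
  by (simp add: numeral_3_eq_3 numeral_2_eq_2)

lemma opr_in_Pol_eod: "opr n F \<in> Pol {eod_rel} \<longleftrightarrow> n \<ge> 1 \<and> pres_eod n F"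
proof -
  have "preserves (opr n F) eod_rel \<longleftrightarrow> pres_eod n F"
  proof
    assume *: "preserves (opr n F) eod_rel"
    show "pres_eod n F"
      unfolding pres_eod_def
    proof (intro allI impI)
      fix a b c :: "nat list"
      assume abc: "length a = n" "length b = n" "length c = n" "\<forall>k<n. eq_or_distinct (a ! k) (b ! k) (c ! k)"
      define ts where "ts = map (\<lambda>k. [a ! k, b ! k, c ! k]) [0..<n]"
      have "length ts = n" "set ts \<subseteq> {[x, y, z] |x y z. eq_or_distinct x y z}"
        using abc(4) by (auto simp: ts_def)
      then have "map (\<lambda>j. F (map (\<lambda>t. t ! j) ts)) [0..<3] \<in> {[x, y, z] |x y z. eq_or_distinct x y z}"
        using *[unfolded eod_rel_def preserves_opr] by blast
      moreover have "map (\<lambda>t. t ! 0) ts = a" "map (\<lambda>t. t ! 1) ts = b" "map (\<lambda>t. t ! 2) ts = c"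
        using abc by (auto simp: ts_def intro: nth_equalityI)
      ultimately show "eq_or_distinct (F a) (F b) (F c)"
        by (simp add: map_3)
    qed
  next
    assume *: "pres_eod n F"
    show "preserves (opr n F) eod_rel"
      unfolding eod_rel_def preserves_opr
    proof (intro allI impI)
      fix ts :: "nat list list"
      assume ts: "length ts = n" "set ts \<subseteq> {[x, y, z] |x y z. eq_or_distinct x y z}"
      have "eq_or_distinct (ts ! k ! 0) (ts ! k ! 1) (ts ! k ! 2)" if "k < n" for k
        using ts nth_mem[of k ts] that by fastforce
      then have "eq_or_distinct (F (map (\<lambda>t. t ! 0) ts)) (F (map (\<lambda>t. t ! 1) ts)) (F (map (\<lambda>t. t ! 2) ts))"
        using *[unfolded pres_eod_def, rule_format, of "map (\<lambda>t. t ! 0) ts" "map (\<lambda>t. t ! 1) ts" "map (\<lambda>t. t ! 2) ts"] ts(1)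
        by simp
      then show "map (\<lambda>j. F (map (\<lambda>t. t ! j) ts)) [0..<3] \<in> {[x, y, z] |x y z. eq_or_distinct x y z}"
        by (simp add: map_3)
    qed
  qed
  then show ?thesis
    by (auto simp: Pol_def)
qed

text \<open>If two of the three images coincide, the corresponding tuples agree on \<open>J\<close>,
  and in each of these coordinates the third tuple then agrees as well.\<close>

lemma clone_H_subset_Pol_eod: "clone_H \<subseteq> Pol {eod_rel}"
proof
  fix f assume f: "f \<in> clone_H"
  obtain n F where nF: "f = opr n F" "n \<ge> 1"
    using f clone_H_subset all_ops_cases by blast
  then obtain J where J: "agree_kernel n F J"
    using f opr_in_clone_H by blast
  have "eq_or_distinct (F a) (F b) (F c)"
    if abc: "length a = n" "length b = n" "length c = n" "\<forall>k<n. eq_or_distinct (a ! k) (b ! k) (c ! k)" for a b c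
  proof -
    have "\<forall>k\<in>J. eq_or_distinct (a ! k) (b ! k) (c ! k)"
      using abc(4) agree_kernel_subset[OF J] by auto
    then show ?thesis
      unfolding eq_or_distinct_def agree_kernelD[OF J abc(1,2)] agree_kernelD[OF J abc(2,3)]
        agree_kernelD[OF J abc(1,3)] by metis
  qed
  then have "pres_eod n F"
    by (simp add: pres_eod_def)
  then show "f \<in> Pol {eod_rel}"
    using nF opr_in_Pol_eod by simp
qed

text \<open>The smallest failure of injectivity in the second variable: only \<open>(0, 0)\<close>
  and \<open>(0, 1)\<close> are identified. Iterated, it produces all kernels of
  \<open>clone_R\<close>.\<close>

definition merge01 :: "nat \<Rightarrow> nat \<Rightarrow> nat" where
  "merge01 x y = prod_encode (x, if x = 0 \<and> y = 1 then 0 else y)"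

lemma merge01_eq_iff:
  "merge01 x y = merge01 x' y' \<longleftrightarrow> x = x' \<and> (y = y' \<or> x = 0 \<and> y \<le> 1 \<and> y' \<le> 1)"
  by (auto simp: merge01_def)

context inj_clone
begin

text \<open>Coordinates in \<open>I\<close> receive the first variable, the others the second; so
  row 0 of a binary operation can run through four points that agree on \<open>I\<close> and are
  pairwise different elsewhere.\<close>

lemma ex_mem_through_four_points:
  assumes F: "mem n F" and len: "length w0 = n" "length w1 = n" "length w2 = n" "length w3 = n"
    and I: "\<And>k. k < n \<Longrightarrow> k \<in> I \<Longrightarrow> w0 ! k = w1 ! k \<and> w0 ! k = w2 ! k \<and> w0 ! k = w3 ! k"
    and nI: "\<And>k. k < n \<Longrightarrow> k \<notin> I \<Longrightarrow> distinct [w0 ! k, w1 ! k, w2 ! k, w3 ! k]"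
    and s: "distinct [s0, s1, s2, s3]"
  obtains K where "mem 2 (bin K)" "K 0 s0 = F w0" "K 0 s1 = F w1" "K 0 s2 = F w2" "K 0 s3 = F w3"
proof -
  have "\<exists>\<tau> :: nat \<Rightarrow> nat. inj \<tau> \<and> \<tau> 0 = w0 ! k" for k
    using inj_extension2[of 0 1 "w0 ! k" "Suc (w0 ! k)"] by (metis n_not_Suc_n zero_neq_one)
  then obtain \<tau> :: "nat \<Rightarrow> nat \<Rightarrow> nat" where \<tau>: "\<And>k. inj (\<tau> k) \<and> \<tau> k 0 = w0 ! k"
    by metis
  have "\<exists>\<gamma> :: nat \<Rightarrow> nat. inj \<gamma> \<and> \<gamma> s0 = w0 ! k \<and> \<gamma> s1 = w1 ! k \<and> \<gamma> s2 = w2 ! k \<and> \<gamma> s3 = w3 ! k"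
    if "k < n" "k \<notin> I" for k
    using inj_extension4[OF s nI[OF that]] by metis
  then obtain \<gamma> :: "nat \<Rightarrow> nat \<Rightarrow> nat" where \<gamma>: "\<And>k. k < n \<Longrightarrow> k \<notin> I \<Longrightarrow>
      inj (\<gamma> k) \<and> \<gamma> k s0 = w0 ! k \<and> \<gamma> k s1 = w1 ! k \<and> \<gamma> k s2 = w2 ! k \<and> \<gamma> k s3 = w3 ! k"
    by metis
  define W where "W x y = map (\<lambda>k. if k \<in> I then \<tau> k x else \<gamma> k y) [0..<n]" for x y
  have "mem 2 (\<lambda>xs. F (map (\<lambda>k. (if k \<in> I then (\<lambda>xs. \<tau> k (xs ! 0)) else (\<lambda>xs. \<gamma> k (xs ! 1))) xs) [0..<n]))"
    by (rule mem_comp[OF F]) (use \<tau> \<gamma> in \<open>auto intro: mem_inj_proj\<close>)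
  then have "mem 2 (bin (\<lambda>x y. F (W x y)))"
    by (rule mem_if_kernel) (simp add: bin_def W_def if_distrib[of "\<lambda>f. f _"] cong: if_cong)
  moreover have "w1 ! k = w0 ! k" "w2 ! k = w0 ! k" "w3 ! k = w0 ! k" if "k < n" "k \<in> I" for k
    using I[OF that] by simp_all
  then have "W 0 s0 = w0" "W 0 s1 = w1" "W 0 s2 = w2" "W 0 s3 = w3"
    using \<tau> \<gamma> len by (auto simp: W_def intro!: nth_equalityI)
  ultimately show thesis
    using that[of "\<lambda>x y. F (W x y)"] by simp
qed

text \<open>If \<open>d\<close> or \<open>e\<close> is at most 1, then \<open>a\<close> and
  \<open>b\<close> go to positions 0 and 1 and \<open>c\<close> goes to the other one. If both
  exceed 1, the generic points \<open>g j\<close> decide: one with a value other than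
  \<open>F c\<close> can be placed beside \<open>c\<close>; if there is none, \<open>g 0\<close> and
  \<open>g 1\<close> are the merged pair, and \<open>a\<close> and \<open>g 2\<close> the separated
  one.\<close>

lemma ex_merging_separating:
  assumes F: "mem n F" and len: "length a = n" "length b = n" "length c = n"
    and abc: "\<And>k. k < n \<Longrightarrow> eq_or_distinct (a ! k) (b ! k) (c ! k)"
    and F_ab: "F a = F b" and F_ac: "F a \<noteq> F c"
    and de: "d \<noteq> e" "\<not> (d \<le> 1 \<and> e \<le> 1)"
  obtains K where "mem 2 (bin K)" "K 0 0 = K 0 1" "K 0 d \<noteq> K 0 e"
proof -
  define I where "I = {k. k < n \<and> a ! k = b ! k}"
  obtain M where M: "\<And>w k. w \<in> {a, b, c} \<Longrightarrow> k < length w \<Longrightarrow> w ! k < M"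
    using finite_lists_nth_bounded[of "{a, b, c}"] by blast
  have lt: "a ! k < M" "b ! k < M" "c ! k < M" if "k < n" for k
    using M that len by auto
  define g where "g j = map (\<lambda>k. if k \<in> I then a ! k else M + j) [0..<n]" for j
  have g: "length (g j) = n" for j
    by (simp add: g_def)
  have I: "a ! k = b ! k \<and> a ! k = c ! k \<and> a ! k = g j ! k" if "k < n" "k \<in> I" for k j
    using abc[of k] that by (auto simp: I_def g_def eq_or_distinct_def)
  have nI: "distinct [a ! k, b ! k, c ! k, g j ! k]" if "k < n" "k \<notin> I" for k j
    using abc[of k] that lt[of k] by (auto simp: I_def g_def eq_or_distinct_def)
  have I': "g 0 ! k = g 1 ! k \<and> g 0 ! k = a ! k \<and> g 0 ! k = g 2 ! k" if "k < n" "k \<in> I" for k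
    using that by (simp add: g_def)
  have nI': "distinct [g 0 ! k, g 1 ! k, a ! k, g 2 ! k]" if "k < n" "k \<notin> I" for k
    using that lt[of k] by (simp add: g_def)
  note result = that
  have one_low: thesis if de': "d' \<le> 1" "e' > 1" and K: "\<And>K :: nat \<Rightarrow> nat \<Rightarrow> nat. K 0 d' \<noteq> K 0 e' \<Longrightarrow> K 0 d \<noteq> K 0 e"
    for d' e'
  proof -
    \<comment> \<open>\<open>Suc e'\<close> is a free position that holds the fourth point
      \<open>g 0\<close>.\<close>
    have "distinct [0, 1, e', Suc e']"
      using de' by auto
    from ex_mem_through_four_points[OF F len g[of 0] I nI this]
    obtain K where K': "mem 2 (bin K)" "K 0 0 = F a" "K 0 1 = F b" "K 0 e' = F c"
      by blast
    have "d' = 0 \<or> d' = 1"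
      using de' by auto
    then have "K 0 d' = F a"
      using K' F_ab by auto
    then have "K 0 d \<noteq> K 0 e"
      using K' F_ac by (intro K) simp
    then show thesis
      using result[of K] K' F_ab by simp
  qed
  show thesis
  proof (cases "d \<le> 1 \<or> e \<le> 1")
    case True
    then show thesis
      using one_low[of d e] one_low[of e d] de by (metis not_le)
  next
    case False
    then have dist: "distinct [0, 1, d, e]"
      using de(1) by auto
    show thesis
    proof (cases "\<exists>j. F (g j) \<noteq> F c")
      case True
      then obtain j where j: "F (g j) \<noteq> F c"
        by blast
      from ex_mem_through_four_points[OF F len g[of j] I nI dist]
      obtain K where "mem 2 (bin K)" "K 0 0 = F a" "K 0 1 = F b" "K 0 d = F c" "K 0 e = F (g j)"
        by blast
      then show thesis
        using result[of K] F_ab j by simp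
    next
      case False
      from ex_mem_through_four_points[OF F g[of 0] g[of 1] len(1) g[of 2] I' nI' dist]
      obtain K where "mem 2 (bin K)" "K 0 0 = F (g 0)" "K 0 1 = F (g 1)" "K 0 d = F a" "K 0 e = F (g 2)"
        by blast
      then show thesis
        using result[of K] False F_ac by simp
    qed
  qed
qed

text \<open>Three kinds of separators suffice: the first projection for different rows,
  \<open>bar 1\<close> inside a row other than 0, and the operations from
  \<open>ex_merging_separating\<close> inside row 0.\<close>

lemma mem_merge01:
  assumes pair: "mem 2 pair_op" and bar: "mem 2 (bin (bar 1))"
    and F: "mem n F" "\<not> pres_eod n F"
  shows "mem 2 (bin merge01)"
proof -
  obtain a b c where abc: "length a = n" "length b = n" "length c = n"
      "\<And>k. k < n \<Longrightarrow> eq_or_distinct (a ! k) (b ! k) (c ! k)" "F a = F b" "F a \<noteq> F c"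
  proof -
    obtain a b c where abc: "length a = n" "length b = n" "length c = n"
      "\<And>k. k < n \<Longrightarrow> eq_or_distinct (a ! k) (b ! k) (c ! k)" "\<not> eq_or_distinct (F a) (F b) (F c)"
      using F(2) unfolding pres_eod_def by blast
    then consider "F a = F b" "F a \<noteq> F c" | "F a = F c" "F a \<noteq> F b" | "F b = F c" "F b \<noteq> F a"
      unfolding eq_or_distinct_def by metis
    then show thesis
    proof cases
      case 1
      show thesis
        by (rule that[OF abc(1-4) 1])
    next
      case 2
      have acb: "eq_or_distinct (a ! k) (c ! k) (b ! k)" if "k < n" for k
        by (rule eq_or_distinct_swap[OF abc(4)[OF that]])
      show thesis
        by (rule that[OF abc(1,3,2) acb 2])
    next
      case 3
      have bca: "eq_or_distinct (b ! k) (c ! k) (a ! k)" if "k < n" for k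
        by (rule eq_or_distinct_rotate[OF abc(4)[OF that]])
      show thesis
        by (rule that[OF abc(2,3,1) bca 3])
    qed
  qed
  show ?thesis
  proof (rule mem_if_separated[OF pair])
    show "mem 2 (\<lambda>xs. xs ! 0)"
      by (rule mem_proj) simp
    show "x ! 0 = y ! 0" if "bin merge01 x = bin merge01 y" for x y
      using that by (simp add: bin_def merge01_eq_iff)
  next
    fix A p q
    assume pq: "bin merge01 p \<noteq> bin merge01 q"
    show "\<exists>K. mem 2 K \<and> K p \<noteq> K q \<and> (\<forall>a\<in>A. \<forall>b\<in>A. bin merge01 a = bin merge01 b \<longrightarrow> K a = K b)"
    proof (cases "p ! 0 = q ! 0")
      case False
      then show ?thesis
        by (intro exI[of _ "\<lambda>xs. xs ! 0"]) (auto simp: bin_def merge01_eq_iff mem_proj)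
    next
      case eq0: True
      show ?thesis
      proof (cases "p ! 0 = 0")
        case False
        then show ?thesis
          using eq0 pq bar by (intro exI[of _ "bin (bar 1)"]) (auto simp: bin_def merge01_eq_iff bar_eq_iff)
      next
        case True
        have "p ! 1 \<noteq> q ! 1" "\<not> (p ! 1 \<le> 1 \<and> q ! 1 \<le> 1)"
          using True eq0 pq by (auto simp: bin_def merge01_eq_iff)
        from ex_merging_separating[OF F(1) abc this]
        obtain K where K: "mem 2 (bin K)" "K 0 0 = K 0 1" "K 0 (p ! 1) \<noteq> K 0 (q ! 1)"
          by blast
        have K01: "K 0 y = K 0 y'" if "y \<le> 1" "y' \<le> 1" for y y'
          using that K(2) by (auto simp: le_Suc_eq)
        show ?thesis
        proof (intro exI[of _ "bin K"] conjI ballI impI)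
          show "bin K p \<noteq> bin K q"
            using K(3) True eq0 by (simp add: bin_def)
          show "bin K x = bin K y" if "bin merge01 x = bin merge01 y" for x y
            using that K01 unfolding bin_def merge01_eq_iff by metis
        qed (rule K(1))
      qed
    qed
  qed simp
qed

text \<open>Starting from an injective operation, two classes of \<open>G\<close> are merged at a
  time until the kernel of \<open>F\<close> on \<open>A\<close> is reached. \<open>merge01\<close>
  acts in one row only, but coordinate \<open>i\<close> serves as the row, and points collapsed by
  \<open>F\<close> share it. So the two classes lie in one row and are merged completely.\<close>

lemma clone_R_subset_if_merge01:
  assumes pair: "mem 2 pair_op" and merge: "mem 2 (bin merge01)"
  shows "clone_R \<subseteq> C"
proof
  fix f assume f: "f \<in> clone_R"
  then obtain n F where nF: "f = opr n F" "n \<ge> 1"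
    using clone_R_subset all_ops_cases by blast
  then obtain i where i: "i < n" "\<And>a b. length a = n \<Longrightarrow> length b = n \<Longrightarrow> a ! i \<noteq> b ! i \<Longrightarrow> F a \<noteq> F b"
    using f opr_in_clone_R by auto
  have "mem n F"
  proof (rule mem_if_kernels[OF nF(2)])
    fix A :: "nat list set"
    assume A: "finite A" "A \<subseteq> tuples n"
    have Fi: "a ! i = b ! i" if "a \<in> A" "b \<in> A" "F a = F b" for a b
      using i(2) that A(2) by (metis mem_tuples subsetD)
    define Q where "Q G \<longleftrightarrow> mem n G \<and> (\<forall>a\<in>A. \<forall>b\<in>A. G a = G b \<longrightarrow> F a = F b)" for G
    define bad where "bad G = {(a, b) \<in> A \<times> A. F a = F b \<and> G a \<noteq> G b}" for G :: "nat list \<Rightarrow> nat"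
    have fin: "finite (bad G)" for G
      using A(1) by (auto simp: bad_def intro: finite_subset[of _ "A \<times> A"])
    have "mem n list_encode"
      by (rule mem_agree_kernel[OF pair agree_kernel_list_encode[OF nF(2)]])
    then have "Q list_encode"
      by (simp add: Q_def list_encode_eq)
    then obtain G where G: "Q G" "\<And>G'. Q G' \<Longrightarrow> card (bad G) \<le> card (bad G')"
      using ex_has_least_nat[of Q _ "\<lambda>G. card (bad G)"] by blast
    have GF: "F a = F b" if "a \<in> A" "b \<in> A" "G a = G b" for a b
      using G(1) that unfolding Q_def by blast
    have "bad G = {}"
    proof (rule ccontr)
      assume "bad G \<noteq> {}"
      then obtain z z' where z: "z \<in> A" "z' \<in> A" "F z = F z'" "G z \<noteq> G z'"
        by (auto simp: bad_def)
      obtain \<alpha> :: "nat \<Rightarrow> nat" where \<alpha>: "inj \<alpha>" "\<alpha> (z ! i) = 0"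
        using inj_extension2[of "z ! i" "Suc (z ! i)" 0 1] by (metis n_not_Suc_n zero_neq_one)
      obtain \<beta> :: "nat \<Rightarrow> nat" where \<beta>: "inj \<beta>" "\<beta> (G z) = 0" "\<beta> (G z') = 1"
        using inj_extension2[OF z(4), of 0 1] by (metis zero_neq_one)
      define G' where "G' w = merge01 (\<alpha> (w ! i)) (\<beta> (G w))" for w
      have "mem n G'"
        unfolding G'_def
        by (rule mem_bin[OF merge]) (use \<alpha> \<beta> G(1) i(1) in \<open>auto intro: mem_inj_proj mem_inj simp: Q_def\<close>)
      have low: "G w = G z \<or> G w = G z'" if "\<beta> (G w) \<le> 1" for w
        using that \<beta> by (metis One_nat_def le_Suc_eq le_zero_eq inj_eq)
      have "F a = F b" if ab: "a \<in> A" "b \<in> A" "G' a = G' b" for a b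
      proof (cases "G a = G b")
        case True
        then show ?thesis
          using GF ab by blast
      next
        case False
        then have "\<beta> (G a) \<le> 1" "\<beta> (G b) \<le> 1"
          using ab(3) \<beta>(1) by (auto simp: G'_def merge01_eq_iff inj_eq)
        then show ?thesis
          using low GF[OF ab(1)] GF[OF ab(2)] z by metis
      qed
      then have "Q G'"
        using \<open>mem n G'\<close> unfolding Q_def by blast
      have "bad G' \<subseteq> bad G"
      proof (rule subrelI)
        fix a b
        assume "(a, b) \<in> bad G'"
        then have ab: "a \<in> A" "b \<in> A" "F a = F b" "G' a \<noteq> G' b"
          unfolding bad_def by auto
        have "G a \<noteq> G b"
          using ab(4) Fi[OF ab(1-3)] by (metis G'_def)
        then show "(a, b) \<in> bad G"
          using ab unfolding bad_def by simp
      qed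
      moreover have "(z, z') \<in> bad G" "(z, z') \<notin> bad G'"
        using z(1,2,4) z(3) \<alpha>(2) \<beta>(2,3) Fi[OF z(1-3)] unfolding bad_def
        by (simp_all add: G'_def merge01_eq_iff)
      ultimately have "bad G' \<subset> bad G"
        by blast
      then have "card (bad G') < card (bad G)"
        by (rule psubset_card_mono[OF fin])
      then show False
        using G(2)[OF \<open>Q G'\<close>] by simp
    qed
    then have "G a = G b \<longleftrightarrow> F a = F b" if "a \<in> A" "b \<in> A" for a b
      using that GF unfolding bad_def by blast
    then show "\<exists>G. mem n G \<and> (\<forall>a\<in>A. \<forall>b\<in>A. G a = G b \<longleftrightarrow> F a = F b)"
      using G(1) unfolding Q_def by blast
  qed
  then show "f \<in> C"
    by (simp add: nF)
qed

end

lemma clone_R_subset_if_not_eod: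
  assumes C: "C \<in> monoidal_interval injective_unary" and not_eod: "\<not> C \<subseteq> Pol {eod_rel}"
  shows "clone_R \<subseteq> C"
proof -
  interpret inj_clone C
    by (rule monoidal_interval_inj_clone[OF C])
  obtain f where f: "f \<in> C" "f \<notin> Pol {eod_rel}"
    using not_eod by blast
  then obtain n F where nF: "f = opr n F" "n \<ge> 1"
    using local_clone_subset[OF local_clone] all_ops_cases by blast
  have F: "mem n F" "\<not> pres_eod n F"
    using f nF opr_in_Pol_eod by auto
  have "\<not> C \<subseteq> clone_H"
    using not_eod clone_H_subset_Pol_eod by blast
  moreover from this have "C \<noteq> generated injective_unary"
    using generated_injective_unary_subset[OF clone_H_in_monoidal_interval] by blast
  ultimately have "mem 2 (bin (bar 1))" "mem 2 pair_op"
    using bar_in_if_not_subset_clone_H[OF C] clone_H_subset_if_nontrivial[OF C] pair_op_in_clone_H by blast+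
  then show ?thesis
    using clone_R_subset_if_merge01 mem_merge01 F by blast
qed

subsection \<open>Operations whose kernel classes are subcubes\<close>

lemma length_3_iff: "length xs = 3 \<longleftrightarrow> (\<exists>x y z. xs = [x, y, z])"
  by (auto simp: numeral_3_eq_3 length_Suc_conv)

text \<open>The three lines on which \<open>f\<^sub>3\<close> is constant, indexed by the value
  taken there.\<close>

definition f3_line :: "nat \<Rightarrow> nat list \<Rightarrow> bool" where
  "f3_line i a \<longleftrightarrow> (i = 1 \<and> a ! 1 = 1 \<and> a ! 2 = 1) \<or> (i = 2 \<and> a ! 0 = 2 \<and> a ! 2 = 2) \<or>
    (i = 3 \<and> a ! 0 = 3 \<and> a ! 1 = 3)"

lemma is_f3_values:
  assumes "is_f3 f"
  shows "snd f [x, 1, 1] = 1" "snd f [2, x, 2] = 2" "snd f [3, 3, x] = 3"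
  using assms unfolding is_f3_def by blast+

lemma is_f3_eqD:
  assumes f: "is_f3 f" and ab: "length a = 3" "length b = 3" "snd f a = snd f b"
  shows "a = b \<or> (\<exists>i. f3_line i a \<and> f3_line i b)"
proof -
  have line: "\<exists>i. f3_line i c \<and> snd f c = i" if "c \<in> (\<Union>x. {[x, 1, 1], [2, x, 2], [3, 3, x]})" for c
    using that is_f3_values[OF f] by (auto simp: f3_line_def)
  have sep: "snd f c \<noteq> snd f d"
    if "length c = 3" "length d = 3" "c \<noteq> d" "c \<notin> (\<Union>x. {[x, 1, 1], [2, x, 2], [3, 3, x]})" for c d
  proof -
    have "\<forall>a \<in> tuples 3 - (\<Union>x. {[x, 1, 1], [2, x, 2], [3, 3, x]}).
        \<forall>b \<in> tuples 3. b \<noteq> a \<longrightarrow> snd f a \<noteq> snd f b"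
      using f unfolding is_f3_def by (elim conjE)
    from this[rule_format, of c d] show ?thesis
      using that by simp
  qed
  show ?thesis
  proof (cases "a = b")
    case False
    then have "\<exists>i. f3_line i a \<and> snd f a = i" "\<exists>i. f3_line i b \<and> snd f b = i"
      using sep[OF ab(1,2)] sep[OF ab(2,1)] ab(3) line[of a] line[of b] by auto
    then show ?thesis
      using ab(3) by metis
  qed simp
qed

lemma is_f3_opr: "is_f3 f \<Longrightarrow> f = opr 3 (snd f)"
  unfolding is_f3_def using ops_eq_opr by blast

lemma f3_line_agree:
  assumes "f3_line i a" "f3_line i b"
  shows "\<exists>k<3. a ! k = b ! k"
proof -
  have "a ! 1 = b ! 1 \<or> a ! 2 = b ! 2"
    using assms unfolding f3_line_def by (elim disjE conjE) simp_all
  then show ?thesis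
    by (elim disjE) (rule exI[of _ 1], simp, rule exI[of _ 2], simp)
qed

lemma is_f3_in_Pol_neq:
  assumes f: "is_f3 f"
  shows "f \<in> Pol {neq_rel}"
proof -
  have "pres_neq 3 (snd f)"
    unfolding pres_neq_def
  proof (intro allI impI notI)
    fix a b :: "nat list"
    assume ab: "length a = 3" "length b = 3" "\<forall>k<3. a ! k \<noteq> b ! k" "snd f a = snd f b"
    have "a ! 0 \<noteq> b ! 0"
      using ab(3) by simp
    then have "a \<noteq> b"
      by auto
    then obtain i where "f3_line i a" "f3_line i b"
      using is_f3_eqD[OF f ab(1,2,4)] by blast
    from f3_line_agree[OF this] show False
      using ab(3) by blast
  qed
  then show ?thesis
    by (subst is_f3_opr[OF f]) (simp add: opr_in_Pol_neq)
qed

text \<open>A line prescribes two coordinates; wherever two points of the triple agree, the third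
  agrees with them.\<close>

lemma f3_line_eod:
  assumes "f3_line i a" "f3_line i b" "\<forall>k<3. eq_or_distinct (a ! k) (b ! k) (c ! k)"
  shows "f3_line i c"
proof -
  have "a ! k = b ! k \<longrightarrow> c ! k = a ! k" if "k < 3" for k
    using assms(3) that unfolding eq_or_distinct_def by metis
  from this[of 0] this[of 1] this[of 2] show ?thesis
    using assms(1,2) unfolding f3_line_def by (elim disjE conjE) simp_all
qed

lemma f3_line_value:
  assumes "is_f3 f" "length a = 3" "f3_line i a"
  shows "snd f a = i"
  using assms(2,3) is_f3_values[OF assms(1)] by (auto simp: f3_line_def length_3_iff)

lemma is_f3_in_Pol_eod:
  assumes f: "is_f3 f"
  shows "f \<in> Pol {eod_rel}"
proof -
  have two: "snd f c = snd f a"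
    if abc: "length a = 3" "length b = 3" "length c = 3" "\<forall>k<3. eq_or_distinct (a ! k) (b ! k) (c ! k)"
      and "snd f a = snd f b" for a b c
  proof (cases "a = b")
    case True
    then have "\<forall>k<3. a ! k = c ! k"
      using abc(4) by (auto simp: eq_or_distinct_def)
    then show ?thesis
      using abc(1,3) nth_equalityI[of a c] by simp
  next
    case False
    then obtain i where i: "f3_line i a" "f3_line i b"
      using is_f3_eqD[OF f abc(1,2)] \<open>snd f a = snd f b\<close> by blast
    then have "f3_line i c"
      using f3_line_eod abc(4) by blast
    then show ?thesis
      using f3_line_value[OF f] i(1) abc(1,3) by metis
  qed
  have "pres_eod 3 (snd f)"
    unfolding pres_eod_def
  proof (intro allI impI)
    fix a b c :: "nat list"
    assume abc: "length a = 3" "length b = 3" "length c = 3"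
      "\<forall>k<3. eq_or_distinct (a ! k) (b ! k) (c ! k)"
    have "\<forall>k<3. eq_or_distinct (a ! k) (c ! k) (b ! k)" "\<forall>k<3. eq_or_distinct (b ! k) (c ! k) (a ! k)"
      using abc(4) eq_or_distinct_swap eq_or_distinct_rotate by blast+
    then show "eq_or_distinct (snd f a) (snd f b) (snd f c)"
      using two[OF abc] two[OF abc(1,3,2)] two[OF abc(2,3,1)] unfolding eq_or_distinct_def by metis
  qed
  then show ?thesis
    by (subst is_f3_opr[OF f]) (simp add: opr_in_Pol_eod)
qed

text \<open>Each of the three lines leaves a different coordinate free, so no coordinate can belong
  to \<open>J\<close>.\<close>

lemma is_f3_not_in_clone_H:
  assumes f: "is_f3 f"
  shows "f \<notin> clone_H"
proof
  assume "f \<in> clone_H"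
  then obtain J where J: "agree_kernel 3 (snd f) J"
    using is_f3_opr[OF f] opr_in_clone_H by metis
  have "\<forall>i\<in>J. [0, 1, 1] ! i = [1, 1, 1 :: nat] ! i"
    using agree_kernelD[OF J, of "[0, 1, 1]" "[1, 1, 1]"] is_f3_values(1)[OF f] by simp
  then have "0 \<notin> J"
    by fastforce
  moreover have "\<forall>i\<in>J. [2, 0, 2] ! i = [2, 1, 2 :: nat] ! i"
    using agree_kernelD[OF J, of "[2, 0, 2]" "[2, 1, 2]"] is_f3_values(2)[OF f] by simp
  then have "1 \<notin> J"
    by fastforce
  moreover have "\<forall>i\<in>J. [3, 3, 0] ! i = [3, 3, 1 :: nat] ! i"
    using agree_kernelD[OF J, of "[3, 3, 0]" "[3, 3, 1]"] is_f3_values(3)[OF f] by simp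
  then have "2 \<notin> J"
    by fastforce
  ultimately have "J = {}"
    using agree_kernel_subset[OF J] by (auto simp: less_Suc_eq numeral_3_eq_3 numeral_2_eq_2)
  then show False
    using agree_kernel_nonempty[OF J] by simp
qed

lemma is_f3_not_in_clone_R:
  assumes f: "is_f3 f"
  shows "f \<notin> clone_R"
proof
  assume "f \<in> clone_R"
  then obtain i where i: "i < 3" "\<forall>a b. length a = 3 \<longrightarrow> length b = 3 \<longrightarrow> a ! i \<noteq> b ! i \<longrightarrow> snd f a \<noteq> snd f b"
    using is_f3_opr[OF f] opr_in_clone_R by metis
  then consider "i = 0" | "i = 1" | "i = 2"
    by linarith
  then show False
  proof cases
    case 1
    then show False
      using i(2)[rule_format, of "[0, 1, 1]" "[1, 1, 1]"] is_f3_values(1)[OF f] by simp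
  next
    case 2
    then show False
      using i(2)[rule_format, of "[2, 0, 2]" "[2, 1, 2]"] is_f3_values(2)[OF f] by simp
  next
    case 3
    then show False
      using i(2)[rule_format, of "[3, 3, 0]" "[3, 3, 1]"] is_f3_values(3)[OF f] by simp
  qed
qed

section \<open>Collapsing finitely many disjoint cubes\<close>

definition cube :: "nat \<Rightarrow> nat list \<Rightarrow> nat set \<Rightarrow> nat list set" where
  "cube n a I = {z. length z = n \<and> (\<forall>k\<in>I. z ! k = a ! k)}"

text \<open>\<open>I \<noteq> {}\<close> excludes the whole space, on which an operation preserving
  \<noteq> cannot be constant.\<close>

definition is_cube :: "nat \<Rightarrow> nat list set \<Rightarrow> bool" where
  "is_cube n S \<longleftrightarrow> (\<exists>a I. length a = n \<and> I \<subseteq> {..<n} \<and> I \<noteq> {} \<and> S = cube n a I)"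

lemma is_cube_length: "is_cube n S \<Longrightarrow> z \<in> S \<Longrightarrow> length z = n"
  by (auto simp: is_cube_def cube_def)

lemma is_cube_nonempty: "is_cube n S \<Longrightarrow> \<exists>z. z \<in> S"
  by (auto simp: is_cube_def cube_def)

text \<open>If the two prescriptions did not contradict each other at a common coordinate, mixing
  \<open>a\<close> and \<open>b\<close> would give a common point.\<close>

lemma disjoint_cubes_coordinate:
  assumes "is_cube n S" "is_cube n T" "S \<inter> T = {}"
  obtains j s t where "j < n" "s \<noteq> t" "\<And>z. z \<in> S \<Longrightarrow> z ! j = s" "\<And>z. z \<in> T \<Longrightarrow> z ! j = t"
proof -
  obtain a I where S: "length a = n" "I \<subseteq> {..<n}" "S = cube n a I"
    using assms(1) by (auto simp: is_cube_def)
  obtain b J where T: "length b = n" "J \<subseteq> {..<n}" "T = cube n b J"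
    using assms(2) by (auto simp: is_cube_def)
  define z where "z = map (\<lambda>k. if k \<in> I then a ! k else b ! k) [0..<n]"
  have z: "z ! k = (if k \<in> I then a ! k else b ! k)" if "k < n" for k
    using that by (simp add: z_def)
  have "z \<in> S"
    using S(2) z by (auto simp: S(3) cube_def z_def)
  then have "z \<notin> T"
    using assms(3) by blast
  then obtain j where j: "j \<in> J" "z ! j \<noteq> b ! j"
    by (auto simp: T(3) cube_def z_def)
  then have "j < n" "j \<in> I" "a ! j \<noteq> b ! j"
    using T(2) z[of j] by (auto split: if_splits)
  then show thesis
    using that[of j "a ! j" "b ! j"] j(1) by (simp add: S(3) T(3) cube_def)
qed

lemma agree_kernel_exists:
  assumes "I \<subseteq> {..<n}" "I \<noteq> {}"
  shows "agree_kernel n (\<lambda>xs. list_encode (map (\<lambda>k. if k \<in> I then xs ! k else 0) [0..<n])) I"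
  using assms by (auto simp: agree_kernel_def list_encode_eq)

locale f3_clone = inj_clone +
  fixes f3 :: oper
  assumes is_f3: "is_f3 f3" and f3_in: "f3 \<in> C" and pair: "opr 2 pair_op \<in> C"
begin

lemma mem_f3:
  assumes "mem n F" "mem n G" "mem n H"
  shows "mem n (\<lambda>xs. snd f3 [F xs, G xs, H xs])"
proof -
  have "mem 3 (snd f3)"
    using f3_in is_f3_opr[OF is_f3] by simp
  then have "mem n (\<lambda>xs. snd f3 (map (\<lambda>j. (if j = 0 then F else if j = 1 then G else H) xs) [0..<3]))"
    by (rule mem_comp[OF _ mem_pos[OF assms(1)]]) (use assms in auto)
  then show ?thesis
    by (simp add: map_3)
qed

lemma f3_eqD:
  assumes "snd f3 [x, y, z] = snd f3 [x', y', z']"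
  shows "(x = x' \<and> y = y' \<and> z = z') \<or> (y = 1 \<and> z = 1 \<and> y' = 1 \<and> z' = 1) \<or>
    (x = 2 \<and> z = 2 \<and> x' = 2 \<and> z' = 2) \<or> (x = 3 \<and> y = 3 \<and> x' = 3 \<and> y' = 3)"
  using is_f3_eqD[OF is_f3 _ _ assms] by (auto simp: f3_line_def)

lemmas f3_values = is_f3_values[OF is_f3]

definition collapses :: "nat \<Rightarrow> nat list set set \<Rightarrow> (nat list \<Rightarrow> nat) \<Rightarrow> bool" where
  "collapses n \<S> K \<longleftrightarrow> mem n K \<and> (\<forall>x y. length x = n \<longrightarrow> length y = n \<longrightarrow>
    (K x = K y \<longleftrightarrow> x = y \<or> (\<exists>S\<in>\<S>. x \<in> S \<and> y \<in> S)))"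

lemma collapsesD:
  "collapses n \<S> K \<Longrightarrow> length x = n \<Longrightarrow> length y = n \<Longrightarrow> K x = K y \<longleftrightarrow> x = y \<or> (\<exists>S\<in>\<S>. x \<in> S \<and> y \<in> S)"
  by (simp add: collapses_def)

lemma collapses_rename: "collapses n \<S> K \<Longrightarrow> inj g \<Longrightarrow> collapses n \<S> (\<lambda>x. g (K x))"
  by (simp add: collapses_def mem_inj inj_eq)

lemma collapses_singleton:
  assumes S: "is_cube n S"
  obtains K where "collapses n {S} K" "\<And>x. x \<in> S \<Longrightarrow> K x = 1"
proof -
  obtain a I where aI: "length a = n" "I \<subseteq> {..<n}" "I \<noteq> {}" "S = cube n a I"
    using S by (auto simp: is_cube_def)
  then have n: "n \<ge> 1"
    by auto
  obtain G where G: "agree_kernel n G I"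
    using agree_kernel_exists[OF aI(2,3)] by blast
  obtain \<beta> :: "nat \<Rightarrow> nat" where \<beta>: "inj \<beta>" "\<beta> (G a) = 1"
    using inj_extension2[of "G a" "Suc (G a)" 1 2] by (metis n_not_Suc_n numeral_2_eq_2 One_nat_def)
  have G1: "\<beta> (G x) = 1 \<longleftrightarrow> x \<in> S" if "length x = n" for x
    using inj_eq[OF \<beta>(1), of "G x" "G a"] \<beta>(2) agree_kernelD[OF G that aI(1)] that
    by (simp add: aI(4) cube_def)
  define K where "K x = snd f3 [list_encode x, \<beta> (G x), \<beta> (G x)]" for x
  have "mem n K"
    unfolding K_def using mem_agree_kernel[OF pair agree_kernel_list_encode[OF n]] mem_agree_kernel[OF pair G]
    by (intro mem_f3 mem_inj[OF \<beta>(1)])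
  have K1: "K x = 1" if "x \<in> S" for x
  proof -
    have "\<beta> (G x) = 1"
      using G1[OF is_cube_length[OF S that]] that by simp
    then show ?thesis
      using f3_values(1) by (simp add: K_def)
  qed
  have "x = y \<or> x \<in> S \<and> y \<in> S" if "length x = n" "length y = n" "K x = K y" for x y
    using f3_eqD[OF that(3)[unfolded K_def]] G1[OF that(1)] G1[OF that(2)] by (metis list_encode_eq)
  then have "collapses n {S} K"
    unfolding collapses_def using \<open>mem n K\<close> K1 by fastforce
  then show thesis
    using that K1 by blast
qed

lemma collapses_pair:
  assumes S: "is_cube n S" and T: "is_cube n T" and ST: "S \<inter> T = {}"
  obtains K where "collapses n {S, T} K"
proof -
  obtain j s t where j: "j < n" "s \<noteq> t" "\<And>z. z \<in> S \<Longrightarrow> z ! j = s" "\<And>z. z \<in> T \<Longrightarrow> z ! j = t"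
    using disjoint_cubes_coordinate[OF assms] by metis
  obtain k2 where k2: "collapses n {S} k2" "\<And>x. x \<in> S \<Longrightarrow> k2 x = 1"
    using collapses_singleton[OF S] by metis
  obtain k where k: "collapses n {T} k" "\<And>x. x \<in> T \<Longrightarrow> k x = 1"
    using collapses_singleton[OF T] by metis
  obtain \<beta> :: "nat \<Rightarrow> nat" where \<beta>: "inj \<beta>" "\<beta> 1 = 2"
    using inj_extension2[of 1 0 2 1] by (metis n_not_Suc_n numeral_2_eq_2 One_nat_def)
  define k1 where "k1 x = \<beta> (k x)" for x
  have k1: "collapses n {T} k1" "\<And>x. x \<in> T \<Longrightarrow> k1 x = 2"
    unfolding k1_def using collapses_rename[OF k(1) \<beta>(1)] k(2) \<beta>(2) by auto
  obtain \<alpha> :: "nat \<Rightarrow> nat" where \<alpha>: "inj \<alpha>" "\<alpha> s = 1" "\<alpha> t = 2"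
    using inj_extension2[OF j(2), of 1 2] by (metis n_not_Suc_n numeral_2_eq_2 One_nat_def)
  define K where "K x = snd f3 [k1 x, k2 x, \<alpha> (x ! j)]" for x
  have "mem n K"
    unfolding K_def using k1(1) k2(1) j(1) \<alpha>(1) by (intro mem_f3 mem_inj_proj) (auto simp: collapses_def)
  have KS: "K x = 1" if "x \<in> S" for x
    using f3_values(1)[of "k1 x"] k2(2)[OF that] j(3)[OF that] \<alpha>(2) by (simp add: K_def)
  have KT: "K x = 2" if "x \<in> T" for x
    using f3_values(2)[of "k2 x"] k1(2)[OF that] j(4)[OF that] \<alpha>(3) by (simp add: K_def)
  have "x = y \<or> (\<exists>U\<in>{S, T}. x \<in> U \<and> y \<in> U)" if len: "length x = n" "length y = n" and "K x = K y" for x y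
  proof -
    have "k1 x = k1 y \<or> k2 x = k2 y"
      using f3_eqD[OF \<open>K x = K y\<close>[unfolded K_def]] by metis
    then show ?thesis
      using collapsesD[OF k1(1) len] collapsesD[OF k2(1) len] by blast
  qed
  then have "collapses n {S, T} K"
    unfolding collapses_def using \<open>mem n K\<close> KS KT by fastforce
  then show thesis
    using that by blast
qed

text \<open>On an omitted cube the other two kernels are constant and can be renamed to put it on
  its line; a cube that is not omitted is collapsed by all three. Equal values force equality of
  \<open>k1\<close> or of \<open>k2\<close>, so no further points are identified. Families with
  fewer than three cubes are the base cases.\<close>

lemma collapses_cubes:
  assumes "finite \<S>" "n \<ge> 1" "\<And>S. S \<in> \<S> \<Longrightarrow> is_cube n S"
    "\<And>S T. S \<in> \<S> \<Longrightarrow> T \<in> \<S> \<Longrightarrow> S \<noteq> T \<Longrightarrow> S \<inter> T = {}"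
  shows "\<exists>K. collapses n \<S> K"
  using assms
proof (induction "card \<S>" arbitrary: \<S> rule: less_induct)
  case less
  note cubes = less.prems(3) and disj = less.prems(4)
  show ?case
  proof (cases "\<exists>S1 S2 S3. S1 \<in> \<S> \<and> S2 \<in> \<S> \<and> S3 \<in> \<S> \<and> distinct [S1, S2, S3]")
    case True
    then obtain S1 S2 S3 where S: "S1 \<in> \<S>" "S2 \<in> \<S>" "S3 \<in> \<S>" and dist: "distinct [S1, S2, S3]"
      by blast
    have sub: "\<exists>K. collapses n (\<S> - {S}) K" if "S \<in> \<S>" for S
    proof (rule less.hyps)
      show "card (\<S> - {S}) < card \<S>"
        using that less.prems(1) by (intro psubset_card_mono) auto
    qed (use less.prems in auto)
    obtain s1 s2 s3 where s: "s1 \<in> S1" "s2 \<in> S2" "s3 \<in> S3"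
      using is_cube_nonempty[OF cubes] S by metis
    have len: "length s1 = n" "length s2 = n" "length s3 = n"
      using s S is_cube_length[OF cubes] by auto
    have uniq: "T = U" if "T \<in> \<S>" "U \<in> \<S>" "z \<in> T" "z \<in> U" for T U z
      using disj that by blast
    \<comment> \<open>Points of different cubes get different values, which can be renamed to the
      constants of two lines.\<close>
    have rename: "\<exists>K. collapses n (\<S> - {S}) K \<and> K t = v \<and> K u = w"
      if STU: "S \<in> \<S>" "T \<in> \<S>" "U \<in> \<S>" "T \<noteq> U" "t \<in> T" "u \<in> U" and "v \<noteq> w"
      for S T U t u and v w :: nat
    proof -
      obtain K where K: "collapses n (\<S> - {S}) K"
        using sub \<open>S \<in> \<S>\<close> by blast
      have "length t = n" "length u = n"
        using STU is_cube_length[OF cubes] by auto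
      have "K t \<noteq> K u"
      proof
        assume "K t = K u"
        then consider "t = u" | V where "V \<in> \<S>" "t \<in> V" "u \<in> V"
          using collapsesD[OF K \<open>length t = n\<close> \<open>length u = n\<close>] by blast
        then have "T = U"
        proof cases
          case 1
          then show ?thesis
            using uniq[OF STU(2,3,5)] STU(6) by simp
        next
          case 2
          then show ?thesis
            using uniq[OF STU(2) 2(1) STU(5) 2(2)] uniq[OF STU(3) 2(1) STU(6) 2(3)] by simp
        qed
        then show False
          using STU(4) by simp
      qed
      then obtain g :: "nat \<Rightarrow> nat" where g: "inj g" "g (K t) = v" "g (K u) = w"
        using inj_extension2[OF _ \<open>v \<noteq> w\<close>] by metis
      then show ?thesis
        using collapses_rename[OF K g(1)] by (intro exI[of _ "\<lambda>x. g (K x)"]) simp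
    qed
    obtain k1 where k1: "collapses n (\<S> - {S1}) k1" "k1 s2 = 2" "k1 s3 = 3"
      using rename[OF S(1,2,3) _ s(2,3), of 2 3] dist by auto
    obtain k2 where k2: "collapses n (\<S> - {S2}) k2" "k2 s1 = 1" "k2 s3 = 3"
      using rename[OF S(2,1,3) _ s(1,3), of 1 3] dist by auto
    obtain k3 where k3: "collapses n (\<S> - {S3}) k3" "k3 s1 = 1" "k3 s2 = 2"
      using rename[OF S(3,1,2) _ s(1,2), of 1 2] dist by auto
    define K where "K x = snd f3 [k1 x, k2 x, k3 x]" for x
    have "mem n K"
      unfolding K_def using k1(1) k2(1) k3(1) by (intro mem_f3) (auto simp: collapses_def)
    have const: "k x = k y" if "collapses n (\<S> - {S}) k" "T \<in> \<S>" "T \<noteq> S" "x \<in> T" "y \<in> T" for k S T x y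
    proof -
      have "length x = n" "length y = n"
        using that is_cube_length[OF cubes] by auto
      then show ?thesis
        using collapsesD[OF that(1)] that(2-5) by blast
    qed
    have K_const: "K x = K y" if T: "T \<in> \<S>" "x \<in> T" "y \<in> T" for T x y
    proof -
      consider "T = S1" | "T = S2" | "T = S3" | "T \<noteq> S1" "T \<noteq> S2" "T \<noteq> S3"
        by blast
      then show ?thesis
      proof cases
        case 1
        then have "k2 z = 1" "k3 z = 1" if "z \<in> T" for z
          using const[OF k2(1) T(1) _ that, of s1] const[OF k3(1) T(1) _ that, of s1] s(1) dist k2(2) k3(2)
          by auto
        then show ?thesis
          using f3_values(1) T by (simp add: K_def)
      next
        case 2
        then have "k1 z = 2" "k3 z = 2" if "z \<in> T" for z
          using const[OF k1(1) T(1) _ that, of s2] const[OF k3(1) T(1) _ that, of s2] s(2) dist k1(2) k3(3)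
          by auto
        then show ?thesis
          using f3_values(2) T by (simp add: K_def)
      next
        case 3
        then have "k1 z = 3" "k2 z = 3" if "z \<in> T" for z
          using const[OF k1(1) T(1) _ that, of s3] const[OF k2(1) T(1) _ that, of s3] s(3) dist k1(3) k2(3)
          by auto
        then show ?thesis
          using f3_values(3) T by (simp add: K_def)
      next
        case 4
        then show ?thesis
          using const[OF k1(1) T(1) _ T(2,3)] const[OF k2(1) T(1) _ T(2,3)] const[OF k3(1) T(1) _ T(2,3)]
          by (simp add: K_def)
      qed
    qed
    have "x = y \<or> (\<exists>T\<in>\<S>. x \<in> T \<and> y \<in> T)" if len: "length x = n" "length y = n" and "K x = K y" for x y
    proof -
      have "k1 x = k1 y \<or> k2 x = k2 y"
        using f3_eqD[OF \<open>K x = K y\<close>[unfolded K_def]] by metis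
      then show ?thesis
        using collapsesD[OF k1(1) len] collapsesD[OF k2(1) len] by blast
    qed
    then have "collapses n \<S> K"
      unfolding collapses_def using \<open>mem n K\<close> K_const by blast
    then show ?thesis
      by blast
  next
    case False
    consider "\<S> = {}" | S where "\<S> = {S}" | S T where "\<S> = {S, T}" "S \<noteq> T"
    proof -
      have "\<S> = {} \<or> (\<exists>S. \<S> = {S}) \<or> (\<exists>S T. \<S> = {S, T} \<and> S \<noteq> T)"
      proof (rule ccontr)
        assume *: "\<not> ?thesis"
        then obtain S where S: "S \<in> \<S>"
          by blast
        then obtain T where T: "T \<in> \<S>" "T \<noteq> S"
          using * by blast
        then obtain U where "U \<in> \<S>" "U \<noteq> S" "U \<noteq> T"
          using * S by blast
        then show False
          using False S T by auto
      qed
      then show thesis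
        using that by blast
    qed
    then show ?thesis
    proof cases
      case 1
      have "collapses n {} list_encode"
        using mem_agree_kernel[OF pair agree_kernel_list_encode[OF less.prems(2)]]
        by (simp add: collapses_def list_encode_eq)
      then show ?thesis
        using 1 by blast
    next
      case 2
      then show ?thesis
        using collapses_singleton[OF cubes] by (metis insertI1)
    next
      case 3
      then have "is_cube n S" "is_cube n T" "S \<inter> T = {}"
        using cubes disj by blast+
      from collapses_pair[OF this] show ?thesis
        using 3 by metis
    qed
  qed
qed

end

text \<open>\<open>spread\<close> enlarges a collapsed pair to a collapsed cube; the partner
  \<open>b\<close> of \<open>a\<close> with the least agreement gives the largest one. A point
  \<open>z\<close> of the class outside it, combined with a generic point \<open>d\<close> of the
  cube, would spread to a point \<open>w\<close> agreeing with \<open>a\<close> in fewer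
  coordinates.\<close>

lemma pres_eod_class_is_cube:
  assumes neq: "pres_neq n F" and eod: "pres_eod n F" and a: "length a = n"
  shows "is_cube n {z. length z = n \<and> F z = F a}"
proof -
  define agr where "agr x y = {k. k < n \<and> x ! k = y ! k}" for x y :: "nat list"
  \<comment> \<open>A generic point \<open>d j\<close> of the cube is, coordinate by coordinate, all
    equal or all distinct with \<open>x\<close> and \<open>y\<close>, so it has the value
    \<open>F x\<close>. Two generic points and an arbitrary \<open>z\<close> of the cube form such a
    triple again.\<close>
  have spread: "F z = F x"
    if len: "length x = n" "length y = n" "length z = n" and xy: "F x = F y" and z: "\<forall>k\<in>agr x y. z ! k = x ! k"
    for x y z
  proof -
    obtain M where M: "\<And>w k. w \<in> {x, y, z} \<Longrightarrow> k < length w \<Longrightarrow> w ! k < M"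
      using finite_lists_nth_bounded[of "{x, y, z}"] by blast
    have lt: "x ! k < M" "y ! k < M" "z ! k < M" if "k < n" for k
      using M that len by auto
    define d where "d j = map (\<lambda>k. if x ! k = y ! k then x ! k else M + j) [0..<n]" for j
    have d: "length (d j) = n" for j
      by (simp add: d_def)
    have "F (d j) = F x" for j
    proof -
      have "eq_or_distinct (x ! k) (y ! k) (d j ! k)" if "k < n" for k
        using that lt[OF that] by (auto simp: d_def eq_or_distinct_def)
      then have "eq_or_distinct (F x) (F y) (F (d j))"
        using eod len d unfolding pres_eod_def by blast
      then show ?thesis
        using xy by (auto simp: eq_or_distinct_def)
    qed
    moreover have "eq_or_distinct (F (d 0)) (F (d 1)) (F z)"
    proof -
      have "eq_or_distinct (d 0 ! k) (d 1 ! k) (z ! k)" if "k < n" for k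
        using that lt[OF that] z by (auto simp: d_def eq_or_distinct_def agr_def)
      then show ?thesis
        using eod len d unfolding pres_eod_def by blast
    qed
    ultimately show ?thesis
      by (auto simp: eq_or_distinct_def)
  qed
  define Q where "Q b \<longleftrightarrow> length b = n \<and> F b = F a" for b
  have "Q a"
    by (simp add: Q_def a)
  then obtain b where b: "Q b" "\<And>b'. Q b' \<Longrightarrow> card (agr a b) \<le> card (agr a b')"
    using ex_has_least_nat[of Q a "\<lambda>b. card (agr a b)"] by blast
  have b_len: "length b = n" and b_eq: "F a = F b"
    using b(1) by (auto simp: Q_def)
  define I where "I = agr a b"
  have I: "I \<subseteq> {..<n}" "finite I"
    by (auto simp: I_def agr_def)
  have in_cube: "F z = F a" if "z \<in> cube n a I" for z
    using spread[OF a b_len _ b_eq, of z] that by (simp add: cube_def I_def)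
  have "z \<in> cube n a I" if z: "length z = n" "F z = F a" for z
  proof (rule ccontr)
    assume "z \<notin> cube n a I"
    then obtain k where k: "k \<in> I" "z ! k \<noteq> a ! k"
      using z by (auto simp: cube_def)
    obtain M where M: "\<And>w k. w \<in> {a, z} \<Longrightarrow> k < length w \<Longrightarrow> w ! k < M"
      using finite_lists_nth_bounded[of "{a, z}"] by blast
    have lt: "a ! k < M" "z ! k < M" if "k < n" for k
      using M that a z by auto
    define d where "d = map (\<lambda>k. if k \<in> I then a ! k else M) [0..<n]"
    have d: "length d = n"
      by (simp add: d_def)
    have "d \<in> cube n a I"
      using I(1) by (auto simp: cube_def d_def)
    then have F_dz: "F d = F z"
      using in_cube z by simp
    define w where "w = map (\<lambda>k. if k \<in> I \<and> z ! k = a ! k then a ! k else M + 1) [0..<n]"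
    have w: "length w = n"
      by (simp add: w_def)
    have "\<forall>k\<in>agr d z. w ! k = d ! k"
    proof
      fix k assume "k \<in> agr d z"
      then have "k < n" "d ! k = z ! k"
        by (simp_all add: agr_def)
      then have k: "k < n" "(if k \<in> I then a ! k else M) = z ! k"
        by (auto simp: d_def split: if_splits)
      then have "k \<in> I" "z ! k = a ! k"
        using lt(2)[of k] by (auto split: if_splits)
      then show "w ! k = d ! k"
        using k(1) by (simp add: w_def d_def)
    qed
    then have "F w = F d"
      by (rule spread[OF d z(1) w F_dz])
    then have "Q w"
      using w F_dz z(2) by (simp add: Q_def)
    have "agr a w \<subseteq> I - {k}"
    proof
      fix l assume "l \<in> agr a w"
      then have l: "l < n" "a ! l = w ! l"
        by (auto simp: agr_def)
      have "l \<in> I \<and> z ! l = a ! l"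
      proof (rule ccontr)
        assume "\<not> (l \<in> I \<and> z ! l = a ! l)"
        then have "w ! l = M + 1"
          using l(1) by (auto simp: w_def)
        then show False
          using lt(1)[OF l(1)] l(2) by simp
      qed
      then show "l \<in> I - {k}"
        using k by auto
    qed
    then have "card (agr a w) \<le> card (I - {k})"
      using I(2) by (intro card_mono) auto
    also have "\<dots> < card I"
      using I(2) k(1) by (rule card_Diff1_less)
    finally show False
      using b(2)[OF \<open>Q w\<close>] by (simp add: I_def)
  qed
  then have "{z. length z = n \<and> F z = F a} = cube n a I"
    using in_cube by (auto simp: cube_def)
  moreover have "I \<noteq> {}"
  proof
    assume "I = {}"
    define w where "w = map (\<lambda>k. Suc (a ! k)) [0..<n]"
    have "F w = F a"
      using \<open>I = {}\<close> by (intro in_cube) (simp add: cube_def w_def)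
    moreover have "length w = n" "\<forall>k<n. w ! k \<noteq> a ! k"
      by (simp_all add: w_def)
    ultimately show False
      using neq a unfolding pres_neq_def by blast
  qed
  ultimately show ?thesis
    unfolding is_cube_def using a I(1) by blast
qed

context f3_clone
begin

text \<open>Only the classes meeting the finite set \<open>A\<close> are collapsed, which keeps the
  family of cubes finite.\<close>

lemma Pol_eod_subset: "Pol {neq_rel} \<inter> Pol {eod_rel} \<subseteq> C"
proof
  fix f assume f: "f \<in> Pol {neq_rel} \<inter> Pol {eod_rel}"
  then have "f \<in> all_ops"
    by (auto simp: Pol_def)
  then obtain n F where nF: "f = opr n F" "n \<ge> 1"
    using all_ops_cases by blast
  have F: "pres_neq n F" "pres_eod n F"
    using f by (auto simp: nF(1) opr_in_Pol_neq opr_in_Pol_eod)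
  have "mem n F"
  proof (rule mem_if_kernels[OF nF(2)])
    fix A :: "nat list set"
    assume A: "finite A" "A \<subseteq> tuples n"
    define cl where "cl a = {z. length z = n \<and> F z = F a}" for a
    have len: "length a = n" if "a \<in> A" for a
      using A(2) that by auto
    have "\<exists>K. collapses n (cl ` A) K"
    proof (rule collapses_cubes[OF _ nF(2)])
      show "finite (cl ` A)"
        using A(1) by simp
      show "is_cube n S" if "S \<in> cl ` A" for S
        using that pres_eod_class_is_cube[OF F] len by (auto simp: cl_def)
      show "S \<inter> T = {}" if "S \<in> cl ` A" "T \<in> cl ` A" "S \<noteq> T" for S T
        using that by (auto simp: cl_def)
    qed
    then obtain K where K: "collapses n (cl ` A) K"
      by blast
    have "K a = K b \<longleftrightarrow> F a = F b" if "a \<in> A" "b \<in> A" for a b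
      using collapsesD[OF K len[OF that(1)] len[OF that(2)]] that len by (auto simp: cl_def)
    then show "\<exists>G. mem n G \<and> (\<forall>a\<in>A. \<forall>b\<in>A. G a = G b \<longleftrightarrow> F a = F b)"
      using K unfolding collapses_def by blast
  qed
  then show "f \<in> C"
    by (simp add: nF)
qed

end

lemma generated_f3:
  assumes f: "is_f3 f"
  shows "generated {f} \<in> monoidal_interval injective_unary" "generated {f} = Pol {neq_rel} \<inter> Pol {eod_rel}"
proof -
  show II: "generated {f} \<in> monoidal_interval injective_unary"
    using is_f3_in_Pol_neq[OF f] by (intro generated_in_monoidal_interval) simp
  have "f \<in> generated {f}"
    using subset_generated by blast
  then have "\<not> generated {f} \<subseteq> clone_H"
    using is_f3_not_in_clone_H[OF f] by blast
  then have "generated {f} \<noteq> generated injective_unary"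
    using generated_injective_unary_subset[OF clone_H_in_monoidal_interval] by blast
  then have "opr 2 pair_op \<in> generated {f}"
    using clone_H_subset_if_nontrivial[OF II] pair_op_in_clone_H by blast
  then interpret f3_clone "generated {f}" f
    using monoidal_interval_inj_clone[OF II] f \<open>f \<in> generated {f}\<close>
    by (simp add: f3_clone_def f3_clone_axioms_def)
  have "generated {f} \<subseteq> Pol {eod_rel}"
    using is_f3_in_Pol_eod[OF f] permutations_subset_clone_H clone_H_subset_Pol_eod eod_rel_in_all_rels
    by (intro generated_minimal local_clone_Pol) auto
  then show "generated {f} = Pol {neq_rel} \<inter> Pol {eod_rel}"
    using subset_Pol_neq Pol_eod_subset by blast
qed

lemma clone_R_not_subset_Pol_eod: "\<not> clone_R \<subseteq> Pol {eod_rel}"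
proof
  assume "clone_R \<subseteq> Pol {eod_rel}"
  \<comment> \<open>Injective in direction 0; in row 0 it identifies columns 1 and 2 but keeps
    column 0 apart, which violates the relation.\<close>
  moreover have "opr 2 (bin (\<lambda>x y. prod_encode (x, min y 1))) \<in> clone_R"
    unfolding opr_in_clone_R by (intro exI[of _ 0]) (simp add: bin_def)
  ultimately have pres: "pres_eod 2 (bin (\<lambda>x y. prod_encode (x, min y 1)))"
    using opr_in_Pol_eod by blast
  have eod: "\<forall>k<2. eq_or_distinct ([0, 0] ! k) ([0, 1] ! k) ([0, 2] ! k)"
    by (auto simp: eq_or_distinct_def less_2_cases_iff)
  have "eq_or_distinct (bin (\<lambda>x y. prod_encode (x, min y 1)) [0, 0])
      (bin (\<lambda>x y. prod_encode (x, min y 1)) [0, 1]) (bin (\<lambda>x y. prod_encode (x, min y 1)) [0, 2])"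
    by (rule pres[unfolded pres_eod_def, rule_format]) (use eod in auto)
  then show False
    by (simp add: eq_or_distinct_def)
qed

lemma clone_R_clone_S:
  assumes f: "is_f3 f"
  shows "\<not> clone_R \<subseteq> generated {f}" "\<not> generated {f} \<subseteq> clone_R"
    "\<And>C. C \<in> monoidal_interval injective_unary \<Longrightarrow> C \<subseteq> generated {f} \<or> clone_R \<subseteq> C"
proof -
  show "\<not> clone_R \<subseteq> generated {f}"
    using clone_R_not_subset_Pol_eod generated_f3(2)[OF f] by blast
  show "\<not> generated {f} \<subseteq> clone_R"
    using is_f3_not_in_clone_R[OF f] subset_generated[of "{f}"] by blast
  show "C \<subseteq> generated {f} \<or> clone_R \<subseteq> C" if "C \<in> monoidal_interval injective_unary" for C
    using clone_R_subset_if_not_eod[OF that] monoidal_interval_subset_Pol_neq[OF that] generated_f3(2)[OF f]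
    by blast
qed

subsection \<open>An embedding of the power set\<close>

text \<open>
  The variables \<open>x\<^sub>k\<close> and \<open>y\<^sub>k\<close> of \<open>cycle_rel n\<close> are numbered \<open>k\<close> and \<open>n + k\<close>. The labelling
  \<open>blk n i\<close> describes the partition with blocks \<open>{y\<^sub>i}\<close>, \<open>{x\<^sub>i, x\<^sub>i\<^sub>+\<^sub>1, y\<^sub>i\<^sub>+\<^sub>1}\<close> (indices modulo \<open>n\<close>) and
  \<open>{x\<^sub>k, y\<^sub>k}\<close> otherwise; a tuple belongs to the relation if its equality pattern refines one of these.
\<close>

definition blk :: "nat \<Rightarrow> nat \<Rightarrow> nat \<Rightarrow> nat" where
  "blk n i u = (if u = i then Suc i mod n else if u = n + i then n else u mod n)"

definition cycle_rel :: "nat \<Rightarrow> rel" where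
  "cycle_rel n = (2 * n, {s. length s = 2 * n \<and>
     (\<exists>i<n. \<forall>u<2*n. \<forall>v<2*n. s ! u = s ! v \<longrightarrow> blk n i u = blk n i v)})"

text \<open>Column \<open>u\<close> of the matrix with rows \<open>blk n j\<close>. The columns of
  \<open>x\<^sub>k\<close> and \<open>y\<^sub>k\<close> differ in coordinate \<open>k\<close>
  only.\<close>

definition pt :: "nat \<Rightarrow> nat \<Rightarrow> nat list" where
  "pt n u = map (\<lambda>j. blk n j u) [0..<n]"

text \<open>Injective except that the column of \<open>y\<^sub>k\<close> is sent to the value of
  that of \<open>x\<^sub>k\<close>. Applied to the matrix, whose rows lie in
  \<open>cycle_rel n\<close>, it makes \<open>x\<^sub>i\<close> and \<open>y\<^sub>i\<close> equal
  for every \<open>i\<close>, whereas \<open>blk n i\<close> keeps them apart.\<close>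

definition cycle_op :: "nat \<Rightarrow> nat list \<Rightarrow> nat" where
  "cycle_op n z = list_encode
    (if \<exists>k<n. z = pt n (n + k) then pt n (SOME k. k < n \<and> z = pt n (n + k)) else z)"

lemma length_pt [simp]: "length (pt n u) = n"
  by (simp add: pt_def)

lemma pt_nth: "k < n \<Longrightarrow> j < n \<Longrightarrow> pt n k ! j = (if j = k then Suc k mod n else k)"
  and pt_bar_nth: "k < n \<Longrightarrow> j < n \<Longrightarrow> pt n (n + k) ! j = (if j = k then n else k)"
  by (auto simp: pt_def blk_def)

lemma pt_bar_inj: "k < n \<Longrightarrow> l < n \<Longrightarrow> pt n (n + k) = pt n (n + l) \<Longrightarrow> k = l"
  using pt_bar_nth[of k n k] pt_bar_nth[of l n k] by (auto split: if_splits)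

text \<open>The label \<open>n\<close> occurs only in the columns of the variables
  \<open>y\<^sub>l\<close>.\<close>

lemma pt_neq_bar: "k < n \<Longrightarrow> l < n \<Longrightarrow> pt n k \<noteq> pt n (n + l)"
proof
  assume kl: "k < n" "l < n" "pt n k = pt n (n + l)"
  then have "pt n k ! l = n"
    using pt_bar_nth[of l n l] by simp
  moreover have "Suc k mod n < n"
    using kl by simp
  ultimately show False
    using pt_nth[OF kl(1,2)] kl(1) by (metis less_irrefl)
qed

text \<open>Two collapsed pairs of \<open>cycle_op\<close> exclude one coordinate each and agree at
  the remaining ones; hence the shift by 3 in \<open>cycle_clone\<close>.\<close>

lemma ex_third:
  fixes k l n :: nat
  assumes "n \<ge> 3"
  shows "\<exists>j<n. j \<noteq> k \<and> j \<noteq> l"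
  using assms
  by (intro exI[of _ "if k \<noteq> 0 \<and> l \<noteq> 0 then 0 else if k \<noteq> 1 \<and> l \<noteq> 1 then 1 else 2"]) auto

lemma pt_inj:
  assumes "n \<ge> 3" "k < n" "l < n" "pt n k = pt n l"
  shows "k = l"
proof -
  obtain j where "j < n" "j \<noteq> k" "j \<noteq> l"
    using ex_third[OF assms(1)] by blast
  then have "pt n k ! j = k" "pt n l ! j = l"
    using pt_nth assms(2,3) by simp_all
  then show ?thesis
    using assms(4) by metis
qed

lemma cycle_op_pt:
  assumes "k < n"
  shows "cycle_op n (pt n k) = list_encode (pt n k)" "cycle_op n (pt n (n + k)) = list_encode (pt n k)"
proof -
  show "cycle_op n (pt n k) = list_encode (pt n k)"
    using pt_neq_bar[OF assms] by (auto simp: cycle_op_def)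
  have "(SOME l. l < n \<and> pt n (n + k) = pt n (n + l)) = k"
    using assms pt_bar_inj by (intro some_equality) auto
  then show "cycle_op n (pt n (n + k)) = list_encode (pt n k)"
    using assms by (auto simp: cycle_op_def)
qed

lemma cycle_op_other: "\<not> (\<exists>k<n. z = pt n (n + k)) \<Longrightarrow> cycle_op n z = list_encode z"
  unfolding cycle_op_def by (subst if_not_P) simp_all

lemma cycle_op_eqD:
  assumes "n \<ge> 3" "cycle_op n z = cycle_op n w" "z \<noteq> w"
  shows "\<exists>k<n. {z, w} = {pt n k, pt n (n + k)}"
proof -
  have mixed: "\<exists>k<n. {z, w} = {pt n k, pt n (n + k)}"
    if "cycle_op n z = cycle_op n w" "z = pt n (n + k)" "k < n" "\<not> (\<exists>k<n. w = pt n (n + k))" for z w k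
    using that cycle_op_pt(2)[OF \<open>k < n\<close>] cycle_op_other[OF that(4)]
    by (intro exI[of _ k]) (auto simp: list_encode_eq)
  consider k l where "k < n" "l < n" "z = pt n (n + k)" "w = pt n (n + l)"
    | k where "k < n" "z = pt n (n + k)" "\<not> (\<exists>k<n. w = pt n (n + k))"
    | k where "k < n" "w = pt n (n + k)" "\<not> (\<exists>k<n. z = pt n (n + k))"
    | "\<not> (\<exists>k<n. z = pt n (n + k))" "\<not> (\<exists>k<n. w = pt n (n + k))"
    by blast
  then show ?thesis
  proof cases
    case 1
    then have "pt n k = pt n l"
      using assms(2) cycle_op_pt(2)[of k n] cycle_op_pt(2)[of l n] by (simp add: list_encode_eq)
    then show ?thesis
      using pt_inj[OF assms(1) 1(1,2)] 1 assms(3) by simp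
  next
    case 2
    then show ?thesis
      using mixed[OF assms(2)] by blast
  next
    case 3
    then show ?thesis
      using mixed[OF assms(2)[symmetric]] by (metis insert_commute)
  next
    case 4
    then show ?thesis
      using assms(2,3) cycle_op_other by (metis list_encode_eq)
  qed
qed

lemma pt_pair_agree:
  assumes "k < n" "{z, w} = {pt n k, pt n (n + k)}" "j < n"
  shows "z ! j = w ! j \<longleftrightarrow> j \<noteq> k"
proof -
  have "Suc k mod n < n"
    using assms(1) by simp
  then have "pt n k ! j = pt n (n + k) ! j \<longleftrightarrow> j \<noteq> k"
    using pt_nth[OF assms(1,3)] pt_bar_nth[OF assms(1,3)] by auto
  moreover have "z = pt n k \<and> w = pt n (n + k) \<or> z = pt n (n + k) \<and> w = pt n k"
    using assms(2) by (auto simp: doubleton_eq_iff)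
  ultimately show ?thesis
    by auto
qed

lemma cycle_op_in_Pol_neq:
  assumes "n \<ge> 3"
  shows "opr n (cycle_op n) \<in> Pol {neq_rel}"
proof -
  have "pres_neq n (cycle_op n)"
    unfolding pres_neq_def
  proof (intro allI impI notI)
    fix a b :: "nat list"
    assume ab: "\<forall>k<n. a ! k \<noteq> b ! k" "cycle_op n a = cycle_op n b"
    have "a ! 0 \<noteq> b ! 0"
      using ab(1) assms by simp
    then obtain k where k: "k < n" "{a, b} = {pt n k, pt n (n + k)}"
      using cycle_op_eqD[OF assms ab(2)] by auto
    obtain j where "j < n" "j \<noteq> k"
      using ex_third[OF assms] by blast
    then show False
      using ab(1) pt_pair_agree[OF k] by blast
  qed
  then show ?thesis
    using assms by (simp add: opr_in_Pol_neq)
qed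

text \<open>The only variable that labelling \<open>i\<close> takes away to the block of another
  index is \<open>x\<^sub>i\<close>, which joins the index after \<open>i\<close>.\<close>

lemma blk_eqD:
  assumes "i < n" "u < 2 * n" "v < 2 * n" "blk n i u = blk n i v" "u mod n \<noteq> v mod n"
  shows "u = i \<and> v mod n = Suc i mod n \<or> v = i \<and> u mod n = Suc i mod n"
proof -
  have "x mod n < n" for x
    using assms(1) by simp
  then have "x mod n \<noteq> n" for x
    by (metis less_irrefl)
  then show ?thesis
    using assms(4,5) unfolding blk_def by (auto split: if_splits) metis
qed

lemma Suc_mod_eq: "i < n \<Longrightarrow> Suc i mod n = (if Suc i = n then 0 else Suc i)"
  by (simp add: mod_Suc)

text \<open>Joining two different indices reveals which edge of the cycle is used; two edges could
  join the same indices only in a cycle of length 2.\<close>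

lemma blk_eq_unique:
  assumes n: "n \<ge> 3" and i: "i < n" "i' < n" and uv: "u < 2 * n" "v < 2 * n" "u mod n \<noteq> v mod n"
    and eq: "blk n i u = blk n i v" "blk n i' u = blk n i' v"
  shows "i = i'"
proof (rule ccontr)
  assume "i \<noteq> i'"
  have "u = i \<and> v mod n = Suc i mod n \<or> v = i \<and> u mod n = Suc i mod n"
    "u = i' \<and> v mod n = Suc i' mod n \<or> v = i' \<and> u mod n = Suc i' mod n"
    using blk_eqD[OF i(1) uv(1,2) eq(1) uv(3)] blk_eqD[OF i(2) uv(1,2) eq(2) uv(3)] by auto
  then have "i' = Suc i mod n \<and> i = Suc i' mod n"
    using \<open>i \<noteq> i'\<close> i by auto
  then have "Suc i = n \<and> i' = 0 \<or> i' = Suc i" "Suc i' = n \<and> i = 0 \<or> i = Suc i'"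
    using Suc_mod_eq[OF i(1)] Suc_mod_eq[OF i(2)] by metis+
  then show False
    using n by presburger
qed

lemma blk_pair: "l < n \<Longrightarrow> i < n \<Longrightarrow> blk n i l = blk n i (n + l) \<longleftrightarrow> l \<noteq> i"
  by (auto simp: blk_def Suc_mod_eq)

lemma mod_double_cases:
  fixes u n :: nat
  assumes "u < 2 * n"
  shows "u = u mod n \<or> u = n + u mod n"
proof (cases "u < n")
  case False
  then have "u mod n = (u - n) mod n"
    by (simp add: le_mod_geq)
  also have "\<dots> = u - n"
    using assms False by (intro mod_less) simp
  finally show ?thesis
    using False by simp
qed simp

text \<open>
  A violation consists of \<open>m\<close> collapsed pairs, one for each coordinate; the shared entries of the
  points \<open>pt m k\<close> turn the assignment of coordinates to pairs into an injective homomorphism from the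
  directed \<open>m\<close>-cycle to the directed \<open>n\<close>-cycle.
\<close>

lemma cycle_op_violation:
  fixes q :: "nat \<Rightarrow> nat list"
  assumes mn: "m \<ge> 3" "n \<ge> 3"
    and len: "\<And>u. u < 2 * n \<Longrightarrow> length (q u) = m" and i: "\<And>j. j < m \<Longrightarrow> i j < n"
    and ker: "\<And>j u v. j < m \<Longrightarrow> u < 2 * n \<Longrightarrow> v < 2 * n \<Longrightarrow> q u ! j = q v ! j \<Longrightarrow> blk n (i j) u = blk n (i j) v"
    and bad: "\<not> (\<exists>l<n. \<forall>u<2*n. \<forall>v<2*n. cycle_op m (q u) = cycle_op m (q v) \<longrightarrow> blk n l u = blk n l v)"
  shows "m = n"
proof -
  have near: "\<exists>k<m. \<forall>j<m. j \<noteq> k \<longrightarrow> q u ! j = q v ! j" if "cycle_op m (q u) = cycle_op m (q v)" for u v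
  proof (cases "q u = q v")
    case True
    then show ?thesis
      using mn(1) by (intro exI[of _ 0]) auto
  next
    case False
    obtain k where "k < m" "{q u, q v} = {pt m k, pt m (m + k)}"
      using cycle_op_eqD[OF mn(1) \<open>cycle_op m (q u) = cycle_op m (q v)\<close> False] by blast
    then show ?thesis
      using pt_pair_agree by blast
  qed
  \<comment> \<open>By \<open>blk_eq_unique\<close>, collapsing variables of different indices
    forces one labelling on all rows other than \<open>k\<close>. Any collapsed pair agrees in such
    a row, so this labelling would witness that the result lies in the relation.\<close>
  have same_pair: "u mod n = v mod n"
    if uv: "u < 2 * n" "v < 2 * n" "cycle_op m (q u) = cycle_op m (q v)" for u v
  proof (rule ccontr)
    assume neq: "u mod n \<noteq> v mod n"
    obtain k where k: "k < m" "\<forall>j<m. j \<noteq> k \<longrightarrow> q u ! j = q v ! j"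
      using near[OF uv(3)] by blast
    obtain j0 where j0: "j0 < m" "j0 \<noteq> k"
      using ex_third[OF mn(1)] by blast
    have const: "i j = i j0" if "j < m" "j \<noteq> k" for j
      using k(2) that j0 uv(1,2)
      by (intro blk_eq_unique[OF mn(2) i i uv(1,2) neq ker ker]) auto
    have "blk n (i j0) u' = blk n (i j0) v'"
      if u'v': "u' < 2 * n" "v' < 2 * n" "cycle_op m (q u') = cycle_op m (q v')" for u' v'
    proof -
      obtain k' where k': "\<forall>j<m. j \<noteq> k' \<longrightarrow> q u' ! j = q v' ! j"
        using near[OF u'v'(3)] by blast
      obtain j where j: "j < m" "j \<noteq> k" "j \<noteq> k'"
        using ex_third[OF mn(1)] by blast
      then show ?thesis
        using ker[OF j(1) u'v'(1,2)] k' const[OF j(1,2)] by simp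
    qed
    then show False
      using bad i[OF j0(1)] by blast
  qed
  \<comment> \<open>\<open>blk n l\<close> fails as a witness, so it separates some collapsed pair.
    By \<open>same_pair\<close> the two variables have the same index, and labelling
    \<open>l\<close> separates such a pair only at index \<open>l\<close>.\<close>
  have pairs: "cycle_op m (q l) = cycle_op m (q (n + l))" if l: "l < n" for l
  proof -
    obtain u v where uv: "u < 2 * n" "v < 2 * n" "cycle_op m (q u) = cycle_op m (q v)" "blk n l u \<noteq> blk n l v"
      using bad l by blast
    define r where "r = u mod n"
    have r: "r < n"
      using l by (simp add: r_def)
    have "v mod n = r"
      using same_pair[OF uv(1-3)] by (simp add: r_def)
    then have "u = r \<or> u = n + r" "v = r \<or> v = n + r"
      using mod_double_cases[OF uv(1)] mod_double_cases[OF uv(2)] by (simp_all add: r_def)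
    moreover have "u \<noteq> v"
      using uv(4) by auto
    ultimately consider "u = r" "v = n + r" | "u = n + r" "v = r"
      by blast
    then show ?thesis
    proof cases
      case 1
      then have "r = l"
        using uv(4) blk_pair[OF r l] by auto
      then show ?thesis
        using uv(3) 1 by simp
    next
      case 2
      then have "r = l"
        using uv(4) blk_pair[OF r l] by auto
      then show ?thesis
        using uv(3) 2 by simp
    qed
  qed
  \<comment> \<open>Row \<open>j\<close> separates the two variables of index \<open>i j\<close>, so
    their columns differ at coordinate \<open>j\<close>; of the pairs collapsed by
    \<open>cycle_op\<close>, only the \<open>j\<close>-th does.\<close>
  have image: "{q (i j), q (n + i j)} = {pt m j, pt m (m + j)}" if j: "j < m" for j
  proof -
    have "blk n (i j) (i j) \<noteq> blk n (i j) (n + i j)"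
      using blk_pair[OF i[OF j] i[OF j]] by simp
    then have diff: "q (i j) ! j \<noteq> q (n + i j) ! j"
      using ker[OF j, of "i j" "n + i j"] i[OF j] by auto
    then have "q (i j) \<noteq> q (n + i j)"
      by auto
    then obtain k where k: "k < m" "{q (i j), q (n + i j)} = {pt m k, pt m (m + k)}"
      using cycle_op_eqD[OF mn(1) pairs[OF i[OF j]]] by blast
    then have "k = j"
      using pt_pair_agree[OF k j] diff by simp
    then show ?thesis
      using k by simp
  qed
  have i_inj: "j = j'" if "j < m" "j' < m" "i j = i j'" for j j'
    using pt_pair_agree[OF that(1) image[OF that(1)] that(1)]
      pt_pair_agree[OF that(2) image[OF that(2)] that(1)] that(3) by auto
  \<comment> \<open>Entry \<open>j\<close> of \<open>pt m j\<close> is the successor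
    \<open>j'\<close> of \<open>j\<close>, which is also entry \<open>j\<close> of both points of
    index \<open>j'\<close>. So row \<open>j\<close> equates a variable of index \<open>i j\<close>
    with one of index \<open>i j'\<close>, which labelling \<open>i j\<close> permits only along its
    edge.\<close>
  have step: "i (Suc j mod m) = Suc (i j) mod n" if j: "j < m" for j
  proof -
    define j' where "j' = Suc j mod m"
    have j': "j' < m" "j' \<noteq> j"
      using j mn(1) by (auto simp: j'_def Suc_mod_eq)
    obtain u where u: "u = i j \<or> u = n + i j" "q u = pt m j"
      using image[OF j] by (auto simp: doubleton_eq_iff)
    have u_lt: "u < 2 * n"
      using u(1) i[OF j] by auto
    have "q u ! j = j'"
      using u(2) pt_nth[OF j j] by (simp add: j'_def)
    moreover have "q (i j') = pt m j' \<or> q (i j') = pt m (m + j')"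
      using image[OF j'(1)] by (auto simp: doubleton_eq_iff)
    then have "q (i j') ! j = j'"
      using pt_nth[OF j'(1) j] pt_bar_nth[OF j'(1) j] j'(2) by auto
    ultimately have "blk n (i j) u = blk n (i j) (i j')"
      using ker[OF j u_lt, of "i j'"] i[OF j'(1)] by simp
    moreover have "i j' \<noteq> i j"
      using i_inj[OF j'(1) j] j'(2) by blast
    then have "blk n (i j) (i j') = i j'"
      using i[OF j'(1)] i[OF j] by (simp add: blk_def)
    moreover have "blk n (i j) u = Suc (i j) mod n \<or> blk n (i j) u = n"
      using u(1) i[OF j] by (auto simp: blk_def)
    ultimately show ?thesis
      using i[OF j'(1)] by (auto simp: j'_def)
  qed
  have walk: "i j = (i 0 + j) mod n" if "j < m" for j
    using that
  proof (induction j)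
    case 0
    then show ?case
      using i[of 0] by simp
  next
    case (Suc j)
    then have "i (Suc j) = Suc (i j) mod n"
      using step[of j] by simp
    also have "\<dots> = (i 0 + Suc j) mod n"
      using Suc by (simp add: mod_Suc_eq)
    finally show ?case .
  qed
  have "i 0 = Suc (i (m - 1)) mod n"
    using step[of "m - 1"] mn(1) by simp
  also have "\<dots> = Suc (i 0 + (m - 1)) mod n"
    using walk[of "m - 1"] mn(1) by (simp add: mod_Suc_eq)
  also have "\<dots> = (i 0 + m) mod n"
    using mn(1) by simp
  finally have "(i 0 + m) mod n = (i 0 + 0) mod n"
    using i[of 0] mn(1) by simp
  \<comment> \<open>The walk in the \<open>n\<close>-cycle closes after \<open>m\<close> steps;
    injectivity of \<open>i\<close> gives the opposite inequality.\<close>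
  then have "n dvd m"
    by (metis add_diff_cancel_left' add_0_right diff_zero le_add1 mod_eq_dvd_iff_nat)
  then have "n \<le> m"
    using mn(1) by (auto dest: dvd_imp_le)
  moreover have "m \<le> n"
  proof -
    have "inj_on i {..<m}" "i ` {..<m} \<subseteq> {..<n}"
      using i_inj i by (auto simp: inj_on_def)
    then show ?thesis
      using card_inj_on_le[of i "{..<m}" "{..<n}"] by simp
  qed
  ultimately show ?thesis
    by simp
qed

lemma cycle_op_preserves:
  assumes mn: "m \<ge> 3" "n \<ge> 3" "m \<noteq> n"
  shows "preserves (opr m (cycle_op m)) (cycle_rel n)"
  unfolding cycle_rel_def preserves_opr
proof (intro allI impI)
  fix ts :: "nat list list"
  let ?R = "{s. length s = 2 * n \<and> (\<exists>i<n. \<forall>u<2*n. \<forall>v<2*n. s ! u = s ! v \<longrightarrow> blk n i u = blk n i v)}"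
  assume ts: "length ts = m" "set ts \<subseteq> ?R"
  have "\<exists>i<n. \<forall>u<2*n. \<forall>v<2*n. ts ! j ! u = ts ! j ! v \<longrightarrow> blk n i u = blk n i v" if "j < m" for j
    using ts nth_mem[of j ts] that by blast
  then obtain i where i: "\<And>j. j < m \<Longrightarrow> i j < n"
    "\<And>j u v. j < m \<Longrightarrow> u < 2 * n \<Longrightarrow> v < 2 * n \<Longrightarrow> ts ! j ! u = ts ! j ! v \<Longrightarrow> blk n (i j) u = blk n (i j) v"
    by metis
  define q where "q u = map (\<lambda>t. t ! u) ts" for u
  have "\<exists>l<n. \<forall>u<2*n. \<forall>v<2*n. cycle_op m (q u) = cycle_op m (q v) \<longrightarrow> blk n l u = blk n l v"
  proof (rule ccontr)
    assume bad: "\<not> ?thesis"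
    have "m = n"
    proof (rule cycle_op_violation[OF mn(1,2) _ i(1) _ bad])
      show "length (q u) = m" for u
        by (simp add: q_def ts(1))
      show "blk n (i j) u = blk n (i j) v" if "j < m" "u < 2 * n" "v < 2 * n" "q u ! j = q v ! j" for j u v
        using that ts(1) by (intro i(2)) (simp_all add: q_def)
    qed
    then show False
      using mn(3) by simp
  qed
  then show "map (\<lambda>u. cycle_op m (map (\<lambda>t. t ! u) ts)) [0..<2 * n] \<in> ?R"
    by (simp add: q_def)
qed

lemma cycle_op_not_preserves:
  assumes n: "n \<ge> 3"
  shows "\<not> preserves (opr n (cycle_op n)) (cycle_rel n)"
proof
  let ?R = "{s. length s = 2 * n \<and> (\<exists>i<n. \<forall>u<2*n. \<forall>v<2*n. s ! u = s ! v \<longrightarrow> blk n i u = blk n i v)}"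
  assume pres: "preserves (opr n (cycle_op n)) (cycle_rel n)"
  \<comment> \<open>Row \<open>j\<close> lies in the relation with its own labelling as witness, and
    the columns are the points \<open>pt n u\<close>.\<close>
  define ts where "ts = map (\<lambda>j. map (\<lambda>u. blk n j u) [0..<2*n]) [0..<n]"
  have "length ts = n"
    by (simp add: ts_def)
  moreover have "map (\<lambda>u. blk n j u) [0..<2*n] \<in> ?R" if "j < n" for j
    using that by auto
  then have "set ts \<subseteq> ?R"
    by (auto simp: ts_def)
  ultimately have "map (\<lambda>u. cycle_op n (map (\<lambda>t. t ! u) ts)) [0..<2*n] \<in> ?R"
    using pres unfolding cycle_rel_def preserves_opr by blast
  moreover have "map (\<lambda>t. t ! u) ts = pt n u" if "u < 2 * n" for u
    using that by (simp add: ts_def pt_def)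
  ultimately obtain i where i: "i < n" "\<forall>u<2*n. \<forall>v<2*n. cycle_op n (pt n u) = cycle_op n (pt n v) \<longrightarrow> blk n i u = blk n i v"
    by auto
  have "blk n i i = blk n i (n + i)"
    using i(2)[rule_format, of i "n + i"] i(1) cycle_op_pt[OF i(1)] by simp
  then show False
    using blk_pair[OF i(1) i(1)] by simp
qed

lemma cycle_rel_in_all_rels: "n \<ge> 1 \<Longrightarrow> cycle_rel n \<in> all_rels"
  by (auto simp: cycle_rel_def all_rels_def)

text \<open>With an operation injective in direction \<open>j\<close>, equal results force equal
  entries in row \<open>j\<close>. So the equality pattern of the result refines that of row
  \<open>j\<close>, and \<open>cycle_rel\<close> is closed under refinement.\<close>

lemma clone_R_preserves_cycle_rel:
  assumes "f \<in> clone_R"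
  shows "preserves f (cycle_rel n)"
proof -
  obtain m F where mF: "f = opr m F" "m \<ge> 1"
    using assms clone_R_subset all_ops_cases by blast
  then obtain j where j: "j < m" "\<And>a b. length a = m \<Longrightarrow> length b = m \<Longrightarrow> a ! j \<noteq> b ! j \<Longrightarrow> F a \<noteq> F b"
    using assms opr_in_clone_R by auto
  show ?thesis
    unfolding mF(1) cycle_rel_def preserves_opr
  proof (intro allI impI)
    fix ts :: "nat list list"
    let ?R = "{s. length s = 2 * n \<and> (\<exists>i<n. \<forall>u<2*n. \<forall>v<2*n. s ! u = s ! v \<longrightarrow> blk n i u = blk n i v)}"
    assume ts: "length ts = m" "set ts \<subseteq> ?R"
    then have "ts ! j \<in> ?R"
      using j(1) nth_mem by blast
    then obtain i where i: "i < n" "\<forall>u<2*n. \<forall>v<2*n. ts ! j ! u = ts ! j ! v \<longrightarrow> blk n i u = blk n i v"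
      by blast
    have "F (map (\<lambda>t. t ! u) ts) \<noteq> F (map (\<lambda>t. t ! v) ts)" if "ts ! j ! u \<noteq> ts ! j ! v" for u v
      using that ts(1) j(1) by (intro j(2)) simp_all
    then have "\<forall>u<2*n. \<forall>v<2*n. F (map (\<lambda>t. t ! u) ts) = F (map (\<lambda>t. t ! v) ts) \<longrightarrow> blk n i u = blk n i v"
      using i(2) by blast
    then show "map (\<lambda>u. F (map (\<lambda>t. t ! u) ts)) [0..<2 * n] \<in> ?R"
      using i(1) by auto
  qed
qed

section \<open>The embedding and the cardinality\<close>

definition cycle_clone :: "nat set \<Rightarrow> oper set" where
  "cycle_clone A = Pol (insert neq_rel ((\<lambda>k. cycle_rel (k + 3)) ` A))"

lemma cycle_clone_in_interval:
  "cycle_clone A \<in> monoidal_interval injective_unary" "clone_R \<subseteq> cycle_clone A"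
proof -
  show R: "clone_R \<subseteq> cycle_clone A"
    using clone_R_subset clone_R_subset_Pol_neq clone_R_preserves_cycle_rel
    by (auto simp: cycle_clone_def Pol_def)
  show "cycle_clone A \<in> monoidal_interval injective_unary"
  proof (rule monoidal_intervalI)
    have "cycle_rel (k + 3) \<in> all_rels" for k
      by (rule cycle_rel_in_all_rels) simp
    then show "local_clone (cycle_clone A)"
      unfolding cycle_clone_def by (intro local_clone_Pol insert_subsetI image_subsetI neq_rel_in_all_rels)
    show "permutations \<subseteq> cycle_clone A"
      using R permutations_subset_clone_R by blast
    show "cycle_clone A \<subseteq> Pol {neq_rel}"
      by (auto simp: cycle_clone_def Pol_def)
  qed
qed

lemma cycle_clone_subset_iff: "cycle_clone A \<subseteq> cycle_clone B \<longleftrightarrow> B \<subseteq> A"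
proof
  assume "B \<subseteq> A"
  then show "cycle_clone A \<subseteq> cycle_clone B"
    by (auto simp: cycle_clone_def Pol_def)
next
  assume sub: "cycle_clone A \<subseteq> cycle_clone B"
  show "B \<subseteq> A"
  proof (rule subsetI, rule ccontr)
    fix n assume n: "n \<in> B" "n \<notin> A"
    let ?f = "opr (n + 3) (cycle_op (n + 3))"
    have "preserves ?f (cycle_rel (k + 3))" if "k \<in> A" for k
      using that n(2) by (intro cycle_op_preserves) auto
    moreover have "?f \<in> Pol {neq_rel}"
      by (rule cycle_op_in_Pol_neq) simp
    ultimately have "?f \<in> cycle_clone A"
      by (auto simp: cycle_clone_def Pol_def)
    then have "?f \<in> cycle_clone B"
      using sub by blast
    then have "preserves ?f (cycle_rel (n + 3))"
      using n(1) by (simp add: cycle_clone_def Pol_def)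
    then show False
      using cycle_op_not_preserves[of "n + 3"] by simp
  qed
qed

lemma reverse_powerset_embedsI:
  assumes "\<And>A. cycle_clone A \<in> P"
  shows "reverse_powerset_embeds P"
  unfolding reverse_powerset_embeds_def using assms cycle_clone_subset_iff by blast

text \<open>Finite pieces of members, coded in a countable type; since they determine a local clone,
  there are at most as many local clones as sets of natural numbers.\<close>

definition finite_restrictions :: "oper set \<Rightarrow> (nat \<times> (nat list \<times> nat) list) set" where
  "finite_restrictions C = {(n, l). \<exists>G. opr n G \<in> C \<and> (\<forall>(a, v)\<in>set l. length a = n \<and> G a = v)}"

lemma finite_restrictions_subset:
  assumes "local_clone C" "local_clone D" "finite_restrictions C \<subseteq> finite_restrictions D"
  shows "C \<subseteq> D"
proof
  fix f assume f: "f \<in> C"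
  obtain n F where nF: "f = opr n F" "n \<ge> 1"
    using f local_clone_subset[OF assms(1)] all_ops_cases by blast
  have "opr n F \<in> D"
  proof (rule local_clone_limit[OF assms(2) nF(2)])
    fix A :: "nat list set"
    assume A: "finite A" "A \<subseteq> tuples n"
    obtain l where l: "set l = A"
      using A(1) finite_list by blast
    have "(n, map (\<lambda>a. (a, F a)) l) \<in> finite_restrictions C"
      using f nF(1) l A(2) by (auto simp: finite_restrictions_def subset_iff)
    then have "(n, map (\<lambda>a. (a, F a)) l) \<in> finite_restrictions D"
      using assms(3) by blast
    then show "\<exists>G. opr n G \<in> D \<and> (\<forall>a\<in>A. G a = F a)"
      using l by (auto simp: finite_restrictions_def)
  qed
  then show "f \<in> D"
    by (simp add: nF)
qed

lemma local_clones_lepoll: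
  assumes "\<And>C. C \<in> P \<Longrightarrow> local_clone C"
  shows "P \<lesssim> (UNIV :: nat set set)"
proof -
  let ?e = "\<lambda>C. to_nat ` finite_restrictions C"
  have "inj_on ?e P"
  proof (rule inj_onI)
    fix C D
    assume CD: "C \<in> P" "D \<in> P" "?e C = ?e D"
    then have "finite_restrictions C = finite_restrictions D"
      by (simp add: inj_image_eq_iff)
    then show "C = D"
      using finite_restrictions_subset assms CD(1,2) by blast
  qed
  then show ?thesis
    unfolding lepoll_def by blast
qed

lemma eqpoll_powerset:
  assumes "\<And>C. C \<in> P \<Longrightarrow> local_clone C" "\<And>A. cycle_clone A \<in> P"
  shows "P \<approx> (UNIV :: nat set set)"
proof (rule lepoll_antisym)
  show "P \<lesssim> (UNIV :: nat set set)"
    by (rule local_clones_lepoll[OF assms(1)])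
  have "inj cycle_clone"
    by (rule injI) (metis cycle_clone_subset_iff subset_antisym order_refl)
  then show "(UNIV :: nat set set) \<lesssim> P"
    unfolding lepoll_def using assms(2) by blast
qed

section \<open>The monoid of injections and the collected statements\<close>

lemma locally_closed_injective_unary: "locally_closed injective_unary"
proof -
  have sub: "injective_unary \<subseteq> all_ops"
    using injective_unary_subset_ops by (auto simp: all_ops_def)
  show ?thesis
    unfolding locally_closed_iff[OF sub]
  proof (intro allI impI)
    fix n :: nat and F
    assume lim: "\<forall>A. finite A \<longrightarrow> A \<subseteq> tuples n \<longrightarrow> (\<exists>G. opr n G \<in> injective_unary \<and> (\<forall>a\<in>A. G a = F a))"
    \<comment> \<open>The empty set of arguments already forces arity 1; injectivity is then tested
      on two arguments at a time.\<close>
    have "\<exists>G. opr n G \<in> injective_unary"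
      using lim[rule_format, of "{}"] by auto
    then have n: "n = 1"
      by (simp add: opr_in_injective_unary)
    have "inj (\<lambda>x. F [x])"
    proof (rule injI)
      fix x y assume xy: "F [x] = F [y]"
      obtain G where "opr n G \<in> injective_unary" "\<forall>a\<in>{[x], [y]}. G a = F a"
        using lim[rule_format, of "{[x], [y]}"] n by auto
      then show "x = y"
        using xy injD[of "\<lambda>x. G [x]" x y] by (simp add: opr_in_injective_unary)
    qed
    then show "opr n F \<in> injective_unary"
      using n by (simp add: opr_in_injective_unary)
  qed
qed

lemma transformation_monoid_injective_unary: "transformation_monoid injective_unary"
  unfolding transformation_monoid_def
proof (intro conjI ballI)
  show "unary id \<in> injective_unary"
    by (simp add: injective_unary_def)
  fix f g assume "f \<in> injective_unary" "g \<in> injective_unary"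
  then obtain f' g' where fg: "inj f'" "f = unary f'" "inj g'" "g = unary g'"
    by (auto simp: injective_unary_def)
  have "op_comp 1 f [g] = unary (f' \<circ> g')"
    unfolding op_comp_eq_opr fg(2,4) unary_eq_opr by (rule opr_cong) (simp add: length_Suc_conv)
  then show "op_comp 1 f [g] \<in> injective_unary"
    using fg by (auto simp: injective_unary_def inj_compose)
qed (rule injective_unary_subset_ops)

theorem theorem13:
  defines "II \<equiv> monoidal_interval injective_unary"
  shows
    "(transformation_monoid injective_unary \<and> locally_closed injective_unary \<and>
        permutations \<subseteq> injective_unary \<and>
        (\<forall>M. transformation_monoid M \<and> locally_closed M \<and> permutations \<subseteq> M \<longrightarrow>
           injective_unary \<subseteq> M)) \<and>
     (Pol_monoid injective_unary \<in> II \<and> (\<forall>C\<in>II. C \<subseteq> Pol_monoid injective_unary) \<and>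
        Pol_monoid injective_unary = Pol {neq_rel}) \<and>
     (unique_cover II clone_H (generated injective_unary) \<and>
        (\<forall>C\<in>II. C \<noteq> generated injective_unary \<longrightarrow> clone_H \<subseteq> C) \<and>
        (\<forall>p\<in>ops 2. injective_op p \<longrightarrow> generated {p} = clone_H) \<and>
        Inv clone_H = {\<rho> \<in> all_rels. Horn_definable \<rho>}) \<and>
     (\<forall>b. bar_function b \<longrightarrow>
        unique_cover II (generated {b}) clone_H \<and>
        (\<forall>C\<in>II. C \<noteq> generated injective_unary \<and> C \<noteq> clone_H \<longrightarrow> generated {b} \<subseteq> C)) \<and>
     (\<forall>f\<^sub>3. is_f3 f\<^sub>3 \<longrightarrow>
        clone_R \<in> II \<and> generated {f\<^sub>3} \<in> II \<and>
        \<not> clone_R \<subseteq> generated {f\<^sub>3} \<and> \<not> generated {f\<^sub>3} \<subseteq> clone_R \<and>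
        (\<forall>C\<in>II. C \<subseteq> generated {f\<^sub>3} \<or> clone_R \<subseteq> C)) \<and>
     (reverse_powerset_embeds {C\<in>II. clone_R \<subseteq> C \<and> C \<subseteq> Pol_monoid injective_unary} \<and>
        II \<approx> (UNIV :: nat set set) \<and>
        {C. local_clone C \<and> permutations \<subseteq> C} \<approx> (UNIV :: nat set set) \<and>
        reverse_powerset_embeds II \<and>
        reverse_powerset_embeds {C. local_clone C \<and> permutations \<subseteq> C})"
proof -
  have sub_II: "II \<subseteq> {C. local_clone C \<and> permutations \<subseteq> C}"
    by (auto simp: II_def monoidal_interval_iff)
  have max: "Pol_monoid injective_unary \<in> II" "\<forall>C\<in>II. C \<subseteq> Pol_monoid injective_unary"
    unfolding II_def Pol_monoid_injective_unary
    using monoidal_intervalI[OF local_clone_Pol_neq permutations_subset_Pol_neq]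
      monoidal_interval_subset_Pol_neq by auto
  have cycle: "cycle_clone A \<in> II" "clone_R \<subseteq> cycle_clone A" for A
    unfolding II_def by (rule cycle_clone_in_interval)+
  show ?thesis
  proof (intro conjI)
    show "transformation_monoid injective_unary" "locally_closed injective_unary"
      "permutations \<subseteq> injective_unary"
      by (rule transformation_monoid_injective_unary locally_closed_injective_unary
          permutations_subset_injective_unary)+
    show "\<forall>M. transformation_monoid M \<and> locally_closed M \<and> permutations \<subseteq> M \<longrightarrow> injective_unary \<subseteq> M"
    proof (intro allI impI, elim conjE)
      fix M assume M: "transformation_monoid M" "locally_closed M" "permutations \<subseteq> M"
      have "M \<subseteq> all_ops"
        using M(1) by (auto simp: transformation_monoid_def all_ops_def)
      then show "injective_unary \<subseteq> M"
        using M(2,3) by (rule injective_unary_smallest)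
    qed
    show "Pol_monoid injective_unary \<in> II" "\<forall>C\<in>II. C \<subseteq> Pol_monoid injective_unary"
      by (fact max)+
    show "Pol_monoid injective_unary = Pol {neq_rel}"
      by (rule Pol_monoid_injective_unary)
    show "unique_cover II clone_H (generated injective_unary)"
      unfolding II_def by (rule unique_cover_clone_H)
    show "\<forall>C\<in>II. C \<noteq> generated injective_unary \<longrightarrow> clone_H \<subseteq> C"
      unfolding II_def using clone_H_subset_if_nontrivial by simp
    show "\<forall>p\<in>ops 2. injective_op p \<longrightarrow> generated {p} = clone_H"
      using generated_binary_injection by simp
    show "Inv clone_H = {\<rho> \<in> all_rels. Horn_definable \<rho>}"
      by (rule Inv_clone_H)
    show "\<forall>b. bar_function b \<longrightarrow> unique_cover II (generated {b}) clone_H \<and>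
        (\<forall>C\<in>II. C \<noteq> generated injective_unary \<and> C \<noteq> clone_H \<longrightarrow> generated {b} \<subseteq> C)"
      unfolding II_def using unique_cover_bar bar_function_clone(3) by simp
    show "\<forall>f\<^sub>3. is_f3 f\<^sub>3 \<longrightarrow> clone_R \<in> II \<and> generated {f\<^sub>3} \<in> II \<and>
        \<not> clone_R \<subseteq> generated {f\<^sub>3} \<and> \<not> generated {f\<^sub>3} \<subseteq> clone_R \<and>
        (\<forall>C\<in>II. C \<subseteq> generated {f\<^sub>3} \<or> clone_R \<subseteq> C)"
      unfolding II_def using clone_R_in_monoidal_interval generated_f3(1) clone_R_clone_S by simp
    show "reverse_powerset_embeds {C\<in>II. clone_R \<subseteq> C \<and> C \<subseteq> Pol_monoid injective_unary}"
      by (rule reverse_powerset_embedsI) (use cycle max(2) in simp)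
    show "II \<approx> (UNIV :: nat set set)"
      by (rule eqpoll_powerset) (use sub_II cycle(1) in auto)
    show "{C. local_clone C \<and> permutations \<subseteq> C} \<approx> (UNIV :: nat set set)"
      by (rule eqpoll_powerset) (use sub_II cycle(1) in auto)
    show "reverse_powerset_embeds II"
      by (rule reverse_powerset_embedsI) (rule cycle(1))
    show "reverse_powerset_embeds {C. local_clone C \<and> permutations \<subseteq> C}"
      by (rule reverse_powerset_embedsI) (use sub_II cycle(1) in blast)
  qed
qed

end
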